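(* Let $D$ be a connected (oriented) knot diagram with ordered crossings, let $G$ be its ordered signed Tait graph, let $w$ be the writhe of $D$ and let $k=E_+(G)-E_-(G)+2(V(G)-1)$. Then there exists a differential $\partial$ of bidegree $(-1,-1)$ on the bigraded group $\mathcal{UC}(D)=\bigoplus_{u,v}\mathcal{UC}^u_v(D)$ such that the unreduced spanning tree complex $(\mathcal{UC}^u_v(D),\partial)$ is a deformation retract of the (unreduced) Khovanov complex of $D$. In particular, $$H^{i,j}(D;\mathbb{Z})\cong H^u_v(\mathcal{UC}(D);\mathbb{Z}),\qquad u=j-i-w+1,\quad v=\frac{j}{2}-i-\frac{w-k-2}{4}.$$
   Context: **Tait graph.** A connected link diagram $D$ is checkerboard colored; its Tait graph $G$ is the planar graph with one vertex per shaded region and one edge per crossing. An edge is positive if the $A$-smoothing of its crossing joins the shaded regions, and negative otherwise. $V(G)$ is the number of vertices, $E_\pm(G)$ the number of positive/negative edges. The coloring is chosen so that $E_+(G)\ge E_-(G)$. An order on the crossings gives an order on the edges. **Activities.** Let $T$ be a spanning tree of $G$. For $e\in T$, $cut(T,e)$ is the set of edges of $G$ connecting the two components of $T\setminus e$ (including $e$); for $f\notin T$, $cyc(T,f)$ is the set of edges of the unique cycle in $T\cup f$. An edge $e\in T$ is internally active (live) if it is the lowest edge of $cut(T,e)$, else internally inactive (dead); an edge $e\notin T$ is externally active (live) if it is the lowest edge of $cyc(T,e)$, else externally inactive (dead). Write $L,D,\ell,d$ for a positive edge that is respectively internally active, internally inactive, externally active, externally inactive, and $\bar L,\bar D,\bar\ell,\bar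 d$ for the same activities of a negative edge. **Spanning tree groups.** For a spanning tree $T$ set $u(T)=\#L-\#\ell-\#\bar L+\#\bar\ell$ and $v(T)=\#L+\#D$, counting edges of $G$ by activity with respect to $T$. $\mathcal{C}^u_v(D)$ is the free abelian group on the spanning trees $T$ with $u(T)=u$, $v(T)=v$. Define $\mathcal{UC}(D)=\bigoplus_{u,v}\left(\mathcal{C}^u_v(D)\oplus\overline{\mathcal{C}}{}^{u+2}_{v+1}(D)\right)$ where $\overline{\mathcal{C}}{}^{u+2}_{v+1}(D)\cong\mathcal{C}^u_v(D)$ is placed in bidegree $(u+2,v+1)$; i.e. each spanning tree $T$ gives two generators, in bidegrees $(u(T),v(T))$ and $(u(T)+2,v(T)+1)$. **Khovanov complex (Viro's conventions).** An enhanced state of $D$ is a choice of $A$- or $B$-smoothing at each crossing together with a sign $\pm$ on each resulting circle. Let $\sigma=\#A-\#B$ (smoothings), $\tau=\#(+)-\#(-)$ (circles), $i=(w-\sigma)/2$, $j=i+w-\tau$. The Khovanov complex $C^{i,j}(D)$ is free abelian on enhanced states of degree $(i,j)$. Its differential has bidegree $(1,0)$: it is the sum, with the standard signs, over all ways of changing one $A$-smoothing to a $B$-smoothing, with merging of circles given by $(-,-)\mapsto -$, $(+,-),(-,+)\mapsto +$, $(+,+)\mapsto 0$ and splitting given by $+\mapsto(+,+)$, $-\mapsto(+,-)+(-,+)$. Its homology is $H^{i,j}(D)$; for the round unknot it is $\mathbb{Z}$ in degrees $(0,1)$ and $(0,-1)$. **Deformation retract.** A chain complex $X$ is a deformation retract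 of $Y$ if there are chain maps $r:Y\to X$, $f:X\to Y$ with $r\circ f=\mathrm{id}_X$ and a chain homotopy $F:Y\to Y$ with $\partial_YF+F\partial_Y=\mathrm{id}_Y-f\circ r$. Here the bigradings $(i,j)$ and $(u,v)$ are matched by the formulas in the claim. *)

theory Defs
  imports "HOL-Algebra.Free_Abelian_Groups" "HOL-Algebra.Elementary_Groups"
    "HOL-Library.Product_Plus"
begin

definition eqv_gen :: "'a set \<Rightarrow> 'a rel \<Rightarrow> 'a rel"
  where "eqv_gen A R = {(x, y). x \<in> A \<and> y \<in> A \<and> (x, y) \<in> (R \<union> R\<inverse>)\<^sup>*}"


section \<open>Oriented link diagrams\<close>

text \<open>
  Planar diagram codes. The four ends \<open>(c, 0), \<dots>, (c, 3)\<close> of arcs at a crossing \<open>c\<close> are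
  listed counterclockwise, starting with the incoming end of the under-strand; so the
  under-strand runs from end 0 to end 2. The over-strand runs from end 3 to end 1 at a positive
  crossing and from end 1 to end 3 at a negative one. \<open>arc_at\<close> gives the arc to which an end
  belongs. An arc without ends is a circle without crossings, so that the round unknot is
  a diagram.
\<close>

record ('c, 'a) link_diagram =
  crossings :: "'c set"
  arcs :: "'a set"
  arc_at :: "'c \<times> nat \<Rightarrow> 'a"
  pos_crossings :: "'c set"

definition arc_ends :: "('c, 'a) link_diagram \<Rightarrow> ('c \<times> nat) set"
  where "arc_ends D = crossings D \<times> {..<4}"

definition outgoing :: "('c, 'a) link_diagram \<Rightarrow> 'c \<times> nat \<Rightarrow> bool"
  where "outgoing D = (\<lambda>(c, k). k = 2 \<or> k = (if c \<in> pos_crossings D then 1 else 3))"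

definition oriented_link_diagram :: "('c, 'a) link_diagram \<Rightarrow> bool"
  where "oriented_link_diagram D \<longleftrightarrow>
    finite (crossings D) \<and> finite (arcs D) \<and> pos_crossings D \<subseteq> crossings D \<and>
    arc_at D ` arc_ends D \<subseteq> arcs D \<and>
    (\<forall>a \<in> arcs D. {e \<in> arc_ends D. arc_at D e = a} = {} \<or>
       (\<exists>!e. e \<in> arc_ends D \<and> arc_at D e = a \<and> outgoing D e) \<and>
       (\<exists>!e. e \<in> arc_ends D \<and> arc_at D e = a \<and> \<not> outgoing D e))"

definition writhe :: "('c, 'a) link_diagram \<Rightarrow> int"
  where "writhe D = (\<Sum>c \<in> crossings D. if c \<in> pos_crossings D then 1 else - 1)"

definition link_components :: "('c, 'a) link_diagram \<Rightarrow> 'a set set"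
  where "link_components D = arcs D // eqv_gen (arcs D)
    {(arc_at D (c, k), arc_at D (c, k + 2)) | c k. c \<in> crossings D \<and> k < 2}"

definition diagram_components :: "('c, 'a) link_diagram \<Rightarrow> 'a set set"
  where "diagram_components D = arcs D // eqv_gen (arcs D)
    {(arc_at D (c, k), arc_at D (c, l)) | c k l. c \<in> crossings D \<and> k < 4 \<and> l < 4}"

text \<open>
  \<open>(a, True)\<close> and \<open>(a, False)\<close> are the left and the right side of the oriented arc \<open>a\<close>.
  The corner \<open>k\<close> at a crossing lies between end \<open>k\<close> and end \<open>k + 1\<close>. Seen from the
  crossing, the counterclockwise side of an end is the left side of its arc if the arc leaves
  the crossing there, and the right side otherwise. A region of a connected diagram is
  represented by the set of arc sides on its boundary.
\<close>

definition ccw_side :: "('c, 'a) link_diagram \<Rightarrow> 'c \<times> nat \<Rightarrow> 'a \<times> bool"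
  where "ccw_side D e = (arc_at D e, outgoing D e)"

definition cw_side :: "('c, 'a) link_diagram \<Rightarrow> 'c \<times> nat \<Rightarrow> 'a \<times> bool"
  where "cw_side D e = (arc_at D e, \<not> outgoing D e)"

definition region_rel :: "('c, 'a) link_diagram \<Rightarrow> ('a \<times> bool) rel"
  where "region_rel D = eqv_gen (arcs D \<times> UNIV)
    {(ccw_side D (c, k), cw_side D (c, (k + 1) mod 4)) | c k. c \<in> crossings D \<and> k < 4}"

definition regions :: "('c, 'a) link_diagram \<Rightarrow> ('a \<times> bool) set set"
  where "regions D = (arcs D \<times> UNIV) // region_rel D"

definition corner_region :: "('c, 'a) link_diagram \<Rightarrow> 'c \<Rightarrow> nat \<Rightarrow> ('a \<times> bool) set"
  where "corner_region D c k = region_rel D `` {ccw_side D (c, k)}"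

text \<open>
  The last condition says that the code is realised by a diagram on the sphere. A connected
  diagram with \<open>n > 0\<close> crossings has \<open>2 * n\<close> arcs, and its Euler characteristic
  \<open>n - 2 * n + card (regions D)\<close> must be 2. A single circle without crossings has 2 regions.
\<close>

definition connected_link_diagram :: "('c, 'a) link_diagram \<Rightarrow> bool"
  where "connected_link_diagram D \<longleftrightarrow>
    oriented_link_diagram D \<and> card (diagram_components D) = 1 \<and>
    card (regions D) = card (crossings D) + 2"

definition connected_knot_diagram :: "('c, 'a) link_diagram \<Rightarrow> bool"
  where "connected_knot_diagram D \<longleftrightarrow>
    connected_link_diagram D \<and> card (link_components D) = 1"


section \<open>Signed multigraphs and activities\<close>

text \<open>\<open>ends_of e\<close> has two elements, or one if \<open>e\<close> is a loop. Parallel edges are allowed.\<close>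

record ('v, 'e) signed_graph =
  verts :: "'v set"
  edges :: "'e set"
  ends_of :: "'e \<Rightarrow> 'v set"
  pos_edges :: "'e set"

definition graph_components :: "('v, 'e) signed_graph \<Rightarrow> 'e set \<Rightarrow> 'v set set"
  where "graph_components G T =
    verts G // eqv_gen (verts G) {(x, y). \<exists>e \<in> T. ends_of G e = {x, y}}"

text \<open>The length of the cycle may be 1 (a loop) or 2 (two parallel edges).\<close>

definition is_cycle :: "('v, 'e) signed_graph \<Rightarrow> 'e set \<Rightarrow> bool"
  where "is_cycle G C \<longleftrightarrow> (\<exists>xs es. es \<noteq> [] \<and> length xs = length es \<and>
    distinct xs \<and> distinct es \<and> set xs \<subseteq> verts G \<and> set es \<subseteq> edges G \<and> set es = C \<and>
    (\<forall>i < length es. ends_of G (es ! i) = {xs ! i, xs ! (Suc i mod length es)}))"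

definition spanning_tree :: "('v, 'e) signed_graph \<Rightarrow> 'e set \<Rightarrow> bool"
  where "spanning_tree G T \<longleftrightarrow>
    T \<subseteq> edges G \<and> card (graph_components G T) = 1 \<and> (\<forall>C \<subseteq> T. \<not> is_cycle G C)"

definition cut :: "('v, 'e) signed_graph \<Rightarrow> 'e set \<Rightarrow> 'e \<Rightarrow> 'e set"
  where "cut G T e = {f \<in> edges G. \<exists>A \<in> graph_components G (T - {e}).
    \<exists>B \<in> graph_components G (T - {e}). A \<noteq> B \<and> (\<exists>x \<in> A. \<exists>y \<in> B. ends_of G f = {x, y})}"

definition cyc :: "('v, 'e) signed_graph \<Rightarrow> 'e set \<Rightarrow> 'e \<Rightarrow> 'e set"
  where "cyc G T f = (THE C. is_cycle G C \<and> C \<subseteq> T \<union> {f})"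

definition live :: "('v, 'e::linorder) signed_graph \<Rightarrow> 'e set \<Rightarrow> 'e \<Rightarrow> bool"
  where "live G T e \<longleftrightarrow> (\<forall>f \<in> (if e \<in> T then cut G T e else cyc G T e). e \<le> f)"

text \<open>
  The suffix \<open>L\<close>, \<open>D\<close>, \<open>l\<close> stands for internally active, internally inactive and externally
  active; \<open>bar\<close> marks negative edges.
\<close>

definition act_L :: "('v, 'e::linorder) signed_graph \<Rightarrow> 'e set \<Rightarrow> 'e set"
  where "act_L G T = {e \<in> edges G. e \<in> pos_edges G \<and> e \<in> T \<and> live G T e}"

definition act_D :: "('v, 'e::linorder) signed_graph \<Rightarrow> 'e set \<Rightarrow> 'e set"
  where "act_D G T = {e \<in> edges G. e \<in> pos_edges G \<and> e \<in> T \<and> \<not> live G T e}"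

definition act_l :: "('v, 'e::linorder) signed_graph \<Rightarrow> 'e set \<Rightarrow> 'e set"
  where "act_l G T = {e \<in> edges G. e \<in> pos_edges G \<and> e \<notin> T \<and> live G T e}"

definition act_Lbar :: "('v, 'e::linorder) signed_graph \<Rightarrow> 'e set \<Rightarrow> 'e set"
  where "act_Lbar G T = {e \<in> edges G. e \<notin> pos_edges G \<and> e \<in> T \<and> live G T e}"

definition act_lbar :: "('v, 'e::linorder) signed_graph \<Rightarrow> 'e set \<Rightarrow> 'e set"
  where "act_lbar G T = {e \<in> edges G. e \<notin> pos_edges G \<and> e \<notin> T \<and> live G T e}"

definition tree_u :: "('v, 'e::linorder) signed_graph \<Rightarrow> 'e set \<Rightarrow> int"
  where "tree_u G T = int (card (act_L G T)) - int (card (act_l G T))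
    - int (card (act_Lbar G T)) + int (card (act_lbar G T))"

definition tree_v :: "('v, 'e::linorder) signed_graph \<Rightarrow> 'e set \<Rightarrow> int"
  where "tree_v G T = int (card (act_L G T)) + int (card (act_D G T))"

definition num_pos :: "('v, 'e) signed_graph \<Rightarrow> int"
  where "num_pos G = int (card (edges G \<inter> pos_edges G))"

definition num_neg :: "('v, 'e) signed_graph \<Rightarrow> int"
  where "num_neg G = int (card (edges G - pos_edges G))"


section \<open>The Tait graph\<close>

definition checkerboard :: "('c, 'a) link_diagram \<Rightarrow> ('a \<times> bool) set set \<Rightarrow> bool"
  where "checkerboard D S \<longleftrightarrow> S \<subseteq> regions D \<and>
    (\<forall>a \<in> arcs D. (region_rel D `` {(a, True)} \<in> S) \<noteq> (region_rel D `` {(a, False)} \<in> S))"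

text \<open>
  The A-smoothing joins the two regions swept out when the over-strand is turned
  counterclockwise: those at the corners 1 and 3.
\<close>

definition tait_graph ::
    "('c, 'a) link_diagram \<Rightarrow> ('a \<times> bool) set set \<Rightarrow> (('a \<times> bool) set, 'c) signed_graph"
  where "tait_graph D S =
    \<lparr>verts = S, edges = crossings D,
     ends_of = (\<lambda>c. corner_region D c ` {..<4} \<inter> S),
     pos_edges = {c \<in> crossings D. {corner_region D c 1, corner_region D c 3} \<subseteq> S}\<rparr>"


section \<open>Bigraded free abelian groups\<close>

record 'g bigraded_basis =
  gens :: "'g set"
  bideg :: "'g \<Rightarrow> int \<times> int"

definition total_group :: "'g bigraded_basis \<Rightarrow> ('g \<Rightarrow>\<^sub>0 int) monoid"
  where "total_group X = free_Abelian_group (gens X)"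

definition summand :: "'g bigraded_basis \<Rightarrow> int \<times> int \<Rightarrow> ('g \<Rightarrow>\<^sub>0 int) monoid"
  where "summand X p = free_Abelian_group {g \<in> gens X. bideg X g = p}"

text \<open>
  Homomorphisms that send bidegree \<open>p\<close> into the sum of the bidegrees related to \<open>p\<close> by \<open>R\<close>;
  in particular to 0 if there is none.
\<close>

definition graded_hom :: "'g bigraded_basis \<Rightarrow> 'h bigraded_basis \<Rightarrow>
    (int \<times> int \<Rightarrow> int \<times> int \<Rightarrow> bool) \<Rightarrow> (('g \<Rightarrow>\<^sub>0 int) \<Rightarrow> ('h \<Rightarrow>\<^sub>0 int)) set"
  where "graded_hom X Y R = {h \<in> hom (total_group X) (total_group Y).
    \<forall>p. \<forall>x \<in> carrier (summand X p). \<forall>g \<in> Poly_Mapping.keys (h x). R p (bideg Y g)}"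

definition differential ::
    "'g bigraded_basis \<Rightarrow> int \<times> int \<Rightarrow> (('g \<Rightarrow>\<^sub>0 int) \<Rightarrow> ('g \<Rightarrow>\<^sub>0 int)) \<Rightarrow> bool"
  where "differential X s d \<longleftrightarrow>
    d \<in> graded_hom X X (\<lambda>p q. q = p + s) \<and> (\<forall>x \<in> carrier (total_group X). d (d x) = 0)"

definition homology :: "'g bigraded_basis \<Rightarrow> int \<times> int \<Rightarrow> (('g \<Rightarrow>\<^sub>0 int) \<Rightarrow> ('g \<Rightarrow>\<^sub>0 int)) \<Rightarrow>
    int \<times> int \<Rightarrow> ('g \<Rightarrow>\<^sub>0 int) set monoid"
  where "homology X s d p =
    (summand X p)\<lparr>carrier := kernel (summand X p) (summand X (p + s)) d\<rparr>
      Mod (d ` carrier (summand X (p - s)))"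

text \<open>
  The complex \<open>(X, dX)\<close> is a deformation retract of \<open>(Y, dY)\<close>, where \<open>s\<close> and \<open>t\<close> are the
  bidegrees of the differentials and \<open>R q p\<close> says that bidegree \<open>q\<close> of \<open>Y\<close> corresponds to
  bidegree \<open>p\<close> of \<open>X\<close>.
\<close>

definition deformation_retract :: "(int \<times> int \<Rightarrow> int \<times> int \<Rightarrow> bool) \<Rightarrow>
    'g bigraded_basis \<Rightarrow> int \<times> int \<Rightarrow> (('g \<Rightarrow>\<^sub>0 int) \<Rightarrow> ('g \<Rightarrow>\<^sub>0 int)) \<Rightarrow>
    'h bigraded_basis \<Rightarrow> int \<times> int \<Rightarrow> (('h \<Rightarrow>\<^sub>0 int) \<Rightarrow> ('h \<Rightarrow>\<^sub>0 int)) \<Rightarrow> bool"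
  where "deformation_retract R X s dX Y t dY \<longleftrightarrow>
    differential X s dX \<and> differential Y t dY \<and>
    (\<exists>r f F. r \<in> graded_hom Y X R \<and> f \<in> graded_hom X Y (\<lambda>p q. R q p) \<and>
       F \<in> graded_hom Y Y (\<lambda>p q. q = p - t) \<and>
       (\<forall>y \<in> carrier (total_group Y). r (dY y) = dX (r y)) \<and>
       (\<forall>x \<in> carrier (total_group X). f (dX x) = dY (f x)) \<and>
       (\<forall>x \<in> carrier (total_group X). r (f x) = x) \<and>
       (\<forall>y \<in> carrier (total_group Y). dY (F y) + F (dY y) = y - f (r y)))"


section \<open>The Khovanov complex\<close>

text \<open>
  A smoothing of all crossings is given by the set \<open>B\<close> of the crossings with a B-smoothing, and
  a circle by the set of arcs on it. The A-smoothing connects end 0 to 1 and 2 to 3, the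
  B-smoothing connects 0 to 3 and 1 to 2.
\<close>

definition smoothing_pairs :: "bool \<Rightarrow> (nat \<times> nat) set"
  where "smoothing_pairs b = (if b then {(0, 3), (1, 2)} else {(0, 1), (2, 3)})"

definition circles :: "('c, 'a) link_diagram \<Rightarrow> 'c set \<Rightarrow> 'a set set"
  where "circles D B = arcs D // eqv_gen (arcs D)
    {(arc_at D (c, k), arc_at D (c, l)) | c k l.
       c \<in> crossings D \<and> (k, l) \<in> smoothing_pairs (c \<in> B)}"

text \<open>\<open>(B, P)\<close> is the enhanced state with smoothing \<open>B\<close> and set \<open>P\<close> of positive circles.\<close>

type_synonym ('c, 'a) enhanced_state = "'c set \<times> 'a set set"

definition enhanced_states :: "('c, 'a) link_diagram \<Rightarrow> ('c, 'a) enhanced_state set"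
  where "enhanced_states D = {(B, P). B \<subseteq> crossings D \<and> P \<subseteq> circles D B}"

definition state_sigma :: "('c, 'a) link_diagram \<Rightarrow> ('c, 'a) enhanced_state \<Rightarrow> int"
  where "state_sigma D = (\<lambda>(B, P). int (card (crossings D - B)) - int (card B))"

definition state_tau :: "('c, 'a) link_diagram \<Rightarrow> ('c, 'a) enhanced_state \<Rightarrow> int"
  where "state_tau D = (\<lambda>(B, P). int (card P) - int (card (circles D B - P)))"

text \<open>The division is exact: both terms have the parity of the number of crossings.\<close>

definition state_i :: "('c, 'a) link_diagram \<Rightarrow> ('c, 'a) enhanced_state \<Rightarrow> int"
  where "state_i D x = (writhe D - state_sigma D x) div 2"

definition state_j :: "('c, 'a) link_diagram \<Rightarrow> ('c, 'a) enhanced_state \<Rightarrow> int"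
  where "state_j D x = state_i D x + writhe D - state_tau D x"

definition khovanov_group :: "('c, 'a) link_diagram \<Rightarrow> ('c, 'a) enhanced_state bigraded_basis"
  where "khovanov_group D =
    \<lparr>gens = enhanced_states D, bideg = (\<lambda>x. (state_i D x, state_j D x))\<rparr>"

text \<open>
  Sign rules for passing from the circles \<open>Old\<close> with positive ones \<open>P\<close> to the circles \<open>New\<close>
  with positive ones \<open>Q\<close>; the first disjunct is a merge, the second a split.
\<close>

definition sign_rule :: "'x set \<Rightarrow> 'x set \<Rightarrow> 'x set \<Rightarrow> 'x set \<Rightarrow> bool"
  where "sign_rule Old P New Q \<longleftrightarrow>
    (\<exists>x y z. x \<noteq> y \<and> Old = {x, y} \<and> New = {z} \<and>
       (x \<notin> P \<and> y \<notin> P \<and> z \<notin> Q \<or> (x \<in> P) \<noteq> (y \<in> P) \<and> z \<in> Q)) \<or>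
    (\<exists>x y z. y \<noteq> z \<and> Old = {x} \<and> New = {y, z} \<and>
       (x \<in> P \<and> y \<in> Q \<and> z \<in> Q \<or> x \<notin> P \<and> (y \<in> Q) \<noteq> (z \<in> Q)))"

definition state_targets ::
    "('c, 'a) link_diagram \<Rightarrow> ('c, 'a) enhanced_state \<Rightarrow> 'c \<Rightarrow> ('c, 'a) enhanced_state set"
  where "state_targets D = (\<lambda>(B, P) c. {(insert c B, Q) | Q.
    Q \<subseteq> circles D (insert c B) \<and> Q \<inter> circles D B = P \<inter> circles D (insert c B) \<and>
    sign_rule (circles D B - circles D (insert c B)) P (circles D (insert c B) - circles D B) Q})"

definition khovanov_d :: "('c::linorder, 'a) link_diagram \<Rightarrow>
    (('c, 'a) enhanced_state \<Rightarrow>\<^sub>0 int) \<Rightarrow> (('c, 'a) enhanced_state \<Rightarrow>\<^sub>0 int)"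
  where "khovanov_d D = frag_extend (\<lambda>x. \<Sum>c \<in> crossings D - fst x.
    frag_cmul ((- 1) ^ card {b \<in> fst x. b < c}) (\<Sum>y \<in> state_targets D x c. frag_of y))"


section \<open>The unreduced spanning tree group\<close>

text \<open>\<open>(T, False)\<close> and \<open>(T, True)\<close> are the generators in the lower and the upper bidegree.\<close>

definition UC :: "('v, 'e::linorder) signed_graph \<Rightarrow> ('e set \<times> bool) bigraded_basis"
  where "UC G =
    \<lparr>gens = {T. spanning_tree G T} \<times> UNIV,
     bideg = (\<lambda>(T, b). if b then (tree_u G T + 2, tree_v G T + 1) else (tree_u G T, tree_v G T))\<rparr>"

definition bidegrees_match :: "int \<Rightarrow> int \<Rightarrow> int \<times> int \<Rightarrow> int \<times> int \<Rightarrow> bool"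
  where "bidegrees_match w k = (\<lambda>(i, j) (u, v). u = j - i - w + 1 \<and>
    (of_int v :: rat) = of_int j / 2 - of_int i - of_int (w - k - 2) / 4)"

end

theory Submission
  imports Defs
begin

text \<open>
  The proof is an acyclic matching on the whole Khovanov complex. A state determines a subgraph of
  the Tait graph, and by the Euler formula it has a single circle exactly if the subgraph is a
  spanning tree. Every state arises in exactly one way from such a state \<open>T\<close> by changing smoothings
  at live edges of \<open>T\<close>, since the highest edge at which two spanning trees differ is dead in both.
  The live edges of \<open>T\<close> do not cross each other, so each change of the smoothing at a live edge
  splits off one circle, on the side away from a base point of the diagram. In the two-term complex
  of such an edge, the component of the differential between the unchanged smoothing and one of the
  signs of the new circle is the identity. Matching along the first edge where this cancellation is
  possible leaves two states for each tree: all live edges are changed, the signs of the new circles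
  are prescribed, and the circle through the base point has an arbitrary sign. The part of the
  differential that respects the matching is unitriangular, because the differential either passes
  to a later tree or moves positive signs towards the base point.
\<close>

section \<open>Acyclic matchings\<close>

text \<open>A checkerboard coloring orients every arc with the shaded region on its left, and every
  smoothing respects these orientations. Circles are therefore orbits of a permutation of the arcs,
  and a change of smoothing multiplies it by a transposition. So a change always splits or merges
  and never turns one circle into one circle. This and connectedness are all that
  \<open>smoothing_cube\<close> records; the differential, the intervals and the matching are
  treated on that basis alone. Activities enter as exchanges: an edge is dead exactly if a lower
  edge can be exchanged with it to give another tree. This form covers internal and external
  activity at once and makes sense for states before any graph is mentioned. Cancelling within each
  interval separately would not be enough, because the differential also passes between intervals.
  The cancellation is therefore done for all intervals at once, by inverting a triangular block with
  diagonal entries 1 and -1 over the integers. The shift (2, 1) comes from the circle through the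
  base point: making it negative lowers tau by 2, which raises j by 2 at fixed i, hence u by 2 and v
  by 1.\<close>

lemma lookup_frag_sum: "Poly_Mapping.lookup (sum f I) z = (\<Sum>i\<in>I. Poly_Mapping.lookup (f i) z)"
  by (induction I rule: infinite_finite_induct) (auto simp: lookup_add)

text \<open>\<open>frag_induction\<close> builds an element from generators by differences, and zero
  is 0 - 0; so compatibility with subtraction is the convenient form of additivity.\<close>

lemma frag_additive_eqI:
  fixes f g :: "('a \<Rightarrow>\<^sub>0 int) \<Rightarrow> ('b \<Rightarrow>\<^sub>0 int)"
  assumes "Poly_Mapping.keys c \<subseteq> S"
    and "\<And>a b. f (a - b) = f a - f b" and "\<And>a b. g (a - b) = g a - g b"
    and "\<And>x. x \<in> S \<Longrightarrow> f (frag_of x) = g (frag_of x)"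
  shows "f c = g c"
  using assms(1)
proof (induction c rule: frag_induction)
  case zero
  then show ?case using assms(2,3)[of 0 0] by simp
qed (use assms in auto)

lemma keys_frag_extend_subset:
  assumes "\<And>x. x \<in> Poly_Mapping.keys c \<Longrightarrow> Poly_Mapping.keys (f x) \<subseteq> Z"
  shows "Poly_Mapping.keys (frag_extend f c) \<subseteq> Z"
  using keys_frag_extend[of f c] assms by blast

lemma keys_frag_extendE:
  assumes "k \<in> Poly_Mapping.keys (frag_extend f c)"
  obtains x where "x \<in> Poly_Mapping.keys c" "k \<in> Poly_Mapping.keys (f x)"
  using assms keys_frag_extend[of f c] by blast

lemma keys_sum_subset:
  assumes "\<And>i. i \<in> I \<Longrightarrow> Poly_Mapping.keys (f i) \<subseteq> Z"
  shows "Poly_Mapping.keys (sum f I) \<subseteq> Z"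
  using keys_sum[of f I] assms by blast

lemma graded_homI:
  assumes "\<And>a b. h (a - b) = h a - h b"
    and "\<And>x. Poly_Mapping.keys x \<subseteq> gens X \<Longrightarrow> Poly_Mapping.keys (h x) \<subseteq> gens Y"
    and "\<And>p x g. Poly_Mapping.keys x \<subseteq> {k \<in> gens X. bideg X k = p} \<Longrightarrow>
      g \<in> Poly_Mapping.keys (h x) \<Longrightarrow> R p (bideg Y g)"
  shows "h \<in> graded_hom X Y R"
proof -
  have "h 0 = 0" using assms(1)[of 0 0] by simp
  then have "h (- b) = - h b" for b using assms(1)[of 0 b] by simp
  then have "h (a + b) = h a + h b" for a b
    using assms(1)[of a "- b"] by simp
  then show ?thesis
    using assms by (auto simp: graded_hom_def hom_def total_group_def summand_def)
qed

lemma graded_hom_add: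
  assumes "h \<in> graded_hom X Y R" "Poly_Mapping.keys a \<subseteq> gens X" "Poly_Mapping.keys b \<subseteq> gens X"
  shows "h (a + b) = h a + h b"
  using assms hom_frag_add[of h "gens X" "gens Y"]
  by (auto simp: graded_hom_def total_group_def)

lemma graded_hom_keys:
  assumes "h \<in> graded_hom X Y R" "Poly_Mapping.keys a \<subseteq> gens X"
  shows "Poly_Mapping.keys (h a) \<subseteq> gens Y"
  using assms hom_in_carrier[of h "free_Abelian_group (gens X)" "free_Abelian_group (gens Y)" a]
  by (auto simp: graded_hom_def total_group_def)

lemma graded_hom_bideg:
  assumes "h \<in> graded_hom X Y R" "Poly_Mapping.keys a \<subseteq> {k \<in> gens X. bideg X k = p}"
    "g \<in> Poly_Mapping.keys (h a)"
  shows "R p (bideg Y g)"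
proof -
  have "a \<in> carrier (summand X p)" using assms(2) by (simp add: summand_def)
  then show ?thesis using assms(1,3) unfolding graded_hom_def by blast
qed

text \<open>Discrete Morse theory in algebraic form. \<open>unit\<close> and \<open>lower\<close>
  make the block of the differential from sources to targets triangular with invertible diagonal,
  which is what Gaussian elimination of this block requires over the integers; well-foundedness of
  \<open>r\<close> stands in for finiteness.\<close>

locale acyclic_matching =
  fixes Y :: "'h bigraded_basis" and t :: "int \<times> int" and \<delta> :: "'h \<Rightarrow> 'h \<Rightarrow>\<^sub>0 int"
    and J :: "'j set" and src tgt :: "'j \<Rightarrow> 'h" and r :: "'j rel"
    and X :: "'g bigraded_basis" and \<kappa> :: "'g \<Rightarrow> 'h"
  assumes differential_Y: "differential Y t (frag_extend \<delta>)"
    and inj_src: "inj_on src J" and inj_tgt: "inj_on tgt J" and inj_crit: "inj_on \<kappa> (gens X)"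
    and cover: "gens Y = src ` J \<union> tgt ` J \<union> \<kappa> ` gens X"
    and disjoint: "src ` J \<inter> tgt ` J = {}" "src ` J \<inter> \<kappa> ` gens X = {}"
      "tgt ` J \<inter> \<kappa> ` gens X = {}"
    and wf_r: "wf r"
    and unit: "j \<in> J \<Longrightarrow> Poly_Mapping.lookup (\<delta> (src j)) (tgt j) \<in> {1, - 1}"
    and lower: "i \<in> J \<Longrightarrow> j \<in> J \<Longrightarrow> i \<noteq> j \<Longrightarrow>
      Poly_Mapping.lookup (\<delta> (src j)) (tgt i) \<noteq> 0 \<Longrightarrow> (i, j) \<in> r"
begin

abbreviation d where "d \<equiv> frag_extend \<delta>"

abbreviation coefficient :: "'j \<Rightarrow> 'j \<Rightarrow> int"
  where "coefficient j i \<equiv> Poly_Mapping.lookup (\<delta> (src j)) (tgt i)"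

text \<open>
  \<open>\<phi>\<close> inverts the component of the differential from the sources to the targets. This makes
  \<open>e = 1 - d \<phi> - \<phi> d\<close> an idempotent chain map that vanishes on the sources and has no component in
  the targets, so that its image is isomorphic to the span of the critical generators.
\<close>

definition below :: "'j \<Rightarrow> 'j set"
  where "below j = {i \<in> J. i \<noteq> j \<and> coefficient j i \<noteq> 0}"

text \<open>Back substitution: the preimage of \<open>tgt j\<close> under the triangular block. The
  diagonal entry is its own inverse, so it appears as a factor instead of a quotient.\<close>

definition \<psi> :: "'j \<Rightarrow> 'h \<Rightarrow>\<^sub>0 int"
  where "\<psi> = wfrec r (\<lambda>\<psi> j. frag_cmul (coefficient j j)
    (frag_of (src j) - (\<Sum>i\<in>below j. frag_cmul (coefficient j i) (\<psi> i))))"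

definition \<phi> :: "('h \<Rightarrow>\<^sub>0 int) \<Rightarrow> ('h \<Rightarrow>\<^sub>0 int)"
  where "\<phi> = frag_extend (\<lambda>y. if y \<in> tgt ` J then \<psi> (inv_into J tgt y) else 0)"

definition \<pi> :: "'h set \<Rightarrow> ('h \<Rightarrow>\<^sub>0 int) \<Rightarrow> ('h \<Rightarrow>\<^sub>0 int)"
  where "\<pi> Z = frag_extend (\<lambda>y. if y \<in> Z then frag_of y else 0)"

lemma below_r: "j \<in> J \<Longrightarrow> i \<in> below j \<Longrightarrow> (i, j) \<in> r"
  using lower by (auto simp: below_def)

text \<open>Distinct lower indices have distinct targets in the finite support of
  \<open>\<delta> (src j)\<close>, so the recursion only meets finite sums even if \<open>J\<close>
  is infinite.\<close>

lemma finite_below: "finite (below j)"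
proof -
  have "tgt ` below j \<subseteq> Poly_Mapping.keys (\<delta> (src j))"
    by (auto simp: below_def in_keys_iff)
  moreover have "inj_on tgt (below j)"
    by (rule inj_on_subset[OF inj_tgt]) (auto simp: below_def)
  ultimately show ?thesis
    by (metis finite_keys finite_subset finite_imageD)
qed

lemma \<psi>_eq:
  assumes "j \<in> J"
  shows "\<psi> j = frag_cmul (coefficient j j)
    (frag_of (src j) - (\<Sum>i\<in>below j. frag_cmul (coefficient j i) (\<psi> i)))"
proof -
  have "\<psi> j = frag_cmul (coefficient j j)
    (frag_of (src j) - (\<Sum>i\<in>below j. frag_cmul (coefficient j i) (Wfrec.cut \<psi> r j i)))"
    using wfrec[OF wf_r] unfolding \<psi>_def by fastforce
  also have "(\<Sum>i\<in>below j. frag_cmul (coefficient j i) (Wfrec.cut \<psi> r j i)) =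
    (\<Sum>i\<in>below j. frag_cmul (coefficient j i) (\<psi> i))"
    using below_r[OF assms] by (intro sum.cong) (auto simp: Wfrec.cut_def)
  finally show ?thesis .
qed

lemma coefficient_unit: "j \<in> J \<Longrightarrow> coefficient j j * coefficient j j = 1"
  using unit[of j] by auto

text \<open>Expands a map that only sees targets along one row of the block. Both inverse laws for
  \<phi> use it, once for \<phi> itself and once for the projection to the targets.\<close>

lemma sum_targets:
  assumes "j \<in> J" and "\<And>y. y \<notin> tgt ` J \<Longrightarrow> h y = 0"
  shows "frag_extend h (\<delta> (src j)) = frag_cmul (coefficient j j) (h (tgt j)) +
    (\<Sum>i\<in>below j. frag_cmul (coefficient j i) (h (tgt i)))"
proof -
  let ?I = "insert j (below j)"
  have "tgt ` ?I \<subseteq> Poly_Mapping.keys (\<delta> (src j))"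
    using coefficient_unit[OF assms(1)] by (auto simp: below_def in_keys_iff)
  moreover have "h y = 0" if "y \<in> Poly_Mapping.keys (\<delta> (src j)) - tgt ` ?I" for y
  proof (rule assms(2), rule notI)
    assume "y \<in> tgt ` J"
    then obtain i where "i \<in> J" "y = tgt i" by blast
    with that show False by (auto simp: below_def in_keys_iff)
  qed
  ultimately have "frag_extend h (\<delta> (src j)) =
      (\<Sum>y\<in>tgt ` ?I. frag_cmul (Poly_Mapping.lookup (\<delta> (src j)) y) (h y))"
    unfolding frag_extend_def by (intro sum.mono_neutral_right) auto
  also have "\<dots> = (\<Sum>i\<in>?I. frag_cmul (coefficient j i) (h (tgt i)))"
  proof -
    have "inj_on tgt ?I"
      by (rule inj_on_subset[OF inj_tgt]) (use assms(1) in \<open>auto simp: below_def\<close>)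
    then show ?thesis by (simp only: sum.reindex o_def)
  qed
  also have "\<dots> = frag_cmul (coefficient j j) (h (tgt j)) +
    (\<Sum>i\<in>below j. frag_cmul (coefficient j i) (h (tgt i)))"
    using finite_below by (subst sum.insert) (auto simp: below_def)
  finally show ?thesis .
qed

lemma d_diff [simp]: "d (a - b) = d a - d b" "d 0 = 0"
  by (auto simp: frag_extend_diff)
lemma \<phi>_diff [simp]: "\<phi> (a - b) = \<phi> a - \<phi> b" "\<phi> 0 = 0"
  by (auto simp: frag_extend_diff \<phi>_def)
lemma \<pi>_diff [simp]: "\<pi> Z (a - b) = \<pi> Z a - \<pi> Z b" "\<pi> Z 0 = 0"
  by (auto simp: frag_extend_diff \<pi>_def)

lemma \<phi>_tgt: "j \<in> J \<Longrightarrow> \<phi> (frag_of (tgt j)) = \<psi> j"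
  using inj_tgt by (auto simp: \<phi>_def)

text \<open>Left inverse law: the recursion equation for \<open>\<psi> j\<close>, solved for the
  source.\<close>

lemma \<phi>_\<delta>_src:
  assumes "j \<in> J"
  shows "\<phi> (\<delta> (src j)) = frag_of (src j)"
proof -
  have "\<phi> (\<delta> (src j)) = frag_cmul (coefficient j j) (\<psi> j) +
    (\<Sum>i\<in>below j. frag_cmul (coefficient j i) (\<psi> i))"
    unfolding \<phi>_def using assms inj_tgt
    by (subst sum_targets) (auto simp: below_def intro!: sum.cong)
  then show ?thesis
    using coefficient_unit[OF assms] by (subst (asm) \<psi>_eq[OF assms]) simp
qed

text \<open>Right inverse law. It needs induction along \<open>r\<close>, since the differential is
  applied to the values \<psi> i at lower indices, whose target parts must already be known.\<close>

lemma \<pi>_tgt_d_\<psi>: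
  assumes "j \<in> J"
  shows "\<pi> (tgt ` J) (d (\<psi> j)) = frag_of (tgt j)"
  using wf_r assms
proof (induction j rule: wf_induct_rule)
  case (less j)
  let ?s = "\<Sum>i\<in>below j. frag_cmul (coefficient j i) (\<psi> i)"
  have "\<pi> (tgt ` J) (d ?s) = (\<Sum>i\<in>below j. frag_cmul (coefficient j i) (\<pi> (tgt ` J) (d (\<psi> i))))"
    unfolding \<pi>_def using finite_below
    by (simp add: frag_extend_sum frag_extend_cmul o_def)
  also have "\<dots> = (\<Sum>i\<in>below j. frag_cmul (coefficient j i) (frag_of (tgt i)))"
    using less below_r by (intro sum.cong) (auto simp: below_def)
  finally have s: "\<pi> (tgt ` J) (d ?s) = \<dots>" .
  have "\<pi> (tgt ` J) (\<delta> (src j)) = frag_cmul (coefficient j j) (frag_of (tgt j)) +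
    (\<Sum>i\<in>below j. frag_cmul (coefficient j i) (frag_of (tgt i)))"
    unfolding \<pi>_def using less(2)
    by (subst sum_targets) (auto simp: below_def intro!: sum.cong)
  then have "\<pi> (tgt ` J) (d (frag_of (src j) - ?s)) = frag_cmul (coefficient j j) (frag_of (tgt j))"
    using s by simp
  then have "\<pi> (tgt ` J) (d (frag_cmul (coefficient j j) (frag_of (src j) - ?s))) = frag_of (tgt j)"
    using coefficient_unit[OF less(2)] by (simp add: frag_extend_cmul \<pi>_def del: d_diff)
  then show ?case by (subst \<psi>_eq[OF less(2)])
qed

lemma \<delta>_keys: "y \<in> gens Y \<Longrightarrow> Poly_Mapping.keys (\<delta> y) \<subseteq> {k \<in> gens Y. bideg Y k = bideg Y y + t}"
  using differential_Y graded_hom_keys[of d Y Y _ "frag_of y"]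
    graded_hom_bideg[of d Y Y _ "frag_of y" "bideg Y y"]
  by (auto simp: differential_def)

text \<open>All targets met by one source lie in the same bidegree, because the differential is
  homogeneous; hence back substitution never mixes bidegrees.\<close>

lemma \<psi>_keys:
  assumes "j \<in> J"
  shows "Poly_Mapping.keys (\<psi> j) \<subseteq> {k \<in> src ` J. bideg Y k + t = bideg Y (tgt j)}"
  using wf_r assms
proof (induction j rule: wf_induct_rule)
  case (less j)
  have deg: "bideg Y (tgt i) = bideg Y (src j) + t" if "i \<in> J" "coefficient j i \<noteq> 0" for i
    using \<delta>_keys[of "src j"] cover less(2) that by (auto simp: in_keys_iff)
  have "coefficient j j \<noteq> 0" using unit[OF less(2)] by auto
  then have degj: "bideg Y (tgt j) = bideg Y (src j) + t" using deg less(2) by blast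
  have "Poly_Mapping.keys (frag_cmul (coefficient j i) (\<psi> i)) \<subseteq>
      {k \<in> src ` J. bideg Y k + t = bideg Y (tgt j)}" if "i \<in> below j" for i
    using less.IH[of i] that below_r[OF less(2) that] deg[of i] degj
    by (auto simp: below_def)
  then have "Poly_Mapping.keys (\<Sum>i\<in>below j. frag_cmul (coefficient j i) (\<psi> i)) \<subseteq>
      {k \<in> src ` J. bideg Y k + t = bideg Y (tgt j)}"
    by (intro keys_sum_subset)
  then have "Poly_Mapping.keys (frag_of (src j) - (\<Sum>i\<in>below j. frag_cmul (coefficient j i) (\<psi> i)))
      \<subseteq> {k \<in> src ` J. bideg Y k + t = bideg Y (tgt j)}"
    using less(2) degj keys_diff[of "frag_of (src j)" "\<Sum>i\<in>below j. frag_cmul (coefficient j i) (\<psi> i)"] by auto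
  then show ?case
    by (subst \<psi>_eq[OF less(2)]) (metis (lifting) keys_cmul subset_trans)
qed

lemma \<phi>_keys_src: "Poly_Mapping.keys (\<phi> y) \<subseteq> src ` J"
proof -
  have "Poly_Mapping.keys (if x \<in> tgt ` J then \<psi> (inv_into J tgt x) else 0) \<subseteq> src ` J" for x
    using \<psi>_keys[of "inv_into J tgt x"] inv_into_into[of x tgt J] by auto
  then show ?thesis
    unfolding \<phi>_def by (intro keys_frag_extend_subset)
qed

lemma \<phi>_bideg:
  assumes "Poly_Mapping.keys y \<subseteq> {k \<in> gens Y. bideg Y k = p}" "k \<in> Poly_Mapping.keys (\<phi> y)"
  shows "bideg Y k = p - t"
proof -
  obtain x where x: "x \<in> Poly_Mapping.keys y"
      "k \<in> Poly_Mapping.keys (if x \<in> tgt ` J then \<psi> (inv_into J tgt x) else 0)"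
    using assms(2) unfolding \<phi>_def by (elim keys_frag_extendE)
  then obtain j where "j \<in> J" "x = tgt j" "k \<in> Poly_Mapping.keys (\<psi> j)"
    using inj_tgt by (auto split: if_splits)
  then have "bideg Y k + t = p" using \<psi>_keys[of j] x assms(1) by auto
  then show ?thesis by (simp add: eq_diff_eq)
qed

lemma \<phi>_zero: "Poly_Mapping.keys y \<inter> tgt ` J = {} \<Longrightarrow> \<phi> y = 0"
  unfolding \<phi>_def by (rule frag_extend_eq_0) auto

lemma \<phi>_\<phi>: "\<phi> (\<phi> y) = 0"
  using \<phi>_keys_src[of y] disjoint by (intro \<phi>_zero) blast

lemma \<pi>_zero: "Poly_Mapping.keys y \<inter> Z = {} \<Longrightarrow> \<pi> Z y = 0"
  unfolding \<pi>_def by (rule frag_extend_eq_0) auto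

lemma \<pi>_id: "Poly_Mapping.keys y \<subseteq> Z \<Longrightarrow> \<pi> Z y = y"
  by (rule frag_additive_eqI[of y Z]) (auto simp: \<pi>_def frag_extend_diff)

lemma keys_\<pi>: "Poly_Mapping.keys (\<pi> Z y) \<subseteq> Poly_Mapping.keys y \<inter> Z"
proof -
  have "Poly_Mapping.keys (\<pi> Z y) \<subseteq>
      (\<Union>x\<in>Poly_Mapping.keys y. Poly_Mapping.keys (if x \<in> Z then frag_of x else 0))"
    unfolding \<pi>_def by (rule keys_frag_extend)
  then show ?thesis by (force split: if_splits)
qed

lemma \<pi>_tgt_d_\<phi>: "\<pi> (tgt ` J) (d (\<phi> y)) = \<pi> (tgt ` J) y"
proof (rule frag_additive_eqI[of y UNIV])
  fix x show "\<pi> (tgt ` J) (d (\<phi> (frag_of x))) = \<pi> (tgt ` J) (frag_of x)"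
  proof (cases "x \<in> tgt ` J")
    case True
    then show ?thesis using \<phi>_tgt \<pi>_tgt_d_\<psi> by (auto simp: \<pi>_def)
  next
    case False
    then have "\<phi> (frag_of x) = 0" by (intro \<phi>_zero) auto
    then show ?thesis using False by (simp add: \<pi>_def)
  qed
qed auto

lemma \<phi>_\<pi>: "\<phi> (\<pi> (tgt ` J) y) = \<phi> y"
proof (rule frag_additive_eqI[of y UNIV])
  fix x show "\<phi> (\<pi> (tgt ` J) (frag_of x)) = \<phi> (frag_of x)"
    using \<phi>_zero[of "frag_of x"] by (simp add: \<pi>_def)
qed auto

lemma \<phi>_d_\<phi>: "\<phi> (d (\<phi> y)) = \<phi> y"
  by (metis \<phi>_\<pi> \<pi>_tgt_d_\<phi>)

lemma d_keys: "Poly_Mapping.keys y \<subseteq> gens Y \<Longrightarrow> Poly_Mapping.keys (d y) \<subseteq> gens Y"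
  using \<delta>_keys keys_frag_extend[of \<delta> y] by fastforce

lemma \<phi>_keys: "Poly_Mapping.keys (\<phi> y) \<subseteq> gens Y"
  using \<phi>_keys_src cover by blast

lemma d_d: "Poly_Mapping.keys y \<subseteq> gens Y \<Longrightarrow> d (d y) = 0"
  using differential_Y by (simp add: differential_def total_group_def)

lemma d_bideg:
  assumes "Poly_Mapping.keys y \<subseteq> {k \<in> gens Y. bideg Y k = p}" "k \<in> Poly_Mapping.keys (d y)"
  shows "bideg Y k = p + t"
proof -
  obtain x where "x \<in> Poly_Mapping.keys y" "k \<in> Poly_Mapping.keys (\<delta> x)"
    using assms(2) keys_frag_extend[of \<delta> y] by blast
  then show ?thesis using \<delta>_keys[of x] assms(1) by auto
qed

section \<open>The idempotent chain map and its image\<close>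

definition e :: "('h \<Rightarrow>\<^sub>0 int) \<Rightarrow> ('h \<Rightarrow>\<^sub>0 int)"
  where "e y = y - d (\<phi> y) - \<phi> (d y)"

lemma e_diff [simp]: "e (a - b) = e a - e b" "e 0 = 0"
  by (auto simp: e_def)

lemma e_keys: "Poly_Mapping.keys y \<subseteq> gens Y \<Longrightarrow> Poly_Mapping.keys (e y) \<subseteq> gens Y"
  unfolding e_def 
  using d_keys[of y] \<phi>_keys[of "d y"] d_keys[OF \<phi>_keys[of y]]
    keys_diff[of "y - d (\<phi> y)" "\<phi> (d y)"] keys_diff[of y "d (\<phi> y)"] by blast

lemma e_bideg:
  assumes y: "Poly_Mapping.keys y \<subseteq> {k \<in> gens Y. bideg Y k = p}" and "k \<in> Poly_Mapping.keys (e y)"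
  shows "bideg Y k = p"
proof -
  have "Poly_Mapping.keys (d y) \<subseteq> {k \<in> gens Y. bideg Y k = p + t}"
    using d_bideg[OF y] d_keys y by blast
  moreover have "Poly_Mapping.keys (\<phi> y) \<subseteq> {k \<in> gens Y. bideg Y k = p - t}"
    using \<phi>_bideg[OF y] \<phi>_keys by blast
  ultimately show ?thesis
    using assms keys_diff[of "y - d (\<phi> y)" "\<phi> (d y)"] keys_diff[of y "d (\<phi> y)"]
      d_bideg[of "\<phi> y" "p - t" k] \<phi>_bideg[of "d y" "p + t" k] unfolding e_def by force
qed

lemma d_e:
  assumes "Poly_Mapping.keys y \<subseteq> gens Y"
  shows "d (e y) = e (d y)"
  using d_d[of y] d_d[of "\<phi> y"] \<phi>_keys assms by (simp add: e_def)

lemma \<phi>_e: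
  assumes "Poly_Mapping.keys y \<subseteq> gens Y"
  shows "\<phi> (e y) = 0"
  using \<phi>_d_\<phi> \<phi>_\<phi> by (simp add: e_def)

text \<open>\<phi> vanishes on the image of \<open>e\<close>, and also after applying
  \<open>d\<close> there because \<open>e\<close> is a chain map; so both correction terms
  disappear.\<close>

lemma e_e:
  assumes "Poly_Mapping.keys y \<subseteq> gens Y"
  shows "e (e y) = e y"
  using \<phi>_e[OF assms] \<phi>_e[OF d_keys[OF assms]] d_e[OF assms] by (simp add: e_def[of "e y"])

lemma e_src:
  assumes "Poly_Mapping.keys y \<subseteq> src ` J"
  shows "e y = 0"
proof -
  have "\<phi> (d y) = y"
    by (rule frag_additive_eqI[OF assms]) (auto simp: \<phi>_\<delta>_src)
  moreover have "\<phi> y = 0" using assms disjoint by (intro \<phi>_zero) blast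
  ultimately show ?thesis by (simp add: e_def)
qed

lemma \<pi>_tgt_e: "\<pi> (tgt ` J) (e y) = 0"
proof -
  have "\<pi> (tgt ` J) (\<phi> (d y)) = 0"
    using \<phi>_keys_src[of "d y"] disjoint by (intro \<pi>_zero) blast
  then show ?thesis using \<pi>_tgt_d_\<phi> by (simp add: e_def)
qed

lemma decompose:
  assumes "Poly_Mapping.keys y \<subseteq> gens Y"
  shows "\<pi> (src ` J) y + \<pi> (tgt ` J) y + \<pi> (\<kappa> ` gens X) y = y"
proof -
  have "\<pi> (tgt ` J) y = y - \<pi> (src ` J) y - \<pi> (\<kappa> ` gens X) y"
  proof (rule frag_additive_eqI[OF assms])
    fix x assume "x \<in> gens Y"
    then show "\<pi> (tgt ` J) (frag_of x) =
        frag_of x - \<pi> (src ` J) (frag_of x) - \<pi> (\<kappa> ` gens X) (frag_of x)"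
      using cover disjoint by (auto simp: \<pi>_def)
  qed (auto)
  then show ?thesis by simp
qed

text \<open>\<open>e y\<close> has no target part and \<open>e\<close> annihilates its source part,
  so the critical part alone determines it.\<close>

lemma e_\<pi>_e:
  assumes "Poly_Mapping.keys y \<subseteq> gens Y"
  shows "e (\<pi> (\<kappa> ` gens X) (e y)) = e y"
proof -
  have "e (e y - \<pi> (\<kappa> ` gens X) (e y)) = 0"
    using decompose[OF e_keys[OF assms]] \<pi>_tgt_e[of y] keys_\<pi>[of "src ` J" "e y"]
    by (intro e_src) (metis (no_types, lifting) add.right_neutral add_diff_cancel_right' Int_lower2 subset_trans)
  then show ?thesis using e_e[OF assms] by simp
qed

text \<open>For critical y the term \<open>d (\<phi> y)\<close> vanishes and
  \<open>\<phi> (d y)\<close> lies in the sources. Together with \<open>e_\<pi>_e\<close> this makes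
  \<open>e\<close> and the critical projection mutually inverse between the critical span and the
  image of \<open>e\<close>.\<close>

lemma \<pi>_e_crit:
  assumes "Poly_Mapping.keys y \<subseteq> \<kappa> ` gens X"
  shows "\<pi> (\<kappa> ` gens X) (e y) = y"
proof -
  have "\<phi> y = 0" using assms disjoint by (intro \<phi>_zero) blast
  moreover have "\<pi> (\<kappa> ` gens X) (\<phi> (d y)) = 0"
    using \<phi>_keys_src[of "d y"] disjoint by (intro \<pi>_zero) blast
  ultimately show ?thesis using \<pi>_id[OF assms] by (simp add: e_def)
qed

section \<open>The retract spanned by the critical generators\<close>

definition \<iota> :: "('g \<Rightarrow>\<^sub>0 int) \<Rightarrow> ('h \<Rightarrow>\<^sub>0 int)"
  where "\<iota> = frag_extend (\<lambda>g. frag_of (\<kappa> g))"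

definition \<rho> :: "('h \<Rightarrow>\<^sub>0 int) \<Rightarrow> ('g \<Rightarrow>\<^sub>0 int)"
  where "\<rho> = frag_extend (\<lambda>y. if y \<in> \<kappa> ` gens X then frag_of (inv_into (gens X) \<kappa> y) else 0)"

lemma \<iota>_diff [simp]: "\<iota> (a - b) = \<iota> a - \<iota> b" by (simp add: \<iota>_def frag_extend_diff)
lemma \<rho>_diff [simp]: "\<rho> (a - b) = \<rho> a - \<rho> b" by (simp add: \<rho>_def frag_extend_diff)

lemma \<iota>_\<rho>: "\<iota> (\<rho> y) = \<pi> (\<kappa> ` gens X) y"
  by (rule frag_additive_eqI[of y UNIV]) (auto simp: \<iota>_def \<rho>_def \<pi>_def frag_extend_diff f_inv_into_f)

lemma \<rho>_\<iota>: "Poly_Mapping.keys x \<subseteq> gens X \<Longrightarrow> \<rho> (\<iota> x) = x"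
  by (rule frag_additive_eqI[of x "gens X"]) (auto simp: \<iota>_def \<rho>_def frag_extend_diff inj_crit)

lemma \<rho>_\<pi>: "\<rho> (\<pi> (\<kappa> ` gens X) y) = \<rho> y"
  by (rule frag_additive_eqI[of y UNIV]) (auto simp: \<rho>_def \<pi>_def frag_extend_diff f_inv_into_f)

lemma keys_\<iota>: "Poly_Mapping.keys (\<iota> x) \<subseteq> \<kappa> ` Poly_Mapping.keys x"
  unfolding \<iota>_def using keys_frag_extend[of "\<lambda>g. frag_of (\<kappa> g)" x] by auto

lemma keys_\<rho>:
  assumes "g \<in> Poly_Mapping.keys (\<rho> y)"
  shows "g \<in> gens X" "\<kappa> g \<in> Poly_Mapping.keys y"
proof -
  obtain x where "x \<in> Poly_Mapping.keys y"
      "g \<in> Poly_Mapping.keys (if x \<in> \<kappa> ` gens X then frag_of (inv_into (gens X) \<kappa> x) else 0)"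
    using assms unfolding \<rho>_def by (elim keys_frag_extendE)
  then show "g \<in> gens X" "\<kappa> g \<in> Poly_Mapping.keys y"
    by (auto split: if_splits simp: inj_crit)
qed

text \<open>The homotopy is \<phi> itself, because 1 - e = d \<phi> + \<phi> d. The differential of
  the retract is \<open>d\<close> transported through the isomorphism of the critical span with the
  image of \<open>e\<close>; \<open>shift\<close> converts its bidegree and \<open>unique\<close>
  keeps the inclusion homogeneous.\<close>

theorem deformation_retract:
  assumes M: "\<And>g. g \<in> gens X \<Longrightarrow> M (bideg Y (\<kappa> g)) (bideg X g)"
    and shift: "\<And>q p p'. M q p \<Longrightarrow> M (q + t) p' \<Longrightarrow> p' = p + s"
    and unique: "\<And>q q' p. M q p \<Longrightarrow> M q' p \<Longrightarrow> q = q'"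
  shows "\<exists>dX. deformation_retract M X s dX Y t d"
proof -
  define R where "R y = \<rho> (e y)" for y
  define f where "f x = e (\<iota> x)" for x
  define dX where "dX x = R (d (f x))" for x
  have \<iota>_gens: "Poly_Mapping.keys (\<iota> x) \<subseteq> gens Y" if "Poly_Mapping.keys x \<subseteq> gens X" for x
    using keys_\<iota>[of x] that cover by blast
  have f_keys: "Poly_Mapping.keys (f x) \<subseteq> gens Y" if "Poly_Mapping.keys x \<subseteq> gens X" for x
    unfolding f_def by (rule e_keys[OF \<iota>_gens[OF that]])
  have R_keys: "Poly_Mapping.keys (R y) \<subseteq> gens X" for y
    using keys_\<rho> unfolding R_def by blast
  have diffs: "R (a - b) = R a - R b" "f (x - z) = f x - f z" "dX (x - z) = dX x - dX z" for a b x z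
    by (auto simp: R_def f_def dX_def)
  have fR: "f (R y) = e y" if "Poly_Mapping.keys y \<subseteq> gens Y" for y
    unfolding f_def R_def \<iota>_\<rho> using e_\<pi>_e[OF that] .
  have Rf: "R (f x) = x" if "Poly_Mapping.keys x \<subseteq> gens X" for x
  proof -
    have "R (f x) = \<rho> (\<pi> (\<kappa> ` gens X) (e (\<iota> x)))"
      unfolding R_def f_def using e_e[OF \<iota>_gens[OF that]] by (simp add: \<rho>_\<pi>)
    also have "\<pi> (\<kappa> ` gens X) (e (\<iota> x)) = \<iota> x"
      using keys_\<iota>[of x] that by (intro \<pi>_e_crit) blast
    finally show ?thesis using \<rho>_\<iota>[OF that] by simp
  qed
  have ef: "e (f x) = f x" if "Poly_Mapping.keys x \<subseteq> gens X" for x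
    unfolding f_def using e_e[OF \<iota>_gens[OF that]] .
  have Re: "R (e y) = R y" if "Poly_Mapping.keys y \<subseteq> gens Y" for y
    unfolding R_def using e_e[OF that] by simp
  have chain_R: "R (d y) = dX (R y)" if y: "Poly_Mapping.keys y \<subseteq> gens Y" for y
    unfolding dX_def fR[OF y] d_e[OF y] using Re[OF d_keys[OF y]] by simp
  have chain_f: "f (dX x) = d (f x)" if x: "Poly_Mapping.keys x \<subseteq> gens X" for x
    unfolding dX_def using fR[OF d_keys[OF f_keys[OF x]]] d_e[OF f_keys[OF x]] ef[OF x] by simp
  have f_bideg: "Poly_Mapping.keys (f x) \<subseteq> {k \<in> gens Y. M (bideg Y k) p}"
    if x: "Poly_Mapping.keys x \<subseteq> {k \<in> gens X. bideg X k = p}" for x p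
  \<comment> \<open>A nonzero x supplies a critical generator, and with it a bidegree of Y that is
    matched with p. For x = 0 there may be no such bidegree.\<close>
  proof (cases "Poly_Mapping.keys x = {}")
    case True
    then have "x = 0" by simp
    then show ?thesis using diffs(2)[of 0 0] by simp
  next
    case False
    then obtain g where g: "g \<in> gens X" "bideg X g = p" using x by blast
    have "Poly_Mapping.keys (\<iota> x) \<subseteq> {k \<in> gens Y. bideg Y k = bideg Y (\<kappa> g)}"
    proof
      fix k assume "k \<in> Poly_Mapping.keys (\<iota> x)"
      then obtain h where h: "h \<in> gens X" "bideg X h = p" "k = \<kappa> h" using keys_\<iota> x by blast
      then show "k \<in> {k \<in> gens Y. bideg Y k = bideg Y (\<kappa> g)}"
        using unique[OF M[OF h(1)]] M[OF g(1)] g cover by auto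
    qed
    then have "bideg Y k = bideg Y (\<kappa> g)" if "k \<in> Poly_Mapping.keys (f x)" for k
      using e_bideg that unfolding f_def by blast
    then show ?thesis using f_keys[of x] x M[OF g(1)] g by auto
  qed
  have R_bideg: "M p (bideg X g)"
    if y: "Poly_Mapping.keys y \<subseteq> {k \<in> gens Y. bideg Y k = p}" and g: "g \<in> Poly_Mapping.keys (R y)"
    for y p g
    using keys_\<rho>[of g "e y"] e_bideg[OF y, of "\<kappa> g"] g M[of g] unfolding R_def by auto
  have R: "R \<in> graded_hom Y X M"
    by (rule graded_homI) (use diffs R_keys R_bideg in blast)+
  have f: "f \<in> graded_hom X Y (\<lambda>p q. M q p)"
    by (rule graded_homI) (use diffs f_keys f_bideg in blast)+
  have \<phi>: "\<phi> \<in> graded_hom Y Y (\<lambda>p q. q = p - t)"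
    by (rule graded_homI) (use \<phi>_diff \<phi>_keys \<phi>_bideg in blast)+
  have dX: "dX \<in> graded_hom X X (\<lambda>p q. q = p + s)"
  proof (rule graded_homI)
    fix p x g assume x: "Poly_Mapping.keys x \<subseteq> {k \<in> gens X. bideg X k = p}"
      and g: "g \<in> Poly_Mapping.keys (dX x)"
    have "f x \<noteq> 0" using g by (auto simp: dX_def R_def \<rho>_def)
    then obtain k where "k \<in> Poly_Mapping.keys (f x)" by fastforce
    then have k: "M (bideg Y k) p" using f_bideg[OF x] by blast
    have "Poly_Mapping.keys (f x) \<subseteq> {l \<in> gens Y. bideg Y l = bideg Y k}"
      using f_bideg[OF x] unique[OF _ k] by blast
    then have "Poly_Mapping.keys (d (f x)) \<subseteq> {l \<in> gens Y. bideg Y l = bideg Y k + t}"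
      using d_bideg d_keys[OF f_keys[of x]] x by blast
    then have "M (bideg Y k + t) (bideg X g)"
      using R_bideg g unfolding dX_def by blast
    then show "bideg X g = p + s" using shift[OF k] by blast
  qed (use diffs R_keys in \<open>auto simp: dX_def\<close>)
  have "dX (dX x) = 0" if x: "Poly_Mapping.keys x \<subseteq> gens X" for x
    using chain_f[OF x] d_d[OF f_keys[OF x]] diffs(1)[of 0 0] by (simp add: dX_def)
  then have "differential X s dX"
    using dX by (simp add: differential_def total_group_def)
  moreover have "\<forall>y\<in>carrier (total_group Y). d (\<phi> y) + \<phi> (d y) = y - f (R y)"
    using fR by (simp add: e_def total_group_def)
  ultimately show ?thesis
    unfolding deformation_retract_def using differential_Y R f \<phi> chain_R chain_f Rf
    by (intro exI[of _ dX] exI[of _ R] exI[of _ f] exI[of _ \<phi>] conjI)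
      (simp_all add: total_group_def)
qed

end

section \<open>Homology of a deformation retract\<close>

lemma differential_hom:
  assumes "differential Z s' d"
  shows "d \<in> hom (summand Z p) (summand Z (p + s'))"
proof -
  have d: "d \<in> graded_hom Z Z (\<lambda>p q. q = p + s')" using assms by (simp add: differential_def)
  have "Poly_Mapping.keys (d x) \<subseteq> {g \<in> gens Z. bideg Z g = p + s'}"
    if "Poly_Mapping.keys x \<subseteq> {g \<in> gens Z. bideg Z g = p}" for x
    using graded_hom_keys[OF d, of x] graded_hom_bideg[OF d that] that by blast
  moreover have "d (x + y) = d x + d y"
    if "Poly_Mapping.keys x \<subseteq> {g \<in> gens Z. bideg Z g = p}"
      "Poly_Mapping.keys y \<subseteq> {g \<in> gens Z. bideg Z g = p}" for x y
    using graded_hom_add[OF d, of x y] that by blast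
  ultimately show ?thesis
    by (intro homI) (simp_all add: summand_def)
qed

abbreviation cycles :: "'x bigraded_basis \<Rightarrow> int \<times> int \<Rightarrow> (('x \<Rightarrow>\<^sub>0 int) \<Rightarrow> ('x \<Rightarrow>\<^sub>0 int)) \<Rightarrow>
    int \<times> int \<Rightarrow> ('x \<Rightarrow>\<^sub>0 int) monoid"
  where "cycles Z s' d p \<equiv> (summand Z p)\<lparr>carrier := kernel (summand Z p) (summand Z (p + s')) d\<rparr>"

abbreviation boundaries where "boundaries Z s' d p \<equiv> d ` carrier (summand Z (p - s'))"

lemma carrier_cycles:
  "x \<in> carrier (cycles Z s' d p) \<longleftrightarrow> Poly_Mapping.keys x \<subseteq> {g \<in> gens Z. bideg Z g = p} \<and> d x = 0"
  by (simp add: kernel_def summand_def)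

lemma cycles_comm_group:
  assumes "differential Z s' d"
  shows "comm_group (cycles Z s' d p)"
proof -
  interpret group_hom "summand Z p" "summand Z (p + s')" d
    using differential_hom[OF assms, of p]
    by (simp add: group_hom_def group_hom_axioms_def summand_def)
  have "group (cycles Z s' d p)"
    using G.subgroup_imp_group[OF subgroup_kernel] .
  then show ?thesis
    by (rule group.group_comm_groupI) (simp add: summand_def add.commute)
qed

text \<open>\<open>d (d x) = 0\<close> puts the image inside the cycles, and in a commutative group
  normality is automatic.\<close>

lemma boundaries_normal:
  assumes "differential Z s' d"
  shows "boundaries Z s' d p \<lhd> cycles Z s' d p"
proof -
  interpret C: comm_group "cycles Z s' d p" by (rule cycles_comm_group[OF assms])
  interpret group_hom "summand Z (p - s')" "summand Z p" d
    using differential_hom[OF assms, of "p - s'"]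
    by (simp add: group_hom_def group_hom_axioms_def summand_def)
  have "d ` carrier (summand Z (p - s')) \<subseteq> carrier (cycles Z s' d p)"
  proof
    fix x assume "x \<in> d ` carrier (summand Z (p - s'))"
    then obtain y where y: "y \<in> carrier (summand Z (p - s'))" "x = d y" by blast
    then have "x \<in> carrier (summand Z p)" by simp
    moreover have "d x = 0"
    proof -
      have "y \<in> carrier (total_group Z)" using y(1) by (auto simp: total_group_def summand_def)
      then show ?thesis using assms unfolding y(2) differential_def by blast
    qed
    ultimately show "x \<in> carrier (cycles Z s' d p)"
      unfolding carrier_cycles by (simp add: summand_def)
  qed
  moreover have "subgroup (kernel (summand Z p) (summand Z (p + s')) d) (summand Z p)"
    using differential_hom[OF assms, of p]
    by (intro group_hom.subgroup_kernel) (simp add: group_hom_def group_hom_axioms_def summand_def)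
  ultimately have "subgroup (d ` carrier (summand Z (p - s'))) (cycles Z s' d p)"
    by (intro H.subgroup_incl[OF img_is_subgroup]) auto
  then show ?thesis by (simp add: C.normal_iff_subgroup)
qed

context
  fixes M :: "int \<times> int \<Rightarrow> int \<times> int \<Rightarrow> bool" and s t :: "int \<times> int"
    and X :: "'g bigraded_basis" and Y :: "'h bigraded_basis" and dX dY
  assumes retract: "deformation_retract M X s dX Y t dY"
begin

lemma retractE:
  obtains r f F where "differential X s dX" "differential Y t dY"
    "r \<in> graded_hom Y X M" "f \<in> graded_hom X Y (\<lambda>p q. M q p)"
    "F \<in> graded_hom Y Y (\<lambda>p q. q = p - t)"
    "\<And>y. Poly_Mapping.keys y \<subseteq> gens Y \<Longrightarrow> r (dY y) = dX (r y)"
    "\<And>x. Poly_Mapping.keys x \<subseteq> gens X \<Longrightarrow> f (dX x) = dY (f x)"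
    "\<And>x. Poly_Mapping.keys x \<subseteq> gens X \<Longrightarrow> r (f x) = x"
    "\<And>y. Poly_Mapping.keys y \<subseteq> gens Y \<Longrightarrow> dY (F y) + F (dY y) = y - f (r y)"
proof -
  have ball: "(\<forall>x\<in>carrier (total_group Z). P x) \<longleftrightarrow> (\<forall>x. Poly_Mapping.keys x \<subseteq> gens Z \<longrightarrow> P x)"
    for Z :: "'x bigraded_basis" and P
    by (auto simp: total_group_def)
  from retract obtain r f F where "differential X s dX" "differential Y t dY"
    "r \<in> graded_hom Y X M" "f \<in> graded_hom X Y (\<lambda>p q. M q p)"
    "F \<in> graded_hom Y Y (\<lambda>p q. q = p - t)"
    "\<forall>y. Poly_Mapping.keys y \<subseteq> gens Y \<longrightarrow> r (dY y) = dX (r y)"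
    "\<forall>x. Poly_Mapping.keys x \<subseteq> gens X \<longrightarrow> f (dX x) = dY (f x)"
    "\<forall>x. Poly_Mapping.keys x \<subseteq> gens X \<longrightarrow> r (f x) = x"
    "\<forall>y. Poly_Mapping.keys y \<subseteq> gens Y \<longrightarrow> dY (F y) + F (dY y) = y - f (r y)"
    unfolding deformation_retract_def ball by (elim conjE exE)
  then show ?thesis by (intro that[of r f F]) simp_all
qed

text \<open>The retraction induces a map from the cycles of Y onto the homology of X, onto because r
  f = 1, and the homotopy identifies its kernel with the boundaries. The match of
  \<open>q - t\<close> with \<open>p - s\<close> is used to transport primitives between the two
  complexes.\<close>

lemma homology_iso:
  assumes M: "M q p" "M (q - t) (p - s)"
    and functional: "\<And>q p p'. M q p \<Longrightarrow> M q p' \<Longrightarrow> p' = p"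
    and unique: "\<And>q q' p. M q p \<Longrightarrow> M q' p \<Longrightarrow> q = q'"
  shows "homology Y t dY q \<cong> homology X s dX p"
proof -
  obtain r f F where dX: "differential X s dX" and dY: "differential Y t dY"
    and r: "r \<in> graded_hom Y X M" and f: "f \<in> graded_hom X Y (\<lambda>p q. M q p)"
    and F: "F \<in> graded_hom Y Y (\<lambda>p q. q = p - t)"
    and r_d: "\<And>y. Poly_Mapping.keys y \<subseteq> gens Y \<Longrightarrow> r (dY y) = dX (r y)"
    and f_d: "\<And>x. Poly_Mapping.keys x \<subseteq> gens X \<Longrightarrow> f (dX x) = dY (f x)"
    and r_f: "\<And>x. Poly_Mapping.keys x \<subseteq> gens X \<Longrightarrow> r (f x) = x"
    and htpy: "\<And>y. Poly_Mapping.keys y \<subseteq> gens Y \<Longrightarrow> dY (F y) + F (dY y) = y - f (r y)"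
    by (rule retractE) blast
  have zero: "h 0 = 0" if "h \<in> graded_hom Z Z' R" for h :: "('x \<Rightarrow>\<^sub>0 int) \<Rightarrow> ('y \<Rightarrow>\<^sub>0 int)" and Z Z' R
    using graded_hom_add[OF that, of 0 0] by simp
  have r_keys: "Poly_Mapping.keys (r y) \<subseteq> {g \<in> gens X. bideg X g = p'}"
    if "M q' p'" "Poly_Mapping.keys y \<subseteq> {g \<in> gens Y. bideg Y g = q'}" for q' p' y
    using graded_hom_keys[OF r, of y] graded_hom_bideg[OF r that(2)] that functional by blast
  have f_keys: "Poly_Mapping.keys (f x) \<subseteq> {g \<in> gens Y. bideg Y g = q'}"
    if "M q' p'" "Poly_Mapping.keys x \<subseteq> {g \<in> gens X. bideg X g = p'}" for q' p' x
    using graded_hom_keys[OF f, of x] graded_hom_bideg[OF f that(2)] that unique by blast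
  have F_keys: "Poly_Mapping.keys (F y) \<subseteq> {g \<in> gens Y. bideg Y g = q - t}"
    if "Poly_Mapping.keys y \<subseteq> {g \<in> gens Y. bideg Y g = q}" for y
    using graded_hom_keys[OF F, of y] graded_hom_bideg[OF F that] that by blast
  let ?GX = "cycles X s dX p" and ?GY = "cycles Y t dY q"
  let ?BX = "boundaries X s dX p" and ?BY = "boundaries Y t dY q"
  interpret GX: comm_group ?GX by (rule cycles_comm_group[OF dX])
  interpret GY: comm_group ?GY by (rule cycles_comm_group[OF dY])
  interpret BX: normal ?BX ?GX by (rule boundaries_normal[OF dX])
  have rGX: "r y \<in> carrier ?GX" if "y \<in> carrier ?GY" for y
  proof -
    have y: "Poly_Mapping.keys y \<subseteq> {g \<in> gens Y. bideg Y g = q}" "dY y = 0"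
      using that by (simp_all only: carrier_cycles)
    then have "Poly_Mapping.keys y \<subseteq> gens Y" by blast
    then have "dX (r y) = 0" using r_d[of y] zero[OF r] y(2) by simp
    then show ?thesis using r_keys[OF M(1) y(1)] by (simp only: carrier_cycles)
  qed
  have fGY: "f x \<in> carrier ?GY" if "x \<in> carrier ?GX" for x
  proof -
    have x: "Poly_Mapping.keys x \<subseteq> {g \<in> gens X. bideg X g = p}" "dX x = 0"
      using that by (simp_all only: carrier_cycles)
    then have "Poly_Mapping.keys x \<subseteq> gens X" by blast
    then have "dY (f x) = 0" using f_d[of x] zero[OF f] x(2) by simp
    then show ?thesis using f_keys[OF M(1) x(1)] by (simp only: carrier_cycles)
  qed
  have mult: "x \<otimes>\<^bsub>cycles Z s' d p\<^esub> y = x + y" for x y Z s' d p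
    by (simp add: summand_def)
  have r_hom: "r \<in> hom ?GY ?GX"
  proof (rule homI)
    fix x y assume "x \<in> carrier ?GY" "y \<in> carrier ?GY"
    then have "Poly_Mapping.keys x \<subseteq> gens Y" "Poly_Mapping.keys y \<subseteq> gens Y"
      unfolding carrier_cycles by blast+
    then show "r (x \<otimes>\<^bsub>?GY\<^esub> y) = r x \<otimes>\<^bsub>?GX\<^esub> r y"
      unfolding mult by (rule graded_hom_add[OF r])
  qed (rule rGX)
  let ?h = "\<lambda>y. ?BX #>\<^bsub>?GX\<^esub> r y"
  have h_hom: "?h \<in> hom ?GY (?GX Mod ?BX)"
    using hom_compose[OF r_hom BX.r_coset_hom_Mod] by (simp add: o_def)
  interpret h: group_hom ?GY "?GX Mod ?BX" ?h
    using h_hom BX.factorgroup_is_group GY.is_group by (simp add: group_hom_def group_hom_axioms_def)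
  have "?h ` carrier ?GY = carrier (?GX Mod ?BX)"
  proof
    show "?h ` carrier ?GY \<subseteq> carrier (?GX Mod ?BX)" using h.hom_closed by blast
    show "carrier (?GX Mod ?BX) \<subseteq> ?h ` carrier ?GY"
    proof
      fix C assume "C \<in> carrier (?GX Mod ?BX)"
      then obtain x where x: "x \<in> carrier ?GX" "C = ?BX #>\<^bsub>?GX\<^esub> x"
        unfolding carrier_FactGroup by blast
      then have "Poly_Mapping.keys x \<subseteq> gens X" unfolding carrier_cycles by blast
      then have "C = ?h (f x)" using x r_f by simp
      then show "C \<in> ?h ` carrier ?GY" using fGY[OF x(1)] by blast
    qed
  qed
  then have "?GY Mod (kernel ?GY (?GX Mod ?BX) ?h) \<cong> ?GX Mod ?BX"
    by (rule h.FactGroup_iso)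
  moreover have "kernel ?GY (?GX Mod ?BX) ?h = ?BY"
  proof (intro equalityI subsetI)
    fix y assume "y \<in> kernel ?GY (?GX Mod ?BX) ?h"
    then have y: "y \<in> carrier ?GY" "?h y = ?BX" unfolding kernel_def by auto
    then have "r y \<in> ?BX" using GX.coset_join1 BX.subgroup_axioms rGX by blast
    then obtain x where "x \<in> carrier (summand X (p - s))" "r y = dX x"
      by (elim imageE)
    then have x: "Poly_Mapping.keys x \<subseteq> {g \<in> gens X. bideg X g = p - s}" "r y = dX x"
      by (simp_all add: summand_def)
    have yk: "Poly_Mapping.keys y \<subseteq> {g \<in> gens Y. bideg Y g = q}" "dY y = 0"
      using y(1) by (simp_all only: carrier_cycles)
    \<comment> \<open>The homotopy identity for a cycle y reads dY (F y) = y - f (r y), and here r y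
      = dX x.\<close>
    have "y = dY (F y) + f (dX x)"
      using htpy[of y] yk zero[OF F] x(2) by (force simp: algebra_simps)
    also have "f (dX x) = dY (f x)" using x by (intro f_d) blast
    also have "dY (F y) + dY (f x) = dY (F y + f x)"
      using F_keys[OF yk(1)] f_keys[OF M(2) x(1)] dY unfolding differential_def
      by (intro graded_hom_add[of dY Y Y "\<lambda>p q. q = p + t", symmetric]) blast+
    finally have "y = dY (F y + f x)" .
    moreover have "F y + f x \<in> carrier (summand Y (q - t))"
      unfolding summand_def carrier_free_Abelian_group_iff
      using F_keys[OF yk(1)] f_keys[OF M(2) x(1)] keys_add[of "F y" "f x"] by blast
    ultimately show "y \<in> ?BY" by blast
  next
    fix y assume y: "y \<in> ?BY"
    then have yG: "y \<in> carrier ?GY"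
      using boundaries_normal[OF dY, of q] normal_imp_subgroup subgroup.subset by blast
    obtain y' where "y' \<in> carrier (summand Y (q - t))" "y = dY y'"
      using y by (elim imageE)
    then have y': "Poly_Mapping.keys y' \<subseteq> {g \<in> gens Y. bideg Y g = q - t}" "y = dY y'"
      by (simp_all add: summand_def)
    then have "r y = dX (r y')" using r_d[of y'] by blast
    moreover have "r y' \<in> carrier (summand X (p - s))"
      unfolding summand_def carrier_free_Abelian_group_iff using r_keys[OF M(2) y'(1)] .
    ultimately have "r y \<in> ?BX" by blast
    then have "?h y = ?BX" using GX.coset_join2[OF rGX[OF yG] BX.subgroup_axioms] by blast
    then show "y \<in> kernel ?GY (?GX Mod ?BX) ?h" using yG by (simp add: kernel_def)
  qed
  ultimately show ?thesis by (simp add: homology_def)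
qed

text \<open>In an unmatched bidegree the retraction can only take the value 0, so the homotopy
  exhibits every cycle as a boundary. In the application these are the bidegrees for which the
  formula for v gives no integer.\<close>

lemma homology_trivial:
  assumes "\<nexists>p. M q p"
  shows "trivial_group (homology Y t dY q)"
proof -
  obtain r f F where dY: "differential Y t dY"
    and r: "r \<in> graded_hom Y X M" and f: "f \<in> graded_hom X Y (\<lambda>p q. M q p)"
    and F: "F \<in> graded_hom Y Y (\<lambda>p q. q = p - t)"
    and htpy: "\<And>y. Poly_Mapping.keys y \<subseteq> gens Y \<Longrightarrow> dY (F y) + F (dY y) = y - f (r y)"
    by (rule retractE) blast
  let ?GY = "cycles Y t dY q" and ?BY = "boundaries Y t dY q"
  interpret GY: comm_group ?GY by (rule cycles_comm_group[OF dY])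
  interpret BY: normal ?BY ?GY by (rule boundaries_normal[OF dY])
  have "y \<in> ?BY" if "y \<in> carrier ?GY" for y
  proof -
    have y: "Poly_Mapping.keys y \<subseteq> {g \<in> gens Y. bideg Y g = q}" "dY y = 0"
      using that by (simp_all only: carrier_cycles)
    have "Poly_Mapping.keys (r y) = {}" using graded_hom_bideg[OF r y(1)] assms by blast
    then have "f (r y) = 0" using graded_hom_add[OF f, of 0 0] by simp
    moreover have "F (dY y) = 0" using y graded_hom_add[OF F, of 0 0] by simp
    ultimately have "y = dY (F y)" using htpy[of y] y by force
    moreover have "Poly_Mapping.keys (F y) \<subseteq> {g \<in> gens Y. bideg Y g = q - t}"
      using graded_hom_keys[OF F, of y] graded_hom_bideg[OF F y(1)] y by blast
    ultimately show ?thesis unfolding summand_def by auto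
  qed
  then have "carrier (?GY Mod ?BY) \<subseteq> {?BY}"
    unfolding carrier_FactGroup using GY.coset_join2[OF _ BY.subgroup_axioms] by blast
  then have "carrier (?GY Mod ?BY) = {\<one>\<^bsub>?GY Mod ?BY\<^esub>}"
    using BY.factorgroup_is_group group.is_monoid monoid.one_closed by (metis (lifting) one_FactGroup subset_singletonD empty_iff)
  then show ?thesis
    using BY.factorgroup_is_group by (simp add: trivial_group_def homology_def)
qed

end

section \<open>Merging two classes of an equivalence relation\<close>

text \<open>For an equivalence \<open>R\<close> and x, y in its carrier this is the equivalence
  generated by \<open>R\<close> and (x, y). It is written without a closure so that membership
  reduces to a few cases.\<close>

definition merge_rel :: "'a rel \<Rightarrow> 'a \<Rightarrow> 'a \<Rightarrow> 'a rel"
  where "merge_rel R x y = R \<union> {(a, b). (a, x) \<in> R \<and> (b, y) \<in> R \<or> (a, y) \<in> R \<and> (b, x) \<in> R}"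

lemma merge_commute: "merge_rel R x y = merge_rel R y x"
  by (auto simp: merge_rel_def)

lemma subset_merge: "R \<subseteq> merge_rel R x y"
  by (auto simp: merge_rel_def)

context
  fixes A :: "'a set" and R :: "'a rel"
  assumes R: "equiv A R"
begin

lemma equiv_in: "(a, b) \<in> R \<Longrightarrow> a \<in> A" "(a, b) \<in> R \<Longrightarrow> b \<in> A"
  using equivE[OF R] by auto

lemma equiv_sym: "(a, b) \<in> R \<Longrightarrow> (b, a) \<in> R"
  using R by (auto elim: equivE symE)

lemma equiv_trans: "(a, b) \<in> R \<Longrightarrow> (b, c) \<in> R \<Longrightarrow> (a, c) \<in> R"
  using R by (auto elim: equivE transE)

lemma equiv_refl: "a \<in> A \<Longrightarrow> (a, a) \<in> R"
  using R by (auto elim!: equivE dest: refl_onD)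

lemma class_eq_iff: "a \<in> A \<Longrightarrow> b \<in> A \<Longrightarrow> R `` {a} = R `` {b} \<longleftrightarrow> (a, b) \<in> R"
  using eq_equiv_class_iff[OF R] by blast

lemma equiv_merge:
  assumes "x \<in> A" "y \<in> A"
  shows "equiv A (merge_rel R x y)"
proof (rule equivI)
  show "merge_rel R x y \<subseteq> A \<times> A"
    using equiv_in by (auto simp: merge_rel_def)
  show "refl_on A (merge_rel R x y)"
    using equiv_refl by (auto simp: refl_on_def merge_rel_def)
  show "sym (merge_rel R x y)"
    by (rule symI) (auto simp: merge_rel_def dest: equiv_sym)
  show "trans (merge_rel R x y)"
    by (rule transI) (auto simp: merge_rel_def; meson equiv_sym equiv_trans)
qed

lemma merge_subset:
  assumes "equiv A Q" "R \<subseteq> Q" "(x, y) \<in> Q"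
  shows "merge_rel R x y \<subseteq> Q"
proof -
  have "sym Q" "trans Q" using assms(1) by (auto elim: equivE)
  then show ?thesis
    using assms(2,3) unfolding merge_rel_def by (auto; meson subsetD symD transD)
qed

lemma merge_absorb:
  assumes "(x, y) \<in> R"
  shows "merge_rel R x y = R"
  by (rule equalityI[OF merge_subset[OF R order_refl assms] subset_merge])

context
  fixes x y :: 'a
  assumes x: "x \<in> A" and y: "y \<in> A" and xy: "(x, y) \<notin> R"
begin

lemma merge_class: "(a, x) \<notin> R \<Longrightarrow> (a, y) \<notin> R \<Longrightarrow> merge_rel R x y `` {a} = R `` {a}"
  by (auto simp: merge_rel_def)

lemma merge_class_merged: "merge_rel R x y `` {x} = R `` {x} \<union> R `` {y}"
  using x y xy equiv_refl equiv_sym by (auto simp: merge_rel_def)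

text \<open>A class through x or y that survived the merge would contain both points, although they
  are unrelated.\<close>

lemma class_in_merge_iff: "a \<in> A \<Longrightarrow> R `` {a} \<in> A // merge_rel R x y \<longleftrightarrow> (a, x) \<notin> R \<and> (a, y) \<notin> R"
proof
  assume a: "a \<in> A" and "R `` {a} \<in> A // merge_rel R x y"
  then obtain b where "b \<in> A" "R `` {a} = merge_rel R x y `` {b}" by (auto elim: quotientE)
  then have ab: "R `` {a} = merge_rel R x y `` {a}"
    using equiv_class_eq[OF equiv_merge[OF x y]] equiv_refl[OF a]
    by (metis Image_singleton_iff)
  show "(a, x) \<notin> R \<and> (a, y) \<notin> R"
  proof (rule ccontr)
    assume "\<not> ?thesis"
    then have "(a, x) \<in> R \<or> (a, y) \<in> R" by blast
    then have "x \<in> merge_rel R x y `` {a}" "y \<in> merge_rel R x y `` {a}"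
      using equiv_refl[OF x] equiv_refl[OF y] by (auto simp: merge_rel_def)
    then have "(a, x) \<in> R" "(a, y) \<in> R" using ab by auto
    then show False using xy equiv_sym equiv_trans by blast
  qed
next
  assume "a \<in> A" "(a, x) \<notin> R \<and> (a, y) \<notin> R"
  then show "R `` {a} \<in> A // merge_rel R x y" using merge_class quotientI by metis
qed

lemma quotient_diff_merge: "A // R - A // merge_rel R x y = {R `` {x}, R `` {y}}"
proof (intro equalityI subsetI)
  fix C assume C: "C \<in> A // R - A // merge_rel R x y"
  then obtain a where "a \<in> A" "C = R `` {a}" by (auto elim: quotientE)
  then show "C \<in> {R `` {x}, R `` {y}}"
    using C class_in_merge_iff[of a] class_eq_iff x y by auto
qed (use class_in_merge_iff x y equiv_refl quotientI in fastforce)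

lemma quotient_merge_diff: "A // merge_rel R x y - A // R = {merge_rel R x y `` {x}}"
proof (intro equalityI subsetI)
  fix C assume C: "C \<in> A // merge_rel R x y - A // R"
  then obtain a where a: "a \<in> A" "C = merge_rel R x y `` {a}" by (auto elim: quotientE)
  then have "(a, x) \<in> R \<or> (a, y) \<in> R" using C merge_class[of a] quotientI[of a A R] by (metis DiffD2)
  then have "(a, x) \<in> merge_rel R x y"
    using a equiv_refl[OF x] equiv_refl[OF y] by (auto simp: merge_rel_def)
  then show "C \<in> {merge_rel R x y `` {x}}"
    using equiv_class_eq[OF equiv_merge[OF x y]] a(2) by auto
next
  fix C assume C: "C \<in> {merge_rel R x y `` {x}}"
  have "merge_rel R x y `` {x} \<notin> A // R"
  proof
    assume "merge_rel R x y `` {x} \<in> A // R"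
    then obtain b where "b \<in> A" "merge_rel R x y `` {x} = R `` {b}" by (auto elim: quotientE)
    moreover have "x \<in> merge_rel R x y `` {x}" "y \<in> merge_rel R x y `` {x}"
      using merge_class_merged equiv_refl x y by auto
    ultimately have "(b, x) \<in> R" "(b, y) \<in> R" by auto
    then show False using xy equiv_sym[of b x] equiv_trans[of x b y] by blast
  qed
  then show "C \<in> A // merge_rel R x y - A // R" using C x by (auto intro: quotientI)
qed

text \<open>\<open>state_targets\<close> compares signs as sets of common circles; here the
  comparison is made at representatives, which is how all later arguments address circles.\<close>

lemma agree_off_merged_iff:
  assumes P: "P \<subseteq> A // R" and Q: "Q \<subseteq> A // merge_rel R x y"
  shows "Q \<inter> A // R = P \<inter> A // merge_rel R x y \<longleftrightarrow>
    (\<forall>a\<in>A. (a, x) \<notin> merge_rel R x y \<longrightarrow> (merge_rel R x y `` {a} \<in> Q \<longleftrightarrow> R `` {a} \<in> P))"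
proof -
  let ?M = "merge_rel R x y"
  have off: "(a, x) \<notin> ?M \<longleftrightarrow> (a, x) \<notin> R \<and> (a, y) \<notin> R" if "a \<in> A" for a
    using equiv_refl[OF x] equiv_refl[OF y] by (auto simp: merge_rel_def)
  have same: "?M `` {a} = R `` {a}" "R `` {a} \<in> A // R \<inter> A // ?M" if "a \<in> A" "(a, x) \<notin> ?M" for a
    using that off merge_class[of a] class_in_merge_iff[of a] quotientI[of a A R] by auto
  have "\<exists>a\<in>A. (a, x) \<notin> ?M \<and> C = R `` {a}" if C: "C \<in> A // R" "C \<in> A // ?M" for C
  proof -
    obtain a where a: "a \<in> A" "C = R `` {a}" using C(1) by (auto elim: quotientE)
    then show ?thesis using C(2) class_in_merge_iff[of a] off[of a] by blast
  qed
  then have common: "A // R \<inter> A // ?M = {R `` {a} | a. a \<in> A \<and> (a, x) \<notin> ?M}"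
    using same(2) by blast
  have "Q \<inter> A // R = P \<inter> A // ?M \<longleftrightarrow> (\<forall>C \<in> A // R \<inter> A // ?M. C \<in> Q \<longleftrightarrow> C \<in> P)"
    using P Q by blast
  also have "\<dots> \<longleftrightarrow> (\<forall>a\<in>A. (a, x) \<notin> ?M \<longrightarrow> (R `` {a} \<in> Q \<longleftrightarrow> R `` {a} \<in> P))"
    unfolding common by blast
  finally show ?thesis using same(1) by simp
qed

lemma card_quotient_merge:
  assumes "finite A"
  shows "card (A // R) = card (A // merge_rel R x y) + 1"
proof -
  have fin: "finite (A // R)" "finite (A // merge_rel R x y)"
    using assms equiv_type[OF R] equiv_type[OF equiv_merge[OF x y]] by (simp_all add: finite_quotient)
  have "R `` {x} \<noteq> R `` {y}" using class_eq_iff x y xy by simp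
  then have "card (A // R - A // merge_rel R x y) = 2" by (simp add: quotient_diff_merge)
  moreover have "card (A // merge_rel R x y - A // R) = 1" by (simp add: quotient_merge_diff)
  moreover have "card (A // R) = card (A // R \<inter> A // merge_rel R x y) + card (A // R - A // merge_rel R x y)"
    "card (A // merge_rel R x y) = card (A // R \<inter> A // merge_rel R x y) + card (A // merge_rel R x y - A // R)"
    using card_Int_Diff[OF fin(1), of "A // merge_rel R x y"] card_Int_Diff[OF fin(2), of "A // R"]
    by (simp_all only: Int_commute)
  ultimately show ?thesis by simp
qed

end
end

lemma card_quotient_1_iff:
  assumes R: "equiv A R" and A: "A \<noteq> {}"
  shows "card (A // R) = 1 \<longleftrightarrow> R = A \<times> A"
proof
  assume "card (A // R) = 1"
  then obtain C where C: "A // R = {C}" by (auto simp: card_1_singleton_iff)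
  have "(a, b) \<in> R" if "a \<in> A" "b \<in> A" for a b
  proof -
    have "R `` {a} = C" "R `` {b} = C" using that quotientI[of _ A R] C by blast+
    then show ?thesis using class_eq_iff[OF R that] by simp
  qed
  then show "R = A \<times> A" using equiv_type[OF R] by blast
next
  assume "R = A \<times> A"
  then have "A // R = {A}" using A by (auto simp: quotient_def)
  then show "card (A // R) = 1" by simp
qed

lemma equiv_eqv_gen: "equiv A (eqv_gen A R)"
proof (rule equivI)
  have "sym ((R \<union> R\<inverse>)\<^sup>*)" by (rule sym_rtrancl) (auto simp: sym_def)
  then show "sym (eqv_gen A R)" by (auto simp: eqv_gen_def sym_def)
  show "trans (eqv_gen A R)" by (rule transI) (auto simp: eqv_gen_def)
qed (auto simp: eqv_gen_def refl_on_def)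

lemma eqv_gen_base: "(a, b) \<in> R \<Longrightarrow> a \<in> A \<Longrightarrow> b \<in> A \<Longrightarrow> (a, b) \<in> eqv_gen A R"
  by (auto simp: eqv_gen_def)

lemma eqv_gen_subset:
  assumes Q: "equiv A Q" and R: "R \<subseteq> Q"
  shows "eqv_gen A R \<subseteq> Q"
proof (clarsimp simp: eqv_gen_def)
  fix a b assume "(a, b) \<in> (R \<union> R\<inverse>)\<^sup>*" and "a \<in> A"
  then show "(a, b) \<in> Q"
  proof (induction rule: rtrancl_induct)
    case base
    then show ?case using equiv_refl[OF Q] by blast
  next
    case (step b c)
    then have "(b, c) \<in> Q" using R equiv_sym[OF Q] by blast
    then show ?case using step equiv_trans[OF Q] by blast
  qed
qed

text \<open>The sign rules name the two circles in some order. They are symmetric, so any fixed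
  naming may be used.\<close>

lemma ex_doubleton_eq_iff:
  assumes "p \<noteq> q" and F: "F p q \<longleftrightarrow> F q p"
  shows "(\<exists>a b. a \<noteq> b \<and> {p, q} = {a, b} \<and> F a b) \<longleftrightarrow> F p q"
proof
  assume "\<exists>a b. a \<noteq> b \<and> {p, q} = {a, b} \<and> F a b"
  then obtain a b where "{p, q} = {a, b}" "F a b" by blast
  then show "F p q" using F by (auto simp: doubleton_eq_iff)
qed (use assms in blast)

lemma sign_rule_merge:
  assumes "p \<noteq> q"
  shows "sign_rule {p, q} P {z} Q \<longleftrightarrow>
    p \<notin> P \<and> q \<notin> P \<and> z \<notin> Q \<or> (p \<in> P) \<noteq> (q \<in> P) \<and> z \<in> Q"
proof -
  have "{p, q} \<noteq> {a}" for a using assms by blast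
  then have "sign_rule {p, q} P {z} Q \<longleftrightarrow> (\<exists>a b. a \<noteq> b \<and> {p, q} = {a, b} \<and>
      (a \<notin> P \<and> b \<notin> P \<and> z \<notin> Q \<or> (a \<in> P) \<noteq> (b \<in> P) \<and> z \<in> Q))"
    unfolding sign_rule_def by simp
  also have "\<dots> \<longleftrightarrow> p \<notin> P \<and> q \<notin> P \<and> z \<notin> Q \<or> (p \<in> P) \<noteq> (q \<in> P) \<and> z \<in> Q"
    by (rule ex_doubleton_eq_iff[OF assms]) blast
  finally show ?thesis .
qed

lemma sign_rule_split:
  assumes "p \<noteq> q"
  shows "sign_rule {z} P {p, q} Q \<longleftrightarrow>
    z \<in> P \<and> p \<in> Q \<and> q \<in> Q \<or> z \<notin> P \<and> (p \<in> Q) \<noteq> (q \<in> Q)"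
proof -
  have "{p, q} \<noteq> {a}" for a using assms by blast
  then have "sign_rule {z} P {p, q} Q \<longleftrightarrow> (\<exists>a b. a \<noteq> b \<and> {p, q} = {a, b} \<and>
      (z \<in> P \<and> a \<in> Q \<and> b \<in> Q \<or> z \<notin> P \<and> (a \<in> Q) \<noteq> (b \<in> Q)))"
    unfolding sign_rule_def by simp
  also have "\<dots> \<longleftrightarrow> z \<in> P \<and> p \<in> Q \<and> q \<in> Q \<or> z \<notin> P \<and> (p \<in> Q) \<noteq> (q \<in> Q)"
    by (rule ex_doubleton_eq_iff[OF assms]) blast
  finally show ?thesis .
qed

section \<open>The cube of smoothings\<close>

definition smoothing_rel :: "('c, 'a) link_diagram \<Rightarrow> 'c set \<Rightarrow> 'a rel"
  where "smoothing_rel D B = eqv_gen (arcs D)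
    {(arc_at D (c, k), arc_at D (c, l)) | c k l.
       c \<in> crossings D \<and> (k, l) \<in> smoothing_pairs (c \<in> B)}"

lemma circles_eq: "circles D B = arcs D // smoothing_rel D B"
  by (simp add: circles_def smoothing_rel_def)

definition flip :: "'c \<Rightarrow> 'c set \<Rightarrow> 'c set"
  where "flip c B = (if c \<in> B then B - {c} else insert c B)"

lemma flip_flip [simp]: "flip c (flip c B) = B"
  by (auto simp: flip_def)

lemma flip_commute: "flip c (flip b B) = flip b (flip c B)"
  by (auto simp: flip_def)

lemma flip_subset: "c \<in> E \<Longrightarrow> B \<subseteq> E \<Longrightarrow> flip c B \<subseteq> E"
  by (auto simp: flip_def)

text \<open>What is kept of the plane: at each crossing the arcs \<open>x c\<close> and
  \<open>y c\<close> tell whether one circle or two pass through it. \<open>dichotomy\<close>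
  excludes a change of smoothing that turns one circle into one circle, and \<open>connected\<close>
  says that the circles of any state become one class when \<open>x c\<close> and \<open>y c\<close>
  are identified at every crossing.\<close>

locale smoothing_cube =
  fixes D :: "('c::linorder, 'a) link_diagram" and x y :: "'c \<Rightarrow> 'a"
  assumes finite_crossings: "finite (crossings D)" and finite_arcs: "finite (arcs D)"
    and arcs_nonempty: "arcs D \<noteq> {}"
    and x_arc: "c \<in> crossings D \<Longrightarrow> x c \<in> arcs D" and y_arc: "c \<in> crossings D \<Longrightarrow> y c \<in> arcs D"
    and dichotomy: "B \<subseteq> crossings D \<Longrightarrow> c \<in> crossings D \<Longrightarrow>
      (x c, y c) \<in> smoothing_rel D B \<longleftrightarrow> (x c, y c) \<notin> smoothing_rel D (flip c B)"
    and flip_merge: "B \<subseteq> crossings D \<Longrightarrow> c \<in> crossings D \<Longrightarrow> (x c, y c) \<notin> smoothing_rel D B \<Longrightarrow>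
      smoothing_rel D (flip c B) = merge_rel (smoothing_rel D B) (x c) (y c)"
    and connected: "B \<subseteq> crossings D \<Longrightarrow> equiv (arcs D) Q \<Longrightarrow> smoothing_rel D B \<subseteq> Q \<Longrightarrow>
      (\<And>c. c \<in> crossings D \<Longrightarrow> (x c, y c) \<in> Q) \<Longrightarrow> Q = arcs D \<times> arcs D"
begin

abbreviation "A \<equiv> arcs D"
abbreviation "E \<equiv> crossings D"
abbreviation "R \<equiv> smoothing_rel D"
abbreviation circle where "circle B a \<equiv> R B `` {a}"

lemma equiv_R [simp]: "equiv A (R B)"
  unfolding smoothing_rel_def by (rule equiv_eqv_gen)

lemmas R_refl = equiv_refl[OF equiv_R] and R_sym = equiv_sym[OF equiv_R]
  and R_trans = equiv_trans[OF equiv_R] and R_in = equiv_in[OF equiv_R]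
  and circle_eq_iff = class_eq_iff[OF equiv_R]

lemma circle_in: "a \<in> A \<Longrightarrow> circle B a \<in> circles D B"
  by (simp add: circles_eq quotientI)

lemma circlesE:
  assumes "C \<in> circles D B"
  obtains a where "a \<in> A" "C = circle B a"
  using assms by (auto simp: circles_eq elim: quotientE)

lemma finite_circles: "finite (circles D B)"
  unfolding circles_eq using finite_arcs equiv_type[OF equiv_R] by (rule finite_quotient)

lemma card_circles_flip:
  assumes "B \<subseteq> E" "c \<in> E"
  shows "(x c, y c) \<notin> R B \<Longrightarrow> card (circles D B) = card (circles D (flip c B)) + 1"
    "(x c, y c) \<in> R B \<Longrightarrow> card (circles D (flip c B)) = card (circles D B) + 1"
proof -
  have *: "card (circles D B) = card (circles D (flip c B)) + 1"
    if "(x c, y c) \<notin> R B" "B \<subseteq> E" for B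
    unfolding circles_eq flip_merge[OF that(2) assms(2) that(1)]
    by (rule card_quotient_merge) (use assms that x_arc y_arc finite_arcs in auto)
  then show "(x c, y c) \<notin> R B \<Longrightarrow> card (circles D B) = card (circles D (flip c B)) + 1"
    using assms by blast
  show "(x c, y c) \<in> R B \<Longrightarrow> card (circles D (flip c B)) = card (circles D B) + 1"
    using *[of "flip c B"] dichotomy[OF assms] flip_subset[OF assms(2,1)] by simp
qed

context
  fixes B c
  assumes B: "B \<subseteq> E" and c: "c \<in> E" "c \<notin> B"
begin

lemma flip_insert: "flip c B = insert c B"
  using c by (simp add: flip_def)

text \<open>The old circles and the new one are the two differences of the circle sets, so the sign
  rule becomes a condition at \<open>x c\<close> and \<open>y c\<close>, and the remaining circles
  are compared at representatives.\<close>

lemma merge_targets: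
  assumes xy: "(x c, y c) \<notin> R B" and P: "P \<subseteq> circles D B"
  shows "(B', Q) \<in> state_targets D (B, P) c \<longleftrightarrow> B' = insert c B \<and> Q \<subseteq> circles D B' \<and>
    (\<forall>a\<in>A. (a, x c) \<notin> R B' \<longrightarrow> (circle B' a \<in> Q \<longleftrightarrow> circle B a \<in> P)) \<and>
    (circle B (x c) \<notin> P \<and> circle B (y c) \<notin> P \<and> circle B' (x c) \<notin> Q \<or>
     (circle B (x c) \<in> P) \<noteq> (circle B (y c) \<in> P) \<and> circle B' (x c) \<in> Q)"
proof -
  let ?B = "insert c B"
  have J: "R ?B = merge_rel (R B) (x c) (y c)"
    using flip_merge[OF B c(1) xy] by (simp add: flip_insert)
  note ctx = equiv_R x_arc[OF c(1)] y_arc[OF c(1)] xy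
  have old: "circles D B - circles D ?B = {circle B (x c), circle B (y c)}"
    unfolding circles_eq J by (rule quotient_diff_merge[OF ctx])
  have new: "circles D ?B - circles D B = {circle ?B (x c)}"
    unfolding circles_eq J by (rule quotient_merge_diff[OF ctx])
  have ne: "circle B (x c) \<noteq> circle B (y c)" using circle_eq_iff ctx by simp
  note rule = sign_rule_merge[OF ne, of P "circle ?B (x c)"]
  have "Q \<inter> circles D B = P \<inter> circles D ?B \<longleftrightarrow>
    (\<forall>a\<in>A. (a, x c) \<notin> R ?B \<longrightarrow> (circle ?B a \<in> Q \<longleftrightarrow> circle B a \<in> P))"
    if "Q \<subseteq> circles D ?B" for Q
    using P that unfolding circles_eq J by (rule agree_off_merged_iff[OF ctx])
  then show ?thesis
    unfolding state_targets_def by (auto simp: old new rule)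
qed

lemma split_targets:
  assumes xy: "(x c, y c) \<in> R B" and P: "P \<subseteq> circles D B"
  shows "(B', Q) \<in> state_targets D (B, P) c \<longleftrightarrow> B' = insert c B \<and> Q \<subseteq> circles D B' \<and>
    (\<forall>a\<in>A. (a, x c) \<notin> R B \<longrightarrow> (circle B' a \<in> Q \<longleftrightarrow> circle B a \<in> P)) \<and>
    (circle B (x c) \<in> P \<and> circle B' (x c) \<in> Q \<and> circle B' (y c) \<in> Q \<or>
     circle B (x c) \<notin> P \<and> (circle B' (x c) \<in> Q) \<noteq> (circle B' (y c) \<in> Q))"
proof -
  let ?B = "insert c B"
  have xy': "(x c, y c) \<notin> R ?B" using dichotomy[OF B c(1)] xy by (simp add: flip_insert)
  have J: "R B = merge_rel (R ?B) (x c) (y c)"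
    using flip_merge[OF flip_subset[OF c(1) B] c(1)] xy' by (metis flip_flip flip_insert)
  note ctx = equiv_R x_arc[OF c(1)] y_arc[OF c(1)] xy'
  have new: "circles D ?B - circles D B = {circle ?B (x c), circle ?B (y c)}"
    unfolding circles_eq J by (rule quotient_diff_merge[OF ctx])
  have old: "circles D B - circles D ?B = {circle B (x c)}"
    unfolding circles_eq J by (rule quotient_merge_diff[OF ctx])
  have ne: "circle ?B (x c) \<noteq> circle ?B (y c)" using circle_eq_iff ctx by simp
  note rule = sign_rule_split[OF ne, of "circle B (x c)"]
  have "Q \<inter> circles D B = P \<inter> circles D ?B \<longleftrightarrow>
    (\<forall>a\<in>A. (a, x c) \<notin> R B \<longrightarrow> (circle ?B a \<in> Q \<longleftrightarrow> circle B a \<in> P))"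
    if "Q \<subseteq> circles D ?B" for Q
    using agree_off_merged_iff[OF ctx that[unfolded circles_eq] P[unfolded circles_eq J]]
    unfolding circles_eq J by (auto simp only:)
  then show ?thesis
    unfolding state_targets_def by (auto simp: old new rule)
qed

end
end

section \<open>The Khovanov differential\<close>

text \<open>Since tau is twice the number of positive circles minus the number of circles, this says
  that every merge and every split raises tau by 1.\<close>

lemma sign_rule_degree:
  assumes "sign_rule Old P New Q"
  shows "2 * card (Q \<inter> New) + card Old = 2 * card (P \<inter> Old) + card New + 1"
  using assms unfolding sign_rule_def
proof (elim disjE exE conjE)
  fix a b z assume "a \<noteq> b" "Old = {a, b}" "New = {z}"
  then show "a \<notin> P \<Longrightarrow> b \<notin> P \<Longrightarrow> z \<notin> Q \<Longrightarrow> ?thesis"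
    "(a \<in> P) \<noteq> (b \<in> P) \<Longrightarrow> z \<in> Q \<Longrightarrow> ?thesis"
    by (cases "a \<in> P"; cases "b \<in> P"; simp add: Int_insert_right)+
next
  fix z a b assume "a \<noteq> b" "Old = {z}" "New = {a, b}"
  then show "z \<in> P \<Longrightarrow> a \<in> Q \<Longrightarrow> b \<in> Q \<Longrightarrow> ?thesis"
    "z \<notin> P \<Longrightarrow> (a \<in> Q) \<noteq> (b \<in> Q) \<Longrightarrow> ?thesis"
    by (cases "a \<in> Q"; cases "b \<in> Q"; simp add: Int_insert_right)+
qed

text \<open>Truth table of a merge. X and Y say that \<open>V\<close> meets the two circles, p and q
  that they are positive; s stands for separatedness and r for the other circles. On the left are
  the two shifted weights, on the right the merge rule.\<close>

lemma of_bool_insert_cases: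
  "(of_bool (s \<and> \<not> X \<and> r \<and> \<not> p \<and> (q \<longleftrightarrow> \<not> Y)) :: nat) + of_bool (s \<and> \<not> Y \<and> r \<and> \<not> q \<and> (p \<longleftrightarrow> \<not> X)) =
   of_bool (s \<and> \<not> (X \<and> Y) \<and> r \<and> (\<not> p \<and> \<not> q \<and> (X \<or> Y) \<or> p \<noteq> q \<and> \<not> (X \<or> Y)))"
  by (cases X; cases Y; cases p; cases q) simp_all

context smoothing_cube
begin

lemma finite_targets:
  assumes "fst s \<subseteq> E" "c \<in> E - fst s"
  shows "finite (state_targets D s c)"
proof -
  have "state_targets D s c \<subseteq> {insert c (fst s)} \<times> Pow (circles D (insert c (fst s)))"
    by (auto simp: state_targets_def split: prod.splits)
  then show ?thesis by (rule finite_subset) (simp add: finite_circles)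
qed

lemma target_fst: "t \<in> state_targets D s c \<Longrightarrow> fst t = insert c (fst s)"
  by (auto simp: state_targets_def split: prod.splits)

lemma target_enhanced:
  "s \<in> enhanced_states D \<Longrightarrow> c \<in> E \<Longrightarrow> t \<in> state_targets D s c \<Longrightarrow> t \<in> enhanced_states D"
  by (auto simp: state_targets_def enhanced_states_def)

lemma state_i_target:
  assumes s: "s \<in> enhanced_states D" and c: "c \<in> E - fst s" and t: "t \<in> state_targets D s c"
  shows "state_i D t = state_i D s + 1"
proof -
  have B: "fst s \<subseteq> E" using s by (auto simp: enhanced_states_def)
  have "finite (fst s)" by (rule finite_subset[OF B finite_crossings])
  moreover have "E - insert c (fst s) = (E - fst s) - {c}" by auto
  moreover have "card (E - fst s) > 0" using c finite_crossings by (auto simp: card_gt_0_iff)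
  ultimately have "state_sigma D t = state_sigma D s - 2"
    using c finite_crossings target_fst[OF t]
    by (simp add: state_sigma_def case_prod_beta card_Diff_singleton)
  then show ?thesis by (simp add: state_i_def)
qed

lemma state_tau_target:
  assumes s: "s \<in> enhanced_states D" and t: "t \<in> state_targets D s c"
  shows "state_tau D t = state_tau D s + 1"
proof -
  obtain B P where BP: "s = (B, P)" by fastforce
  let ?C = "circles D B" and ?C' = "circles D (insert c B)"
  have P: "P \<subseteq> ?C" using s BP by (simp add: enhanced_states_def)
  obtain Q where Q: "t = (insert c B, Q)" "Q \<subseteq> ?C'" "Q \<inter> ?C = P \<inter> ?C'"
    and rule: "sign_rule (?C - ?C') P (?C' - ?C) Q"
    using t BP by (auto simp: state_targets_def)
  note fin = finite_subset[OF P finite_circles] finite_subset[OF Q(2) finite_circles]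
  have "P - ?C' = P \<inter> (?C - ?C')" "Q - ?C = Q \<inter> (?C' - ?C)" using P Q by auto
  then have "card P = card (P \<inter> ?C') + card (P \<inter> (?C - ?C'))"
    "card Q = card (Q \<inter> ?C) + card (Q \<inter> (?C' - ?C))"
    using card_Int_Diff[OF fin(1), of ?C'] card_Int_Diff[OF fin(2), of ?C] by simp_all
  moreover have "card ?C = card (?C \<inter> ?C') + card (?C - ?C')"
    "card ?C' = card (?C \<inter> ?C') + card (?C' - ?C)"
    using card_Int_Diff[OF finite_circles[of B], of ?C']
      card_Int_Diff[OF finite_circles[of "insert c B"], of ?C] by (simp_all add: Int_commute)
  moreover have "card (?C - P) = card ?C - card P" "card (?C' - Q) = card ?C' - card Q"
    using P Q(2) fin by (simp_all add: card_Diff_subset)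
  moreover have "card P \<le> card ?C" "card Q \<le> card ?C'"
    using P Q(2) finite_circles by (simp_all add: card_mono)
  ultimately show ?thesis
    using sign_rule_degree[OF rule] Q(3) by (simp add: BP Q(1) state_tau_def)
qed

lemma state_j_target:
  assumes "s \<in> enhanced_states D" "c \<in> E - fst s" "t \<in> state_targets D s c"
  shows "state_j D t = state_j D s"
  using state_i_target[OF assms] state_tau_target[OF assms(1,3)] by (simp add: state_j_def)

text \<open>
  A signed smoothing is represented by the sum of the sets \<open>V\<close> that meet each negative circle in
  one arc and no positive circle. Then a split becomes the identity, and a merge of the circles
  through \<open>x\<close> and \<open>y\<close> the operator that sends a function \<open>\<phi>\<close> of \<open>V\<close> to the sum of
  \<open>\<phi> (insert x V)\<close> and \<open>\<phi> (insert y V)\<close>; operators of this form commute.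
\<close>

definition hit :: "'c set \<Rightarrow> 'a set \<Rightarrow> 'a \<Rightarrow> bool"
  where "hit B V a \<longleftrightarrow> (\<exists>v\<in>V. (a, v) \<in> R B)"

definition separated :: "'c set \<Rightarrow> 'a set \<Rightarrow> bool"
  where "separated B V \<longleftrightarrow> V \<subseteq> A \<and> (\<forall>a\<in>V. \<forall>b\<in>V. (a, b) \<in> R B \<longrightarrow> a = b)"

definition missed :: "'c set \<Rightarrow> 'a set \<Rightarrow> 'a set set"
  where "missed B V = circle B ` {a \<in> A. \<not> hit B V a}"

text \<open>The coefficient at the monomial \<open>V\<close> of a square-free polynomial in the
  arcs: the product, over the negative circles, of the sum of the arcs on the circle.\<close>

definition weight :: "('c, 'a) enhanced_state \<Rightarrow> 'a set \<Rightarrow> nat"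
  where "weight = (\<lambda>(B, P) V. of_bool (separated B V \<and> P = missed B V))"

lemma hit_cong: "(a, b) \<in> R B \<Longrightarrow> hit B V a \<longleftrightarrow> hit B V b"
  unfolding hit_def using R_trans R_sym by blast

lemma missed_subset: "missed B V \<subseteq> circles D B"
  by (auto simp: missed_def circle_in)

lemma circle_missed_iff: "a \<in> A \<Longrightarrow> circle B a \<in> missed B V \<longleftrightarrow> \<not> hit B V a"
proof
  assume a: "a \<in> A" and "circle B a \<in> missed B V"
  then obtain b where "b \<in> A" "\<not> hit B V b" "circle B a = circle B b" by (auto simp: missed_def)
  then show "\<not> hit B V a" using a circle_eq_iff hit_cong by blast
qed (simp add: missed_def)

lemma eq_missed_iff:
  assumes "P \<subseteq> circles D B"
  shows "P = missed B V \<longleftrightarrow> (\<forall>a\<in>A. circle B a \<in> P \<longleftrightarrow> \<not> hit B V a)"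
proof
  assume all: "\<forall>a\<in>A. circle B a \<in> P \<longleftrightarrow> \<not> hit B V a"
  have "C \<in> P \<longleftrightarrow> C \<in> missed B V" if "C \<in> circles D B" for C
    using that all circle_missed_iff by (metis circlesE)
  then show "P = missed B V" using assms missed_subset by blast
qed (simp add: circle_missed_iff)

text \<open>Take one arc on each negative circle. Such a \<open>V\<close> singles out one state
  among those with smoothing \<open>B\<close>, because the positive circles are recovered as the
  missed ones.\<close>

lemma weight_exists:
  assumes "P \<subseteq> circles D B"
  obtains V where "weight (B, P) V = 1"
proof -
  define rep where "rep C = (SOME a. a \<in> C)" for C :: "'a set"
  have rep: "rep (circle B a) \<in> A" "(a, rep (circle B a)) \<in> R B" if "a \<in> A" for a
  proof -
    have "a \<in> circle B a" using R_refl[OF that] by simp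
    then have "rep (circle B a) \<in> circle B a" unfolding rep_def by (rule someI)
    then show "rep (circle B a) \<in> A" "(a, rep (circle B a)) \<in> R B" using R_in by auto
  qed
  let ?V = "rep ` (circles D B - P)"
  have hit: "hit B ?V a \<longleftrightarrow> circle B a \<notin> P" if a: "a \<in> A" for a
  proof
    assume "hit B ?V a"
    then obtain C where C: "C \<in> circles D B" "C \<notin> P" "(a, rep C) \<in> R B" by (auto simp: hit_def)
    then obtain b where b: "b \<in> A" "C = circle B b" by (auto elim: circlesE)
    then have "(a, b) \<in> R B" using rep C(3) R_sym R_trans by blast
    then show "circle B a \<notin> P" using C(2) b a circle_eq_iff by metis
  next
    assume "circle B a \<notin> P"
    then have "rep (circle B a) \<in> ?V" using circle_in[OF a] by blast
    then show "hit B ?V a" using rep(2)[OF a] unfolding hit_def by blast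
  qed
  have "separated B ?V"
    unfolding separated_def
  proof (intro conjI ballI impI)
    show "?V \<subseteq> A" using rep by (auto elim!: circlesE)
  next
    fix v w assume "v \<in> ?V" "w \<in> ?V" and vw: "(v, w) \<in> R B"
    then obtain a b where ab: "a \<in> A" "b \<in> A" "v = rep (circle B a)" "w = rep (circle B b)"
      by (auto elim!: circlesE)
    then have "(a, b) \<in> R B" using vw rep R_sym R_trans by metis
    then show "v = w" using ab circle_eq_iff by metis
  qed
  then have "weight (B, P) ?V = 1"
    using hit by (simp add: weight_def eq_missed_iff[OF assms])
  then show thesis by (rule that)
qed

lemma separated_insert:
  assumes a: "a \<in> A"
  shows "a \<notin> V \<and> separated B (insert a V) \<longleftrightarrow> separated B V \<and> \<not> hit B V a"
proof
  assume l: "a \<notin> V \<and> separated B (insert a V)"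
  then have "separated B V" by (simp add: separated_def)
  moreover have "(a, v) \<notin> R B" if "v \<in> V" for v
  proof
    assume "(a, v) \<in> R B"
    then have "a = v" using l that unfolding separated_def by blast
    then show False using l that by blast
  qed
  ultimately show "separated B V \<and> \<not> hit B V a" by (auto simp: hit_def)
next
  assume r: "separated B V \<and> \<not> hit B V a"
  then have no: "(a, v) \<notin> R B" "(v, a) \<notin> R B" if "v \<in> V" for v
    using that R_sym[of v a B] by (auto simp: hit_def)
  then have "a \<notin> V" using R_refl[OF a] by blast
  moreover have "separated B (insert a V)"
    using r a no unfolding separated_def by (simp; blast)
  ultimately show "a \<notin> V \<and> separated B (insert a V)" by blast
qed

lemma all_classes_iff:
  assumes "a \<in> A" "b \<in> A" and "\<And>d e. (d, e) \<in> R B \<Longrightarrow> Z d \<longleftrightarrow> Z e"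
  shows "(\<forall>d\<in>A. Z d) \<longleftrightarrow> (\<forall>d\<in>A. (d, a) \<notin> R B \<longrightarrow> (d, b) \<notin> R B \<longrightarrow> Z d) \<and> Z a \<and> Z b"
  using assms by blast

text \<open>In the polynomial picture, the partial derivative with respect to the arc
  \<open>a\<close>.\<close>

definition shift :: "('a set \<Rightarrow> nat) \<Rightarrow> 'a \<Rightarrow> 'a set \<Rightarrow> nat"
  where "shift \<phi> a V = (if a \<notin> V then \<phi> (insert a V) else 0)"

text \<open>The derivative at \<open>a\<close> deletes the factor of the circle through
  \<open>a\<close>, which must be negative and is then missed by \<open>V\<close>. The circle
  through \<open>b\<close> is listed apart to fit the truth table of a merge.\<close>

lemma weight_insert_iff:
  assumes P: "P \<subseteq> circles D B" and a: "a \<in> A" and b: "b \<in> A" and ab: "(a, b) \<notin> R B"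
  shows "shift (weight (B, P)) a V =
    of_bool (separated B V \<and> \<not> hit B V a \<and>
      (\<forall>d\<in>A. (d, a) \<notin> R B \<longrightarrow> (d, b) \<notin> R B \<longrightarrow> (circle B d \<in> P \<longleftrightarrow> \<not> hit B V d)) \<and>
      circle B a \<notin> P \<and> (circle B b \<in> P \<longleftrightarrow> \<not> hit B V b))"
proof -
  have sep: "a \<notin> V \<and> separated B (insert a V) \<longleftrightarrow> separated B V \<and> \<not> hit B V a"
    by (rule separated_insert[OF a])
  have hit: "hit B (insert a V) d \<longleftrightarrow> (d, a) \<in> R B \<or> hit B V d" for d
    by (auto simp: hit_def)
  have cong: "(circle B d \<in> P \<longleftrightarrow> \<not> hit B W d) \<longleftrightarrow> (circle B e \<in> P \<longleftrightarrow> \<not> hit B W e)"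
    if "(d, e) \<in> R B" for d e W
    using that circle_eq_iff[of d e B] R_in[OF that] hit_cong[OF that] by simp
  have ba: "(b, a) \<notin> R B" using ab R_sym by blast
  have "(\<forall>d\<in>A. circle B d \<in> P \<longleftrightarrow> \<not> hit B (insert a V) d) \<longleftrightarrow>
    (\<forall>d\<in>A. (d, a) \<notin> R B \<longrightarrow> (d, b) \<notin> R B \<longrightarrow> (circle B d \<in> P \<longleftrightarrow> \<not> hit B V d)) \<and>
      circle B a \<notin> P \<and> (circle B b \<in> P \<longleftrightarrow> \<not> hit B V b)"
    by (subst all_classes_iff[OF a b, of B "\<lambda>d. circle B d \<in> P \<longleftrightarrow> \<not> hit B (insert a V) d"])
      (erule cong, simp add: hit R_refl[OF a] ba)
  then show ?thesis
    using sep by (auto simp: shift_def weight_def eq_missed_iff[OF P])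
qed

text \<open>Each factor is a sum over a whole circle, so the derivative depends only on the circle
  through the arc.\<close>

lemma weight_insert_cong:
  assumes P: "P \<subseteq> circles D B" and ab: "(a, b) \<in> R B"
  shows "shift (weight (B, P)) a V = shift (weight (B, P)) b V"
proof -
  have a: "a \<in> A" "b \<in> A" using ab R_in by auto
  have sep: "d \<notin> V \<and> separated B (insert d V) \<longleftrightarrow> separated B V \<and> \<not> hit B V d" if "d \<in> A" for d
    by (rule separated_insert[OF that])
  have "(d, a) \<in> R B \<longleftrightarrow> (d, b) \<in> R B" for d
    using R_trans[OF _ ab, of d] R_trans[OF _ R_sym[OF ab], of d] by blast
  then have "hit B (insert a V) = hit B (insert b V)"
    by (simp add: hit_def fun_eq_iff)
  then have "missed B (insert a V) = missed B (insert b V)" by (simp add: missed_def)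
  moreover have "a \<notin> V \<and> separated B (insert a V) \<longleftrightarrow> b \<notin> V \<and> separated B (insert b V)"
    using sep[OF a(1)] sep[OF a(2)] hit_cong[OF ab] by blast
  ultimately show ?thesis by (auto simp: shift_def weight_def)
qed

definition transfer :: "'c set \<Rightarrow> 'c \<Rightarrow> ('a set \<Rightarrow> nat) \<Rightarrow> 'a set \<Rightarrow> nat"
  where "transfer B c \<phi> V = (if (x c, y c) \<in> R B then \<phi> V else shift \<phi> (x c) V + shift \<phi> (y c) V)"

text \<open>A given \<open>V\<close> is compatible with at most one target, so the sum is the
  indicator that this target is reached. A split is then the additivity of the sum of arcs over the
  two halves of a circle, and a merge is the product rule.\<close>

lemma weight_targets:
  assumes B: "B \<subseteq> E" and c: "c \<in> E" "c \<notin> B" and P: "P \<subseteq> circles D B"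
  shows "(\<Sum>t\<in>state_targets D (B, P) c. weight t V) = transfer B c (weight (B, P)) V"
proof -
  let ?B = "insert c B"
  note xA = x_arc[OF c(1)] and yA = y_arc[OF c(1)]
  have "weight t V = of_bool (separated ?B V \<and> t = (?B, missed ?B V))"
    if "t \<in> state_targets D (B, P) c" for t
    using target_fst[OF that] by (cases t) (auto simp: weight_def)
  then have "(\<Sum>t\<in>state_targets D (B, P) c. weight t V) =
      (\<Sum>t\<in>state_targets D (B, P) c. if t = (?B, missed ?B V) then of_bool (separated ?B V) else 0)"
    by (intro sum.cong) auto
  also have "\<dots> = of_bool (separated ?B V \<and> (?B, missed ?B V) \<in> state_targets D (B, P) c)"
    using finite_targets[of "(B, P)" c] B c by (simp add: sum.delta)
  also have "\<dots> = transfer B c (weight (B, P)) V"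
  proof (cases "(x c, y c) \<in> R B")
    case False
    have J: "R ?B = merge_rel (R B) (x c) (y c)"
      using flip_merge[OF B c(1) False] by (simp add: flip_insert[OF B c])
    have yx: "(y c, x c) \<notin> R B" using False R_sym by blast
    have sep: "separated ?B V \<longleftrightarrow> separated B V \<and> \<not> (hit B V (x c) \<and> hit B V (y c))"
    proof -
      have "separated ?B V \<longleftrightarrow> separated B V \<and> (\<forall>a\<in>V. \<forall>b\<in>V. (a, x c) \<in> R B \<and> (b, y c) \<in> R B \<longrightarrow> a = b)"
        unfolding separated_def J merge_rel_def by blast
      moreover have "a \<noteq> b" if "(a, x c) \<in> R B" "(b, y c) \<in> R B" for a b
        using that False R_sym R_trans by blast
      ultimately show ?thesis unfolding hit_def using R_sym by blast
    qed
    have "(x c, v) \<in> R ?B \<longleftrightarrow> (x c, v) \<in> R B \<or> (y c, v) \<in> R B" for v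
      unfolding J merge_rel_def
      using R_refl[OF xA] False R_sym[of v "y c" B] R_sym[of "y c" v B] by auto
    then have hx: "hit ?B V (x c) \<longleftrightarrow> hit B V (x c) \<or> hit B V (y c)"
      unfolding hit_def by blast
    have far: "(a, x c) \<notin> R ?B \<longleftrightarrow> (a, x c) \<notin> R B \<and> (a, y c) \<notin> R B" if "a \<in> A" for a
      unfolding J merge_rel_def using R_refl[OF xA] R_refl[OF yA] by auto
    have hfar: "hit ?B V a \<longleftrightarrow> hit B V a" if "(a, x c) \<notin> R B" "(a, y c) \<notin> R B" for a
      unfolding hit_def J merge_rel_def using that by auto
    have mem: "(?B, missed ?B V) \<in> state_targets D (B, P) c \<longleftrightarrow>
      (\<forall>a\<in>A. (a, x c) \<notin> R B \<longrightarrow> (a, y c) \<notin> R B \<longrightarrow> (circle B a \<in> P \<longleftrightarrow> \<not> hit B V a)) \<and>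
      (circle B (x c) \<notin> P \<and> circle B (y c) \<notin> P \<and> (hit B V (x c) \<or> hit B V (y c)) \<or>
       (circle B (x c) \<in> P) \<noteq> (circle B (y c) \<in> P) \<and> \<not> (hit B V (x c) \<or> hit B V (y c)))"
      unfolding merge_targets[OF B c False P]
      using missed_subset xA by (simp add: circle_missed_iff hx far hfar) (auto simp: hfar)
    have comm: "(\<forall>d\<in>A. (d, y c) \<notin> R B \<longrightarrow> (d, x c) \<notin> R B \<longrightarrow> Z d) \<longleftrightarrow>
      (\<forall>d\<in>A. (d, x c) \<notin> R B \<longrightarrow> (d, y c) \<notin> R B \<longrightarrow> Z d)" for Z by blast
    show ?thesis
      unfolding transfer_def if_not_P[OF False] weight_insert_iff[OF P xA yA False]
        weight_insert_iff[OF P yA xA yx] comm of_bool_insert_cases sep mem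
      by (simp only: conj_ac)
  next
    case True
    have xy: "(x c, y c) \<notin> R ?B" using dichotomy[OF B c(1)] True by (simp add: flip_insert[OF B c])
    have J: "R B = merge_rel (R ?B) (x c) (y c)"
      using flip_merge[OF flip_subset[OF c(1) B] c(1)] xy by (metis flip_flip flip_insert[OF B c])
    have sep: "separated B V \<longleftrightarrow> separated ?B V \<and> \<not> (hit ?B V (x c) \<and> hit ?B V (y c))"
    proof -
      have "separated B V \<longleftrightarrow> separated ?B V \<and> (\<forall>a\<in>V. \<forall>b\<in>V. (a, x c) \<in> R ?B \<and> (b, y c) \<in> R ?B \<longrightarrow> a = b)"
        unfolding separated_def J merge_rel_def by blast
      moreover have "a \<noteq> b" if "(a, x c) \<in> R ?B" "(b, y c) \<in> R ?B" for a b
        using that xy R_sym R_trans by blast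
      ultimately show ?thesis unfolding hit_def using R_sym by blast
    qed
    have "(x c, v) \<in> R B \<longleftrightarrow> (x c, v) \<in> R ?B \<or> (y c, v) \<in> R ?B" for v
      unfolding J merge_rel_def
      using R_refl[OF xA] xy R_sym[of v "y c" ?B] R_sym[of "y c" v ?B] by auto
    then have hx: "hit B V (x c) \<longleftrightarrow> hit ?B V (x c) \<or> hit ?B V (y c)"
      unfolding hit_def by blast
    have hfar: "hit B V a \<longleftrightarrow> hit ?B V a" if "(a, x c) \<notin> R B" for a
      using that R_refl[OF xA] R_refl[OF yA] unfolding hit_def J merge_rel_def by auto
    have xP: "circle B a \<in> P \<longleftrightarrow> circle B (x c) \<in> P" if "(a, x c) \<in> R B" for a
      using that circle_eq_iff R_in by metis
    have "P = missed B V \<longleftrightarrow>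
      (\<forall>a\<in>A. (a, x c) \<notin> R B \<longrightarrow> (circle B a \<in> P \<longleftrightarrow> \<not> hit ?B V a)) \<and>
      (circle B (x c) \<in> P \<longleftrightarrow> \<not> hit B V (x c))"
      unfolding eq_missed_iff[OF P] using xP hfar hit_cong xA by (metis (no_types, lifting))
    moreover have "(?B, missed ?B V) \<in> state_targets D (B, P) c \<longleftrightarrow>
      (\<forall>a\<in>A. (a, x c) \<notin> R B \<longrightarrow> (circle B a \<in> P \<longleftrightarrow> \<not> hit ?B V a)) \<and>
      (circle B (x c) \<in> P \<and> \<not> hit ?B V (x c) \<and> \<not> hit ?B V (y c) \<or>
       circle B (x c) \<notin> P \<and> hit ?B V (x c) \<noteq> hit ?B V (y c))"
      unfolding split_targets[OF B c True P]
      using missed_subset xA yA by (simp add: circle_missed_iff) blast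
    ultimately show ?thesis
      using True by (auto simp: transfer_def weight_def sep hx)
  qed
  finally show ?thesis .
qed

text \<open>Both orders change the number of circles by the same total. So either both crossings
  keep their type, and the operators commute as derivatives do, or both change type at once. In that
  case the arcs at b and at c lie on the same circles of \<open>B\<close> and give equal
  derivatives.\<close>

lemma transfer_commute:
  assumes B: "B \<subseteq> E" and b: "b \<in> E" "b \<notin> B" and c: "c \<in> E" "c \<notin> B" and bc: "b \<noteq> c"
    and P: "P \<subseteq> circles D B"
  shows "transfer (insert b B) c (transfer B b (weight (B, P))) V =
    transfer (insert c B) b (transfer B c (weight (B, P))) V"
proof -
  let ?\<phi> = "weight (B, P)"
  have sub: "insert b B \<subseteq> E" "insert c B \<subseteq> E" using B b c by auto
  have mem: "c \<notin> insert b B" "b \<notin> insert c B" using b c bc by auto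
  have J: "R (insert d B') = merge_rel (R B') (x d) (y d)"
    if "(x d, y d) \<notin> R B'" "B' \<subseteq> E" "d \<in> E" "d \<notin> B'" for d B'
    using flip_merge[OF that(2,3,1)] flip_insert[OF that(2-4)] by simp
  have J': "R B' = merge_rel (R (insert d B')) (x d) (y d)"
    if "(x d, y d) \<in> R B'" "B' \<subseteq> E" "d \<in> E" "d \<notin> B'" for d B'
    using flip_merge[OF flip_subset[OF that(3,2)] that(3)] dichotomy[OF that(2,3)] that(1)
      flip_insert[OF that(2-4)] by (metis flip_flip)
  have count: "int (card (circles D (insert d B'))) - int (card (circles D B')) =
    (if (x d, y d) \<in> R B' then 1 else - 1)" if "B' \<subseteq> E" "d \<in> E" "d \<notin> B'" for d B'
    using card_circles_flip[OF that(1,2)] flip_insert[OF that] by auto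
  have ins: "insert c (insert b B) = insert b (insert c B)" by auto
  have sum: "(if (x b, y b) \<in> R B then 1 else - 1) + (if (x c, y c) \<in> R (insert b B) then 1 else - 1) =
      (if (x c, y c) \<in> R B then 1 else - 1) + (if (x b, y b) \<in> R (insert c B) then 1 else - (1::int))"
    using count[OF B b] count[OF sub(1) c(1) mem(1)] count[OF B c] count[OF sub(2) b(1) mem(2)]
    unfolding ins by linarith
  consider (same) "(x b, y b) \<in> R B \<longleftrightarrow> (x b, y b) \<in> R (insert c B)"
      "(x c, y c) \<in> R B \<longleftrightarrow> (x c, y c) \<in> R (insert b B)"
    | (merge) "(x b, y b) \<notin> R B" "(x c, y c) \<notin> R B"
      "(x b, y b) \<in> R (insert c B)" "(x c, y c) \<in> R (insert b B)"
    | (split) "(x b, y b) \<in> R B" "(x c, y c) \<in> R B"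
      "(x b, y b) \<notin> R (insert c B)" "(x c, y c) \<notin> R (insert b B)"
    using sum by (auto split: if_splits)
  then show ?thesis
  proof cases
    case same
    then show ?thesis
      unfolding transfer_def shift_def by (simp add: insert_commute)
  next
    case merge
    have "(x c, y c) \<in> merge_rel (R B) (x b) (y b)"
      using merge(4) J[OF merge(1) B b] by simp
    then consider "(x c, x b) \<in> R B" "(y c, y b) \<in> R B" | "(x c, y b) \<in> R B" "(y c, x b) \<in> R B"
      using merge(2) by (auto simp: merge_rel_def)
    then have "transfer B b ?\<phi> V = transfer B c ?\<phi> V" for V
    proof cases
      case 1
      then show ?thesis
        unfolding transfer_def using merge weight_insert_cong[OF P 1(1), of V] weight_insert_cong[OF P 1(2), of V]
        by simp
    next
      case 2
      then show ?thesis
        unfolding transfer_def using merge weight_insert_cong[OF P 2(1), of V] weight_insert_cong[OF P 2(2), of V]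
        by simp
    qed
    then show ?thesis
      unfolding transfer_def[of "insert b B"] transfer_def[of "insert c B"] using merge by simp
  next
    case split
    have "(x c, y c) \<in> merge_rel (R (insert b B)) (x b) (y b)"
      using split(2) J'[OF split(1) B b] by simp
    then have "(x c, x b) \<in> R (insert b B) \<or> (x c, y b) \<in> R (insert b B)"
      using split(4) by (auto simp: merge_rel_def)
    moreover have "R (insert b B) \<subseteq> R B"
      using J'[OF split(1) B b] subset_merge by metis
    ultimately have xx: "(x c, x b) \<in> R B"
      using R_trans[OF _ R_sym[OF split(1)]] by blast
    then have xy: "(y c, y b) \<in> R B"
      using R_trans[OF R_trans[OF R_sym[OF split(2)] xx] split(1)] by blast
    show ?thesis
      unfolding transfer_def using split
        weight_insert_cong[OF P xx, of V] weight_insert_cong[OF P xy, of V] by simp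
  qed
qed

section \<open>The square of the Khovanov differential vanishes\<close>

definition two_steps where
  "two_steps s b c = (\<Sum>t\<in>state_targets D s b. \<Sum>r\<in>state_targets D t c. frag_of r)"

text \<open>The coefficient at z of a double step is the doubly transferred weight, evaluated at a
  \<open>V\<close> that detects z. This \<open>V\<close> is chosen from z alone, hence is the same
  for both orders, and \<open>transfer_commute\<close> applies.\<close>

lemma two_steps_commute:
  assumes s: "s \<in> enhanced_states D" and bc: "b \<in> E - fst s" "c \<in> E - fst s" "b \<noteq> c"
  shows "two_steps s b c = two_steps s c b"
proof -
  obtain B P where BP: "s = (B, P)" "B \<subseteq> E" "P \<subseteq> circles D B"
    using s by (auto simp: enhanced_states_def)
  have weights: "(\<Sum>t\<in>state_targets D s b. \<Sum>r\<in>state_targets D t c. weight r V) =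
      transfer (insert b B) c (transfer B b (weight (B, P))) V"
    if bc: "b \<in> E - fst s" "c \<in> E - fst s" "b \<noteq> c" for b c V
  proof -
    have "(\<Sum>r\<in>state_targets D t c. weight r V) = transfer (insert b B) c (weight t) V"
      if t: "t \<in> state_targets D s b" for t
    proof -
      have "fst t = insert b B" using target_fst[OF t] BP(1) by simp
      moreover have "t \<in> enhanced_states D" using target_enhanced[OF s _ t] bc by simp
      ultimately show ?thesis
        using weight_targets[of "insert b B" c "snd t" V] bc BP
        by (cases t) (auto simp: enhanced_states_def)
    qed
    then have "(\<Sum>t\<in>state_targets D s b. \<Sum>r\<in>state_targets D t c. weight r V) =
        (\<Sum>t\<in>state_targets D s b. transfer (insert b B) c (weight t) V)"
      by (rule sum.cong[OF refl])
    also have "\<dots> = transfer (insert b B) c (\<lambda>V. \<Sum>t\<in>state_targets D s b. weight t V) V"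
      unfolding transfer_def shift_def by (simp add: sum.distrib)
    also have "(\<lambda>V. \<Sum>t\<in>state_targets D s b. weight t V) = transfer B b (weight (B, P))"
      using weight_targets[of B b P] BP bc by (simp add: fun_eq_iff)
    finally show ?thesis .
  qed
  have lookup: "Poly_Mapping.lookup (two_steps s b c) z =
      int (\<Sum>t\<in>state_targets D s b. \<Sum>r\<in>state_targets D t c. of_bool (r = z))" for b c z
    unfolding two_steps_def lookup_frag_sum of_nat_sum
    by (intro sum.cong refl) (auto simp: lookup_single when_def)
  have count: "(\<Sum>t\<in>state_targets D s b. \<Sum>r\<in>state_targets D t c. of_bool (r = z)) =
      (if fst z = insert b (insert c B) \<and> snd z \<subseteq> circles D (fst z) then
        transfer (insert b B) c (transfer B b (weight (B, P))) (SOME V. weight z V = 1) else 0)"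
    if bc: "b \<in> E - fst s" "c \<in> E - fst s" "b \<noteq> c" for b c z
  proof -
    have r: "fst r = insert b (insert c B) \<and> snd r \<subseteq> circles D (fst r)"
      if "t \<in> state_targets D s b" "r \<in> state_targets D t c" for t r
    proof -
      have "r \<in> enhanced_states D"
        using target_enhanced[OF target_enhanced[OF s _ that(1)] _ that(2)] bc by simp
      then show ?thesis
        using target_fst[OF that(1)] target_fst[OF that(2)] BP(1)
        by (auto simp: enhanced_states_def)
    qed
    show ?thesis
    proof (cases "fst z = insert b (insert c B) \<and> snd z \<subseteq> circles D (fst z)")
      case True
      define V where "V = (SOME V. weight z V = 1)"
      have "weight z V = 1"
        unfolding V_def by (rule someI_ex) (use True weight_exists in \<open>metis prod.collapse\<close>)
      then have "of_bool (r = z) = weight r V"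
        if "t \<in> state_targets D s b" "r \<in> state_targets D t c" for t r
      proof -
        have "separated (fst z) V" "snd z = missed (fst z) V"
          using \<open>weight z V = 1\<close> by (simp_all add: weight_def case_prod_beta del: One_nat_def)
        moreover have "fst r = fst z" using r[OF that] True by simp
        ultimately show ?thesis by (auto simp: weight_def case_prod_beta prod_eq_iff)
      qed
      then have "(\<Sum>t\<in>state_targets D s b. \<Sum>r\<in>state_targets D t c. of_bool (r = z)) =
          (\<Sum>t\<in>state_targets D s b. \<Sum>r\<in>state_targets D t c. weight r V)"
        by (intro sum.cong refl)
      then show ?thesis
        by (simp only: if_P[OF True] V_def[symmetric] weights[OF bc])
    next
      case False
      then have "r \<noteq> z" if "t \<in> state_targets D s b" "r \<in> state_targets D t c" for t r
        using r[OF that] by blast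
      then show ?thesis using False by (auto intro!: sum.neutral)
    qed
  qed
  show ?thesis
  proof (rule poly_mapping_eqI)
    fix z
    have "transfer (insert b B) c (transfer B b (weight (B, P))) V =
      transfer (insert c B) b (transfer B c (weight (B, P))) V" for V
      using transfer_commute[of B b c P V] BP bc by simp
    then show "Poly_Mapping.lookup (two_steps s b c) z = Poly_Mapping.lookup (two_steps s c b) z"
      by (simp only: lookup count[OF bc] count[OF bc(2,1) bc(3)[symmetric]] insert_commute[of c b B])
  qed
qed

definition edge_sign :: "'c set \<Rightarrow> 'c \<Rightarrow> int"
  where "edge_sign B c = (- 1) ^ card {b \<in> B. b < c}"

definition \<delta> where "\<delta> s = (\<Sum>c \<in> E - fst s. frag_cmul (edge_sign (fst s) c) (\<Sum>t \<in> state_targets D s c. frag_of t))"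

lemma khovanov_d_eq: "khovanov_d D = frag_extend \<delta>"
  by (simp add: khovanov_d_def \<delta>_def[abs_def] edge_sign_def)

text \<open>Of two distinct crossings exactly one lies below the other, so exactly one of the two
  signs is affected by the insertion.\<close>

lemma edge_sign_insert:
  assumes "finite B" "b \<notin> B" "c \<notin> B" "b \<noteq> c"
  shows "edge_sign B b * edge_sign (insert b B) c = - (edge_sign B c * edge_sign (insert c B) b)"
proof -
  have *: "edge_sign (insert b B) c = (if b < c then - edge_sign B c else edge_sign B c)"
    if "b \<notin> B" "finite B" for b c
  proof (cases "b < c")
    case True
    then have "{a \<in> insert b B. a < c} = insert b {a \<in> B. a < c}" by auto
    then show ?thesis using True that assms by (simp add: edge_sign_def)
  next
    case False
    then have "{a \<in> insert b B. a < c} = {a \<in> B. a < c}" by auto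
    then show ?thesis using False by (simp add: edge_sign_def)
  qed
  show ?thesis using assms(4) by (auto simp: *[OF assms(2,1)] *[OF assms(3,1)])
qed

text \<open>Exchanging the two crossings of a double step reverses the sign of the whole sum, and
  the free abelian group has no 2-torsion.\<close>

lemma \<delta>_\<delta>:
  assumes s: "s \<in> enhanced_states D"
  shows "frag_extend \<delta> (\<delta> s) = 0"
proof -
  let ?F = "E - fst s"
  have B: "fst s \<subseteq> E" using s by (auto simp: enhanced_states_def)
  note finB = finite_subset[OF B finite_crossings]
  let ?S = "\<lambda>b c. frag_cmul (edge_sign (fst s) b * edge_sign (insert b (fst s)) c) (two_steps s b c)"
  have fin: "finite (state_targets D s b)" if "b \<in> ?F" for b
    using finite_targets[OF B that] .
  have "frag_extend \<delta> (\<delta> s) = (\<Sum>b\<in>?F. frag_cmul (edge_sign (fst s) b) (\<Sum>t\<in>state_targets D s b. \<delta> t))"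
    unfolding \<delta>_def[of s] using finite_crossings fin
    by (subst frag_extend_sum) (auto simp: o_def frag_extend_cmul frag_extend_sum intro!: sum.cong)
  also have "\<dots> = (\<Sum>b\<in>?F. \<Sum>c\<in>?F - {b}. ?S b c)"
  proof (intro sum.cong refl)
    fix b assume b: "b \<in> ?F"
    have "\<delta> t = (\<Sum>c\<in>?F - {b}. frag_cmul (edge_sign (insert b (fst s)) c) (\<Sum>r\<in>state_targets D t c. frag_of r))"
      if "t \<in> state_targets D s b" for t
    proof -
      have "E - fst t = ?F - {b}" using target_fst[OF that] by auto
      then show ?thesis using target_fst[OF that] by (simp add: \<delta>_def)
    qed
    then have "(\<Sum>t\<in>state_targets D s b. \<delta> t) =
        (\<Sum>c\<in>?F - {b}. frag_cmul (edge_sign (insert b (fst s)) c) (two_steps s b c))"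
      unfolding two_steps_def by (simp add: frag_cmul_sum sum.swap[of _ "state_targets D s b"])
    then show "frag_cmul (edge_sign (fst s) b) (\<Sum>t\<in>state_targets D s b. \<delta> t) = (\<Sum>c\<in>?F - {b}. ?S b c)"
      by (simp add: frag_cmul_sum)
  qed
  also have "\<dots> = (\<Sum>(b, c)\<in>{(b, c). b \<in> ?F \<and> c \<in> ?F \<and> b \<noteq> c}. ?S b c)" (is "_ = ?T")
    using finite_crossings
    by (subst sum.Sigma) (auto intro!: sum.cong)
  finally have T: "frag_extend \<delta> (\<delta> s) = ?T" .
  have anti: "?S b c = - ?S c b" if "b \<in> ?F" "c \<in> ?F" "b \<noteq> c" for b c
    using two_steps_commute[OF s that] edge_sign_insert[OF finB, of b c] that by simp
  have "?T = (\<Sum>(b, c)\<in>{(b, c). b \<in> ?F \<and> c \<in> ?F \<and> b \<noteq> c}. ?S c b)"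
    by (rule sum.reindex_bij_witness[of _ "\<lambda>(b, c). (c, b)" "\<lambda>(b, c). (c, b)"])
      (auto simp del: minus_frag_cmul)
  also have "\<dots> = (\<Sum>p\<in>{(b, c). b \<in> ?F \<and> c \<in> ?F \<and> b \<noteq> c}. - (case p of (b, c) \<Rightarrow> ?S b c))"
  proof (intro sum.cong refl)
    fix p assume "p \<in> {(b, c). b \<in> ?F \<and> c \<in> ?F \<and> b \<noteq> c}"
    then obtain b c where p: "p = (b, c)" "b \<in> ?F" "c \<in> ?F" "b \<noteq> c" by blast
    show "(case p of (b, c) \<Rightarrow> ?S c b) = - (case p of (b, c) \<Rightarrow> ?S b c)"
      unfolding p(1) prod.case using anti[OF p(3,2)] p(4) by (simp only: not_sym)
  qed
  also have "\<dots> = - ?T" by (rule sum_negf)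
  finally have neg: "frag_extend \<delta> (\<delta> s) = - frag_extend \<delta> (\<delta> s)" unfolding T .
  show ?thesis
  proof (rule poly_mapping_eqI)
    fix z
    have "Poly_Mapping.lookup (frag_extend \<delta> (\<delta> s)) z = - Poly_Mapping.lookup (frag_extend \<delta> (\<delta> s)) z"
      by (subst neg) (simp only: lookup_uminus)
    then show "Poly_Mapping.lookup (frag_extend \<delta> (\<delta> s)) z = Poly_Mapping.lookup 0 z" by simp
  qed
qed

lemma \<delta>_keys:
  "Poly_Mapping.keys (\<delta> s) \<subseteq> (\<Union>c\<in>E - fst s. state_targets D s c)"
  unfolding \<delta>_def
proof (rule keys_sum_subset)
  fix c assume c: "c \<in> E - fst s"
  have "Poly_Mapping.keys (\<Sum>t\<in>state_targets D s c. frag_of t) \<subseteq> (\<Union>c\<in>E - fst s. state_targets D s c)"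
    by (rule keys_sum_subset) (use c in auto)
  then show "Poly_Mapping.keys (frag_cmul (edge_sign (fst s) c) (\<Sum>t\<in>state_targets D s c. frag_of t))
      \<subseteq> (\<Union>c\<in>E - fst s. state_targets D s c)"
    using keys_cmul by blast
qed

text \<open>The crossing is recovered from the target as the new element of its smoothing, so
  different crossings cannot contribute to the same coefficient.\<close>

lemma lookup_\<delta>:
  assumes s: "s \<in> enhanced_states D" and c: "c \<in> E - fst s" and t: "t \<in> state_targets D s c"
  shows "Poly_Mapping.lookup (\<delta> s) t = edge_sign (fst s) c"
proof -
  have B: "fst s \<subseteq> E" using s by (auto simp: enhanced_states_def)
  have "Poly_Mapping.lookup (\<Sum>r\<in>state_targets D s b. frag_of r) t = (if b = c then 1 else 0)"
    if b: "b \<in> E - fst s" for b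
  proof -
    have "Poly_Mapping.lookup (\<Sum>r\<in>state_targets D s b. frag_of r) t =
        (\<Sum>r\<in>state_targets D s b. if r = t then 1 else 0)"
      unfolding lookup_frag_sum by (intro sum.cong refl) (auto simp: lookup_single when_def)
    moreover have "t \<in> state_targets D s b \<longleftrightarrow> b = c"
      using target_fst[of t s b] target_fst[OF t] t c b by auto
    ultimately show ?thesis using finite_targets[OF B b] by simp
  qed
  then have "Poly_Mapping.lookup (\<delta> s) t = (\<Sum>b\<in>E - fst s. if b = c then edge_sign (fst s) b else 0)"
    unfolding \<delta>_def lookup_frag_sum lookup_frag_cmul by (intro sum.cong refl) simp
  then show ?thesis using c finite_crossings by (simp add: sum.delta')
qed

lemma differential_khovanov: "differential (khovanov_group D) (1, 0) (khovanov_d D)"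
proof -
  have keys: "Poly_Mapping.keys (\<delta> s) \<subseteq>
      {t \<in> enhanced_states D. state_i D t = state_i D s + 1 \<and> state_j D t = state_j D s}"
    if s: "s \<in> enhanced_states D" for s
    using \<delta>_keys[of s] target_enhanced[OF s] state_i_target[OF s] state_j_target[OF s] by blast
  have "frag_extend \<delta> \<in> graded_hom (khovanov_group D) (khovanov_group D) (\<lambda>p q. q = p + (1, 0))"
  proof (rule graded_homI)
    fix w :: "('c, 'a) enhanced_state \<Rightarrow>\<^sub>0 int"
    assume "Poly_Mapping.keys w \<subseteq> gens (khovanov_group D)"
    then have "Poly_Mapping.keys (\<delta> s) \<subseteq> enhanced_states D" if "s \<in> Poly_Mapping.keys w" for s
      using keys[of s] that by (auto simp: khovanov_group_def)
    then show "Poly_Mapping.keys (frag_extend \<delta> w) \<subseteq> gens (khovanov_group D)"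
      by (intro keys_frag_extend_subset) (simp add: khovanov_group_def)
  next
    fix p t and w :: "('c, 'a) enhanced_state \<Rightarrow>\<^sub>0 int"
    assume w: "Poly_Mapping.keys w \<subseteq> {k \<in> gens (khovanov_group D). bideg (khovanov_group D) k = p}"
      and "t \<in> Poly_Mapping.keys (frag_extend \<delta> w)"
    then obtain s where "s \<in> Poly_Mapping.keys w" "t \<in> Poly_Mapping.keys (\<delta> s)"
      by (elim keys_frag_extendE)
    then show "bideg (khovanov_group D) t = p + (1, 0)"
      using w keys[of s] by (cases p) (auto simp: khovanov_group_def)
  qed (rule frag_extend_diff)
  moreover have "frag_extend \<delta> (frag_extend \<delta> w) = 0" if "Poly_Mapping.keys w \<subseteq> enhanced_states D" for w :: "('c, 'a) enhanced_state \<Rightarrow>\<^sub>0 int"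
    using that
  proof (induction w rule: frag_induction)
    case (one s)
    then show ?case using \<delta>_\<delta> by simp
  qed (simp_all add: frag_extend_diff)
  ultimately show ?thesis
    by (simp add: khovanov_d_eq differential_def total_group_def khovanov_group_def)
qed

end

section \<open>States with a single circle\<close>

definition sd :: "'c set \<Rightarrow> 'c set \<Rightarrow> 'c set"
  where "sd T S = (T - S) \<union> (S - T)"

lemma sd_sd [simp]: "sd T (sd T S) = S"
  by (auto simp: sd_def)

lemma sd_commute: "sd T S = sd S T"
  by (auto simp: sd_def)

lemma sd_insert: "c \<notin> S \<Longrightarrow> sd T (insert c S) = flip c (sd T S)"
  by (auto simp: sd_def flip_def)

lemma sd_remove: "c \<in> S \<Longrightarrow> sd (flip c T) (S - {c}) = sd T S"
  by (auto simp: sd_def flip_def)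

lemma sd_subset: "T \<subseteq> E \<Longrightarrow> S \<subseteq> E \<Longrightarrow> sd T S \<subseteq> E"
  by (auto simp: sd_def)

lemma sd_empty [simp]: "sd T {} = T"
  by (auto simp: sd_def)

lemma sd_eq_empty_iff: "sd T S = {} \<longleftrightarrow> T = S"
  by (auto simp: sd_def)

lemma sd_flip: "c \<in> sd (flip d T) B \<longleftrightarrow> (if c = d then c \<notin> sd T B else c \<in> sd T B)"
  by (auto simp: sd_def flip_def)

lemma in_sd_iff: "c \<in> sd T S \<longleftrightarrow> (c \<in> T) \<noteq> (c \<in> S)"
  by (auto simp: sd_def)

section \<open>Sets of crossings compared at their highest difference\<close>

lemma sum_two_power_less: "(\<Sum>i<n. 2 ^ i) < (2 ^ n :: nat)"
  by (induction n) auto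

text \<open>The number with binary digits indexed by \<open>E\<close> in increasing order; comparing
  such numbers means comparing sets at the highest element where they differ.\<close>

definition binary_value :: "'c::linorder set \<Rightarrow> 'c set \<Rightarrow> nat"
  where "binary_value E U = (\<Sum>e\<in>U. 2 ^ card {f \<in> E. f < e})"

text \<open>Above \<open>e\<close> the set \<open>V\<close> has no digit that \<open>U\<close>
  lacks, and all digits below \<open>e\<close> together are worth less than the digit at
  \<open>e\<close>.\<close>

lemma binary_value_less:
  assumes E: "finite E" and UV: "U \<subseteq> E" "V \<subseteq> E" and e: "e \<in> U" "e \<notin> V"
    and above: "\<And>f. e < f \<Longrightarrow> f \<in> V \<Longrightarrow> f \<in> U"
  shows "binary_value E V < binary_value E U"
proof -
  let ?k = "\<lambda>e. card {f \<in> E. f < e}"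
  note fin = finite_subset[OF UV(1) E] finite_subset[OF UV(2) E]
  have k_less: "?k f < ?k g" if "f < g" "f \<in> E" for f g
    using that E by (intro psubset_card_mono) auto
  have inj: "inj_on ?k (V \<inter> {..<e})"
  proof (rule inj_onI)
    fix f g assume "f \<in> V \<inter> {..<e}" "g \<in> V \<inter> {..<e}" and eq: "?k f = ?k g"
    then have fg: "f \<in> E" "g \<in> E" using UV(2) by auto
    have "\<not> f < g" "\<not> g < f"
      using k_less[OF _ fg(1), of g] k_less[OF _ fg(2), of f] unfolding eq by blast+
    then show "f = g" using linorder_less_linear[of f g] by blast
  qed
  have "(\<Sum>f\<in>V \<inter> {..<e}. 2 ^ ?k f) = (\<Sum>i\<in>?k ` (V \<inter> {..<e}). 2 ^ i :: nat)"
    using inj by (simp add: sum.reindex)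
  also have "\<dots> \<le> (\<Sum>i<?k e. 2 ^ i)"
    using k_less UV(2) by (intro sum_mono2) auto
  also have "\<dots> < 2 ^ ?k e" by (rule sum_two_power_less)
  finally have below: "(\<Sum>f\<in>V \<inter> {..<e}. 2 ^ ?k f) < (2 ^ ?k e :: nat)" .
  have "binary_value E V = (\<Sum>f\<in>V \<inter> {..<e}. 2 ^ ?k f) + (\<Sum>f\<in>V - {..<e}. 2 ^ ?k f)"
    unfolding binary_value_def using fin(2) by (subst sum.Int_Diff[of _ _ "{..<e}"]) auto
  also have "\<dots> < 2 ^ ?k e + (\<Sum>f\<in>V - {..<e}. 2 ^ ?k f)" using below by simp
  also have "\<dots> = (\<Sum>f\<in>insert e (V - {..<e}). 2 ^ ?k f)"
    using e(2) fin(2) by simp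
  also have "\<dots> \<le> binary_value E U"
    unfolding binary_value_def using e above fin(1)
    by (intro sum_mono2) (auto simp: not_less order_le_less)
  finally show ?thesis .
qed

context smoothing_cube
begin

section \<open>Trees, live edges and the circles that they split off\<close>

definition root :: 'a
  where "root = (SOME a. a \<in> A)"

lemma root_arc: "root \<in> A"
  unfolding root_def using arcs_nonempty by (simp add: some_in_eq)

text \<open>A smoothing with a single circle. Its spanning tree in the Tait graph is not
  \<open>T\<close> itself but the symmetric difference of \<open>T\<close> with the positive
  edges.\<close>

definition tree :: "'c set \<Rightarrow> bool"
  where "tree T \<longleftrightarrow> T \<subseteq> E \<and> R T = A \<times> A"

text \<open>Activity in terms of exchanges; \<open>live_iff\<close> shows that internal and external
  activity of a spanning tree both have this form.\<close>

definition lives :: "'c set \<Rightarrow> 'c set"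
  where "lives T = {e \<in> E. \<forall>f\<in>E. f < e \<longrightarrow> \<not> tree (flip f (flip e T))}"

text \<open>The change at \<open>e\<close> cuts the single circle of \<open>T\<close> into two; this
  is the one that avoids the root.\<close>

definition far :: "'c set \<Rightarrow> 'c \<Rightarrow> 'a set"
  where "far T e = {a \<in> A. (a, root) \<notin> R (flip e T)}"

definition saturated :: "'a set \<Rightarrow> 'c set \<Rightarrow> bool"
  where "saturated Y B \<longleftrightarrow> (\<forall>(a, b) \<in> R B. a \<in> Y \<longleftrightarrow> b \<in> Y)"

lemma lives_subset: "lives T \<subseteq> E"
  by (auto simp: lives_def)

lemma saturatedD: "saturated Y B \<Longrightarrow> (a, b) \<in> R B \<Longrightarrow> a \<in> Y \<longleftrightarrow> b \<in> Y"
  by (auto simp: saturated_def)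

lemma flip_unmerge:
  assumes "B \<subseteq> E" "c \<in> E" "(x c, y c) \<in> R B"
  shows "(x c, y c) \<notin> R (flip c B)" "R B = merge_rel (R (flip c B)) (x c) (y c)"
    "R (flip c B) \<subseteq> R B"
proof -
  show *: "(x c, y c) \<notin> R (flip c B)" using dichotomy[OF assms(1,2)] assms(3) by blast
  show "R B = merge_rel (R (flip c B)) (x c) (y c)"
    using flip_merge[OF flip_subset[OF assms(2,1)] assms(2) *] by simp
  then show "R (flip c B) \<subseteq> R B" using subset_merge by metis
qed

text \<open>A split only refines the circles, and a merge at arcs on the same side of
  \<open>Y\<close> joins circles on that side.\<close>

lemma saturated_flip:
  assumes B: "B \<subseteq> E" "c \<in> E" and Y: "saturated Y B" "x c \<in> Y \<longleftrightarrow> y c \<in> Y"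
  shows "saturated Y (flip c B)"
proof (cases "(x c, y c) \<in> R B")
  case True
  then show ?thesis using flip_unmerge(3)[OF B True] Y(1) by (auto simp: saturated_def)
next
  case False
  have "a \<in> Y \<longleftrightarrow> b \<in> Y" if "(a, b) \<in> merge_rel (R B) (x c) (y c)" for a b
    using that Y(2) saturatedD[OF Y(1)] unfolding merge_rel_def by blast
  then show ?thesis unfolding flip_merge[OF B False] saturated_def by blast
qed

lemma saturated_sd:
  assumes "S \<subseteq> E" "B \<subseteq> E" "saturated Y B" "\<And>c. c \<in> S \<Longrightarrow> x c \<in> Y \<longleftrightarrow> y c \<in> Y"
  shows "saturated Y (sd B S)"
proof -
  have "finite S" using assms(1) finite_crossings finite_subset by blast
  then show ?thesis
    using assms
  proof (induction S)
    case (insert c S)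
    then show ?case
      using saturated_flip[of "sd B S" c Y] by (simp add: sd_insert sd_subset)
  qed simp
qed

text \<open>Labels for the circles of \<open>sd T S\<close>: \<open>None\<close> for the circle
  through the root, \<open>Some e\<close> for the one that is split off at \<open>e\<close>.\<close>

definition indices :: "'c set \<Rightarrow> 'c option set"
  where "indices S = insert None (Some ` S)"

text \<open>Of the two arcs at \<open>e\<close>, the tip is the one on the far circle and the foot
  the one on the circle of the root.\<close>

definition tip :: "'c set \<Rightarrow> 'c \<Rightarrow> 'a"
  where "tip T e = (if x e \<in> far T e then x e else y e)"

definition foot :: "'c set \<Rightarrow> 'c \<Rightarrow> 'a"
  where "foot T e = (if x e \<in> far T e then y e else x e)"

definition anchor :: "'c set \<Rightarrow> 'c option \<Rightarrow> 'a"
  where "anchor T i = (case i of None \<Rightarrow> root | Some e \<Rightarrow> tip T e)"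

text \<open>Far circles shrink with the distance from the root, so complementary size measures
  depth; \<open>Suc\<close> keeps the root strictly above all others.\<close>

definition depth :: "'c set \<Rightarrow> 'c option \<Rightarrow> nat"
  where "depth T i = (case i of None \<Rightarrow> 0 | Some e \<Rightarrow> Suc (card A - card (far T e)))"

context
  fixes T assumes T: "tree T"
begin

lemma tree_subset: "T \<subseteq> E" and tree_full: "a \<in> A \<Longrightarrow> b \<in> A \<Longrightarrow> (a, b) \<in> R T"
  using T by (auto simp: tree_def)

lemma tree_flip:
  assumes e: "e \<in> E"
  shows "(x e, y e) \<notin> R (flip e T)" "R T = merge_rel (R (flip e T)) (x e) (y e)"
  using flip_unmerge[OF tree_subset e] tree_full x_arc y_arc e by auto

lemma saturated_far: "saturated (far T e) (flip e T)"
  unfolding saturated_def far_def using R_trans R_sym R_in by blast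

lemma root_not_far: "root \<notin> far T e"
  by (simp add: far_def R_refl root_arc)

lemma far_subset: "far T e \<subseteq> A"
  by (auto simp: far_def)

lemma far_xor:
  assumes e: "e \<in> E"
  shows "x e \<in> far T e \<longleftrightarrow> y e \<notin> far T e"
proof -
  note A = x_arc[OF e] y_arc[OF e]
  have "(x e, root) \<in> merge_rel (R (flip e T)) (x e) (y e)"
    using tree_flip[OF e] tree_full[OF A(1) root_arc] by simp
  then have "(x e, root) \<in> R (flip e T) \<or> (y e, root) \<in> R (flip e T)"
    using tree_flip(1)[OF e] R_sym by (auto simp: merge_rel_def)
  moreover have "\<not> ((x e, root) \<in> R (flip e T) \<and> (y e, root) \<in> R (flip e T))"
    using tree_flip(1)[OF e] R_trans[OF _ R_sym] by blast
  ultimately show ?thesis using A by (auto simp: far_def)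
qed

lemma far_related:
  assumes e: "e \<in> E" and ab: "a \<in> far T e" "b \<in> far T e"
  shows "(a, b) \<in> R (flip e T)"
proof -
  have A: "a \<in> A" "b \<in> A" using ab far_subset by auto
  have "(a, b) \<in> merge_rel (R (flip e T)) (x e) (y e)"
    using tree_flip[OF e] tree_full[OF A] by simp
  moreover have "\<not> ((a, x e) \<in> R (flip e T) \<and> (b, y e) \<in> R (flip e T))"
    "\<not> ((a, y e) \<in> R (flip e T) \<and> (b, x e) \<in> R (flip e T))"
    using saturatedD[OF saturated_far[of e]] ab far_xor[OF e] by blast+
  ultimately show ?thesis by (auto simp: merge_rel_def)
qed

lemma tip_far: "e \<in> E \<Longrightarrow> tip T e \<in> far T e" and foot_far: "e \<in> E \<Longrightarrow> foot T e \<notin> far T e"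
  using far_xor by (auto simp: tip_def foot_def)

lemma tip_arc: "e \<in> E \<Longrightarrow> tip T e \<in> A" and foot_arc: "e \<in> E \<Longrightarrow> foot T e \<in> A"
  using x_arc y_arc by (auto simp: tip_def foot_def)

lemma merge_tip_foot: "merge_rel Q (x e) (y e) = merge_rel Q (tip T e) (foot T e)"
  by (simp add: tip_def foot_def merge_commute)

lemma related_tip_foot: "(x e, y e) \<in> R B \<longleftrightarrow> (tip T e, foot T e) \<in> R B"
  using R_sym by (auto simp: tip_def foot_def)

text \<open>Viewed as chords of the single circle, e and f cross exactly if changing both gives a
  single circle again: an f with ends on both circles of \<open>flip e T\<close> merges
  them.\<close>

lemma noncrossing:
  assumes ef: "e \<in> E" "f \<in> E" and no: "\<not> tree (flip f (flip e T))"
  shows "x f \<in> far T e \<longleftrightarrow> y f \<in> far T e"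
proof (rule ccontr)
  assume cross: "\<not> ?thesis"
  let ?B = "flip e T"
  have B: "?B \<subseteq> E" using flip_subset[OF ef(1) tree_subset] .
  have "(x f, y f) \<notin> R ?B" using cross saturatedD[OF saturated_far[of e]] by blast
  then have J: "R (flip f ?B) = merge_rel (R ?B) (x f) (y f)"
    by (rule flip_merge[OF B ef(2)])
  have near: "(a, b) \<in> R ?B" if "a \<in> A" "b \<in> A" "a \<notin> far T e" "b \<notin> far T e" for a b
    using that R_trans[of a root ?B b] R_sym by (auto simp: far_def)
  obtain u v where uv: "u \<in> far T e" "v \<in> A" "v \<notin> far T e" "R (flip f ?B) = merge_rel (R ?B) u v"
    using cross J x_arc[OF ef(2)] y_arc[OF ef(2)] merge_commute[of "R ?B" "x f" "y f"] by metis
  have "(a, b) \<in> R (flip f ?B)" if ab: "a \<in> A" "b \<in> A" for a b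
    using near[OF ab] near[OF ab(1) uv(2)] near[OF ab(2) uv(2)] far_related[OF ef(1), of a b]
      far_related[OF ef(1) _ uv(1), of a] far_related[OF ef(1) _ uv(1), of b] uv(3)
    unfolding uv(4) merge_rel_def by blast
  then have "R (flip f ?B) = A \<times> A" using equiv_type[OF equiv_R] by blast
  then show False using no flip_subset[OF ef(2) B] by (simp add: tree_def)
qed

text \<open>The higher of the two edges is live, so the lower one cannot be exchanged with
  it.\<close>

lemma live_noncrossing:
  assumes "e \<in> lives T" "f \<in> lives T" "e \<noteq> f"
  shows "x f \<in> far T e \<longleftrightarrow> y f \<in> far T e"
proof (rule noncrossing)
  show "\<not> tree (flip f (flip e T))"
    using assms flip_commute[of f e T] unfolding lives_def
    by (cases e f rule: linorder_cases) auto
qed (use assms lives_subset in auto)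

text \<open>All other differences are at lower edges. If the highest one were live, none of them
  would cross it, and its far circle would stay separated from the rest along the way to
  \<open>T'\<close>, which has only one circle.\<close>

lemma highest_difference_dead:
  assumes T': "tree T'" and ne: "T \<noteq> T'"
  shows "Max (sd T T') \<notin> lives T"
proof
  let ?e = "Max (sd T T')"
  assume live: "?e \<in> lives T"
  have sub: "sd T T' \<subseteq> E" using tree_subset T' by (auto simp: sd_def tree_def)
  then have fin: "finite (sd T T')" using finite_crossings finite_subset by blast
  have "sd T T' \<noteq> {}" using ne by (simp add: sd_eq_empty_iff)
  then have e: "?e \<in> sd T T'" "?e \<in> E" using Max_in[OF fin] sub by auto
  have "saturated (far T ?e) (sd (flip ?e T) (sd T T' - {?e}))"
  proof (rule saturated_sd)
    fix f assume f: "f \<in> sd T T' - {?e}"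
    then have "f < ?e" using Max_ge[OF fin, of f] by (simp add: order.not_eq_order_implies_strict)
    then have "\<not> tree (flip f (flip ?e T))" using live f sub by (auto simp: lives_def)
    then show "x f \<in> far T ?e \<longleftrightarrow> y f \<in> far T ?e" using noncrossing[OF e(2)] f sub by auto
  qed (use sub flip_subset[OF e(2) tree_subset] saturated_far in auto)
  then have "saturated (far T ?e) T'" using sd_remove[OF e(1), of T] by simp
  moreover have "(tip T ?e, foot T ?e) \<in> R T'" using T' tip_arc foot_arc e(2) by (simp add: tree_def)
  ultimately show False using saturatedD tip_far[OF e(2)] foot_far[OF e(2)] by blast
qed

text \<open>Far circles of noncrossing edges are nested or disjoint. Here e is changed inside the
  far circle of f, which leaves the root circle of \<open>flip f T\<close> intact, so the far circle
  of e contains none of it. The inclusion is strict because the foot of e also lies in the far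
  circle of f.\<close>

lemma far_psubset:
  assumes ef: "e \<in> lives T" "f \<in> lives T" "e \<noteq> f" and tip: "tip T e \<in> far T f"
  shows "far T e \<subset> far T f"
proof -
  have E: "e \<in> E" "f \<in> E" using ef lives_subset by auto
  let ?B = "flip e (flip f T)"
  have sub: "flip f T \<subseteq> E" "flip e T \<subseteq> E" using flip_subset[OF _ tree_subset] E by blast+
  have xy: "x e \<in> far T f \<longleftrightarrow> y e \<in> far T f" "x f \<in> far T e \<longleftrightarrow> y f \<in> far T e"
    using live_noncrossing ef by auto
  then have in_f: "x e \<in> far T f" "y e \<in> far T f" using tip by (auto simp: tip_def split: if_splits)
  have sat: "saturated (far T f) ?B" "saturated (far T e) ?B"
    using saturated_flip[OF sub(1) E(1) saturated_far xy(1)]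
      saturated_flip[OF sub(2) E(2) saturated_far xy(2)] by (simp_all add: flip_commute)
  have J: "R (flip f T) = merge_rel (R ?B) (x e) (y e)"
    using flip_unmerge(2)[OF sub(1) E(1) far_related[OF E(2) in_f]] .
  have "a \<notin> far T e" if "a \<in> A" "a \<notin> far T f" for a
  proof -
    have "(a, root) \<in> merge_rel (R ?B) (x e) (y e)" using that J by (simp add: far_def)
    moreover have "(a, x e) \<notin> R ?B" "(a, y e) \<notin> R ?B"
      using saturatedD[OF sat(1)] that in_f by blast+
    ultimately have "(a, root) \<in> R ?B" by (auto simp: merge_rel_def)
    then show ?thesis using saturatedD[OF sat(2)] root_not_far by blast
  qed
  then have "far T e \<subseteq> far T f" using far_subset by blast
  moreover have "foot T e \<in> far T f" using in_f by (simp add: foot_def)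
  ultimately show ?thesis using foot_far[OF E(1)] by blast
qed

lemma anchor_arc: "S \<subseteq> lives T \<Longrightarrow> i \<in> indices S \<Longrightarrow> anchor T i \<in> A"
  using root_arc tip_arc lives_subset[of T] by (auto simp: anchor_def indices_def)

text \<open>No other live edge crosses e, so later changes may cut up the far circle of e but never
  reconnect it with the outside.\<close>

lemma saturated_far_sd:
  assumes S: "S \<subseteq> lives T" and e: "e \<in> S"
  shows "saturated (far T e) (sd T S)"
proof -
  have "saturated (far T e) (sd (flip e T) (S - {e}))"
  proof (rule saturated_sd)
    show "S - {e} \<subseteq> E" "flip e T \<subseteq> E"
      using S e lives_subset flip_subset[of e E T] tree_subset by blast+
  next
    fix c assume "c \<in> S - {e}"
    then show "x c \<in> far T e \<longleftrightarrow> y c \<in> far T e"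
      using live_noncrossing[of e c] S e by blast
  qed (rule saturated_far)
  then show ?thesis using sd_remove[OF e] by simp
qed

text \<open>A tip is separated from the root by its own far circle. Two tips are separated by a far
  circle containing just one of them, since strict nesting forbids each far circle to contain the
  tip of the other.\<close>

lemma anchors_distinct:
  assumes S: "S \<subseteq> lives T" and ij: "i \<in> indices S" "j \<in> indices S" "i \<noteq> j"
  shows "(anchor T i, anchor T j) \<notin> R (sd T S)"
proof -
  have E: "S \<subseteq> E" using S lives_subset by blast
  have tip_root: "(tip T e, root) \<notin> R (sd T S)" if "e \<in> S" for e
    using saturatedD[OF saturated_far_sd[OF S that]] tip_far[of e] root_not_far that E by blast
  have tips: "(tip T e, tip T f) \<notin> R (sd T S)" if ef: "e \<in> S" "f \<in> S" "e \<noteq> f" for e f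
  proof (cases "tip T e \<in> far T f")
    case True
    then have "far T e \<subset> far T f" using far_psubset ef S by blast
    then have "tip T f \<notin> far T e" using far_psubset[of f e] ef S by blast
    then show ?thesis
      using saturatedD[OF saturated_far_sd[OF S ef(1)]] tip_far[of e] ef E by blast
  next
    case False
    then show ?thesis
      using saturatedD[OF saturated_far_sd[OF S ef(2)]] tip_far[of f] ef E by blast
  qed
  have root_tip: "(root, tip T e) \<notin> R (sd T S)" if "e \<in> S" for e
    using tip_root[OF that] R_sym by blast
  consider e where "i = None" "j = Some e" "e \<in> S" | e where "i = Some e" "j = None" "e \<in> S"
    | e f where "i = Some e" "j = Some f" "e \<in> S" "f \<in> S" "e \<noteq> f"
    using ij by (auto simp: indices_def)
  then show ?thesis
    by cases (simp_all add: anchor_def tip_root root_tip tips)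
qed

lemma new_circle:
  assumes S: "S \<subseteq> lives T" and g: "g \<in> lives T" "g \<notin> S"
  shows "(tip T g, foot T g) \<notin> R (sd T (insert g S))"
    "R (sd T S) = merge_rel (R (sd T (insert g S))) (tip T g) (foot T g)"
proof -
  have gE: "g \<in> E" using g lives_subset by blast
  have "saturated (far T g) (sd T (insert g S))"
    by (rule saturated_far_sd) (use S g in auto)
  then show *: "(tip T g, foot T g) \<notin> R (sd T (insert g S))"
    using saturatedD tip_far[OF gE] foot_far[OF gE] by blast
  have "sd T (insert g S) \<subseteq> E"
    using sd_subset[OF tree_subset, of "insert g S"] S g lives_subset by blast
  then show "R (sd T S) = merge_rel (R (sd T (insert g S))) (tip T g) (foot T g)"
    using flip_merge[of "sd T (insert g S)" g] gE *
    by (simp add: related_tip_foot merge_tip_foot sd_insert[OF g(2)])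
qed

text \<open>The change at a further live edge splits one circle. The half that loses the old anchor
  is the one through the new tip.\<close>

lemma anchors_cover:
  assumes S: "S \<subseteq> lives T" and a: "a \<in> A"
  shows "\<exists>i\<in>indices S. (a, anchor T i) \<in> R (sd T S)"
proof -
  have "finite S" using S lives_subset finite_crossings by (meson finite_subset)
  then show ?thesis
    using S a
  proof (induction S arbitrary: a)
    case empty
    then show ?case using tree_full root_arc by (simp add: indices_def anchor_def)
  next
    case (insert g S)
    let ?B = "sd T (insert g S)"
    have S: "S \<subseteq> lives T" "g \<in> lives T" using insert by auto
    note new = new_circle[OF S insert(2)]
    obtain i where i: "i \<in> indices S" "(a, anchor T i) \<in> R (sd T S)" using insert S by blast
    have iI: "i \<in> indices (insert g S)" "Some g \<in> indices (insert g S)" "i \<noteq> Some g"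
      using i(1) insert(2) by (auto simp: indices_def)
    have "(tip T g, anchor T i) \<notin> R ?B"
      using anchors_distinct[OF insert(4) iI(2,1)] iI(3) by (simp add: anchor_def)
    then have "(a, anchor T i) \<in> R ?B \<or> (a, tip T g) \<in> R ?B"
      using i(2) R_sym unfolding new(2) merge_rel_def by blast
    then show ?case using iI by (force simp: anchor_def)
  qed
qed

text \<open>h labels the circle from which g splits off. Its anchor cannot remain with the tip, as
  anchors lie on distinct circles, so it remains with the foot.\<close>

lemma parent_anchor:
  assumes S: "S \<subseteq> lives T" and g: "g \<in> lives T" "g \<notin> S"
    and h: "h \<in> indices S" "(anchor T h, tip T g) \<in> R (sd T S)"
  shows "(anchor T h, foot T g) \<in> R (sd T (insert g S))"
proof -
  have "insert g S \<subseteq> lives T" "h \<in> indices (insert g S)" "Some g \<in> indices (insert g S)" "h \<noteq> Some g"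
    using S g h(1) by (auto simp: indices_def)
  then have "(anchor T h, tip T g) \<notin> R (sd T (insert g S))"
    using anchors_distinct[of "insert g S" h "Some g"] by (simp add: anchor_def)
  then show ?thesis using h(2) unfolding new_circle(2)[OF S g] merge_rel_def by auto
qed

text \<open>Unless h is the root, the tip of g lies in the far circle of the edge of h, so the far
  circle of g is strictly smaller.\<close>

lemma depth_parent:
  assumes S: "S \<subseteq> lives T" and g: "g \<in> lives T" "g \<notin> S"
    and h: "h \<in> indices S" "(anchor T h, tip T g) \<in> R (sd T S)"
  shows "depth T h < depth T (Some g)"
proof (cases h)
  case (Some e)
  then have e: "e \<in> S" "e \<in> lives T" using h(1) S by (auto simp: indices_def)
  then have "tip T g \<in> far T e"
    using saturatedD[OF saturated_far_sd[OF S e(1)]] h(2) tip_far[of e] lives_subset Some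
    by (auto simp: anchor_def)
  then have *: "far T g \<subset> far T e" using far_psubset[OF g(1) e(2)] e(1) g(2) by blast
  then have "card (far T g) < card (far T e)" "card (far T e) \<le> card A"
    using finite_arcs far_subset by (meson finite_subset psubset_card_mono card_mono)+
  then show ?thesis by (simp add: depth_def Some)
qed (simp add: depth_def)

end

section \<open>Every state lies in the interval of exactly one tree\<close>

lemma tree_exists: "\<exists>T. tree T"
proof -
  \<comment> \<open>In a state with the fewest circles no crossing meets two of them, since its
    change would merge them; connectedness then leaves a single circle.\<close>
  obtain B where B: "B \<subseteq> E" "\<And>B'. B' \<subseteq> E \<Longrightarrow> card (circles D B) \<le> card (circles D B')"
    using ex_has_least_nat[of "\<lambda>B. B \<subseteq> E" "{}" "\<lambda>B. card (circles D B)"] by auto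
  have "(x c, y c) \<in> R B" if c: "c \<in> E" for c
  proof (rule ccontr)
    assume "(x c, y c) \<notin> R B"
    then show False
      using card_circles_flip(1)[OF B(1) c] B(2)[OF flip_subset[OF c B(1)]] by simp
  qed
  then have "R B = A \<times> A" using connected[OF B(1) equiv_R] by blast
  then show ?thesis using B(1) by (auto simp: tree_def)
qed

text \<open>Choose the tree nearest to \<open>B\<close>, with high differences weighing most. A dead
  difference e could be exchanged with a lower f, which removes e and otherwise affects only the
  lower place f.\<close>

lemma interval_exists:
  assumes B: "B \<subseteq> E"
  shows "\<exists>T. tree T \<and> sd T B \<subseteq> lives T"
proof -
  obtain T0 where "tree T0" using tree_exists ..
  then obtain T where T: "tree T"
    and least: "\<And>T'. tree T' \<Longrightarrow> binary_value E (sd T B) \<le> binary_value E (sd T' B)"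
    using ex_has_least_nat[of tree T0 "\<lambda>T. binary_value E (sd T B)"] by auto
  have TE: "T \<subseteq> E" using T by (simp add: tree_def)
  have "e \<in> lives T" if e: "e \<in> sd T B" for e
  proof (rule ccontr)
    have eE: "e \<in> E" using e TE B by (auto simp: sd_def)
    assume "e \<notin> lives T"
    then obtain f where f: "f \<in> E" "f < e" "tree (flip f (flip e T))"
      using eE by (auto simp: lives_def)
    have "binary_value E (sd (flip f (flip e T)) B) < binary_value E (sd T B)"
    proof (rule binary_value_less[of _ _ _ e])
      show "sd T B \<subseteq> E" "sd (flip f (flip e T)) B \<subseteq> E"
        using sd_subset B TE f(3) by (auto simp: tree_def)
      show "e \<notin> sd (flip f (flip e T)) B" using e f(2) by (auto simp: sd_flip)
    next
      fix g assume "e < g" "g \<in> sd (flip f (flip e T)) B"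
      moreover have "g \<noteq> e" "g \<noteq> f" using \<open>e < g\<close> f(2) by auto
      ultimately show "g \<in> sd T B" by (simp add: sd_flip)
    qed (rule finite_crossings e)+
    then show False using least[OF f(3)] by simp
  qed
  then show ?thesis using T by blast
qed

lemma finite_sd: "tree T \<Longrightarrow> tree T' \<Longrightarrow> finite (sd T T')"
  using finite_crossings sd_subset[of T E T'] by (auto simp: tree_def intro: finite_subset)

text \<open>The highest difference of the two trees is dead in both, so neither is changed there on
  the way to \<open>B\<close>; then both agree with \<open>B\<close> at that edge, and hence with
  each other.\<close>

lemma interval_unique:
  assumes T: "tree T" "tree T'" and B: "sd T B \<subseteq> lives T" "sd T' B \<subseteq> lives T'"
  shows "T = T'"
proof (rule ccontr)
  assume ne: "T \<noteq> T'"
  let ?e = "Max (sd T T')"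
  have "?e \<notin> lives T" "?e \<notin> lives T'"
    using highest_difference_dead[OF T ne] highest_difference_dead[OF T(2,1)] ne
    by (simp_all add: sd_commute)
  then have "?e \<notin> sd T B" "?e \<notin> sd T' B" using B by auto
  moreover have "?e \<in> sd T T'"
    using Max_in[OF finite_sd[OF T]] ne by (simp add: sd_eq_empty_iff)
  ultimately show False by (simp add: in_sd_iff)
qed

text \<open>
  A change from an A- to a B-smoothing that leads to the interval of another tree happens at the
  highest edge where the two trees differ, because that edge is dead in both.
\<close>

lemma interval_step:
  assumes T: "tree T" "tree T'" "T \<noteq> T'" and S: "S \<subseteq> lives T" "S' \<subseteq> lives T'"
    and g: "g \<notin> sd T S" "sd T' S' = insert g (sd T S)"
  shows "binary_value E (E - T') < binary_value E (E - T)"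
proof -
  let ?e = "Max (sd T T')"
  have dead: "?e \<notin> lives T" "?e \<notin> lives T'"
    using highest_difference_dead[OF T] highest_difference_dead[OF T(2,1)] T(3)
    by (simp_all add: sd_commute)
  note fin = finite_sd[OF T(1,2)]
  have e: "?e \<in> sd T T'" using Max_in[OF fin] T(3) by (simp add: sd_eq_empty_iff)
  have "?e \<in> T \<longleftrightarrow> ?e \<in> sd T S" "?e \<in> T' \<longleftrightarrow> ?e \<in> insert g (sd T S)"
    using dead S unfolding g(2)[symmetric] in_sd_iff by blast+
  \<comment> \<open>At the dead edge each tree agrees with its state, and the step only adds to the
    set of B-smoothings.\<close>
  then have eT: "?e \<notin> T" "?e \<in> T'" using e unfolding in_sd_iff[of ?e T T'] by blast+
  show ?thesis
  proof (rule binary_value_less[of _ _ _ ?e])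
    fix f assume "?e < f" "f \<in> E - T'"
    then have "f \<notin> sd T T'" using Max_ge[OF fin, of f] by (meson leD)
    then show "f \<in> E - T" using \<open>f \<in> E - T'\<close> by (simp add: in_sd_iff)
  next
    show "?e \<in> E - T" "?e \<notin> E - T'" using eT T(2) by (auto simp: tree_def)
  qed (use finite_crossings in simp_all)
qed

end

section \<open>The matching on enhanced states\<close>

context smoothing_cube
begin

text \<open>
  The code \<open>(T, S, Z)\<close> describes the enhanced state in the interval of the tree \<open>T\<close> where the live
  edges in \<open>S\<close> are flipped; the circles correspond to the root and to the flipped edges, and those
  with index in \<open>Z\<close> are positive.
\<close>

type_synonym 'e code = "'e set \<times> 'e set \<times> 'e option set"

definition codes :: "'c code set"
  where "codes = {(T, S, Z). tree T \<and> S \<subseteq> lives T \<and> Z \<subseteq> indices S}"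

definition smoothing :: "'c code \<Rightarrow> 'c set"
  where "smoothing = (\<lambda>(T, S, Z). sd T S)"

definition decode :: "'c code \<Rightarrow> ('c, 'a) enhanced_state"
  where "decode = (\<lambda>(T, S, Z). (sd T S, (\<lambda>i. circle (sd T S) (anchor T i)) ` Z))"

lemma fst_decode: "fst (decode k) = smoothing k"
  by (simp add: decode_def smoothing_def case_prod_beta)

lemma codesD:
  assumes "(T, S, Z) \<in> codes"
  shows "tree T" "S \<subseteq> lives T" "Z \<subseteq> indices S"
  using assms by (auto simp: codes_def)

lemma smoothing_subset: "tree T \<Longrightarrow> S \<subseteq> lives T \<Longrightarrow> sd T S \<subseteq> E"
  using sd_subset[OF tree_subset, of T S] lives_subset[of T] by blast

lemma positive_iff:
  assumes k: "(T, S, Z) \<in> codes" and i: "i \<in> indices S"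
  shows "circle (sd T S) (anchor T i) \<in> snd (decode (T, S, Z)) \<longleftrightarrow> i \<in> Z"
proof
  note T = codesD[OF k]
  assume "circle (sd T S) (anchor T i) \<in> snd (decode (T, S, Z))"
  then obtain j where j: "j \<in> Z" "circle (sd T S) (anchor T i) = circle (sd T S) (anchor T j)"
    by (auto simp: decode_def)
  then have jI: "j \<in> indices S" using T(3) by blast
  have "(anchor T i, anchor T j) \<in> R (sd T S)"
    using j(2) anchor_arc[OF T(1,2) i] anchor_arc[OF T(1,2) jI] circle_eq_iff by blast
  then show "i \<in> Z" using anchors_distinct[OF T(1,2) i jI] j(1) by metis
qed (auto simp: decode_def)

lemma decode_enhanced:
  assumes "k \<in> codes"
  shows "decode k \<in> enhanced_states D"
proof -
  obtain T S Z where k: "k = (T, S, Z)" by (cases k)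
  note T = codesD[OF assms[unfolded k]]
  have "circle (sd T S) (anchor T i) \<in> circles D (sd T S)" if "i \<in> Z" for i
    using circle_in anchor_arc[OF T(1,2)] T(3) that by blast
  then show ?thesis
    using smoothing_subset[OF T(1,2)] by (auto simp: k decode_def enhanced_states_def)
qed

lemma decode_inj: "inj_on decode codes"
proof (rule inj_onI)
  fix k l assume kl: "k \<in> codes" "l \<in> codes" and eq: "decode k = decode l"
  obtain T S Z where k: "k = (T, S, Z)" by (cases k)
  obtain T' S' Z' where l: "l = (T', S', Z')" by (cases l)
  note T = codesD[OF kl(1)[unfolded k]] and T' = codesD[OF kl(2)[unfolded l]]
  have B: "sd T S = sd T' S'" using eq by (simp add: k l decode_def)
  have "sd T (sd T S) \<subseteq> lives T" using T(2) by simp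
  moreover have "sd T' (sd T S) \<subseteq> lives T'" using T'(2) unfolding B by simp
  ultimately have TT: "T = T'" using interval_unique[OF T(1) T'(1)] by blast
  then have SS: "S = S'" using B by (metis sd_sd)
  have "i \<in> Z \<longleftrightarrow> i \<in> Z'" if "i \<in> indices S" for i
    using positive_iff[OF kl(1)[unfolded k] that] positive_iff[OF kl(2)[unfolded l], of i] that
      eq TT SS by (simp add: k l)
  then have "Z = Z'" using T(3) T'(3) SS by blast
  then show "k = l" using TT SS by (simp add: k l)
qed

lemma decode_surj: "decode ` codes = enhanced_states D"
proof (intro equalityI subsetI)
  fix s assume s: "s \<in> enhanced_states D"
  obtain B P where BP: "s = (B, P)" "B \<subseteq> E" "P \<subseteq> circles D B"
    using s by (auto simp: enhanced_states_def)
  obtain T where T: "tree T" "sd T B \<subseteq> lives T" using interval_exists[OF BP(2)] by blast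
  let ?S = "sd T B" and ?Z = "{i \<in> indices (sd T B). circle B (anchor T i) \<in> P}"
  have "C \<in> (\<lambda>i. circle B (anchor T i)) ` ?Z" if "C \<in> P" for C
  proof -
    have "C \<in> circles D B" using that BP(3) by blast
    then obtain a where a: "a \<in> A" "C = circle B a" by (rule circlesE)
    obtain i where i: "i \<in> indices ?S" "(a, anchor T i) \<in> R B"
      using anchors_cover[OF T a(1)] by auto
    then have "C = circle B (anchor T i)" using a circle_eq_iff anchor_arc[OF T i(1)] by blast
    then show ?thesis using i that by blast
  qed
  then have "P = (\<lambda>i. circle B (anchor T i)) ` ?Z" by blast
  then have "s = decode (T, ?S, ?Z)" by (simp add: BP(1) decode_def)
  moreover have "(T, ?S, ?Z) \<in> codes" using T by (auto simp: codes_def)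
  ultimately show "s \<in> decode ` codes" by blast
qed (use decode_enhanced in blast)

section \<open>The differential inside one interval, in terms of codes\<close>

context
  fixes T S Z g h Z'
  assumes k: "(T, S, Z) \<in> codes" and k': "(T, insert g S, Z') \<in> codes" and g: "g \<in> lives T" "g \<notin> S"
    and h: "h \<in> indices S" "(anchor T h, tip T g) \<in> R (sd T S)"
begin

private abbreviation "B \<equiv> sd T S"
private abbreviation "B' \<equiv> sd T (insert g S)"
private abbreviation "P \<equiv> snd (decode (T, S, Z))"
private abbreviation "P' \<equiv> snd (decode (T, insert g S, Z'))"

lemma flip_step: "B' = flip g B"
  using g by (simp add: sd_insert)

lemma step_edge: "g \<in> E" "B \<subseteq> E" "B' \<subseteq> E" "S \<subseteq> lives T" "insert g S \<subseteq> lives T" "tree T"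
  using codesD[OF k] codesD[OF k'] g lives_subset smoothing_subset by blast+

lemma step_related:
  shows "(x g, y g) \<in> R B" "(x g, y g) \<notin> R B'" "R B' \<subseteq> R B" "(x g, tip T g) \<in> R B"
    "(x g, anchor T h) \<in> R B"
proof -
  note T = step_edge(6)
  note new = new_circle[OF T step_edge(4) g]
  have tf: "tip T g \<in> A" "foot T g \<in> A" using tip_arc foot_arc T step_edge by auto
  show "R B' \<subseteq> R B" unfolding new(2) by (rule subset_merge)
  have tf_B: "(tip T g, foot T g) \<in> R B"
    unfolding new(2) using R_refl tf by (auto simp: merge_rel_def)
  then show xy: "(x g, y g) \<in> R B" using related_tip_foot[OF T] by blast
  show "(x g, y g) \<notin> R B'" using new(1) related_tip_foot[OF T] by blast
  show xt: "(x g, tip T g) \<in> R B"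
    using xy tf_B R_refl R_sym x_arc[OF step_edge(1)] by (auto simp: tip_def)
  show "(x g, anchor T h) \<in> R B" using R_trans[OF xt R_sym[OF h(2)]] .
qed

lemma step_indices: "h \<in> indices (insert g S)" "Some g \<in> indices (insert g S)" "h \<noteq> Some g"
    "Some g \<notin> Z" "Some g \<notin> indices S - {h}" "Z \<subseteq> insert h (indices S - {h})"
    "Z' \<subseteq> insert (Some g) (insert h (indices S - {h}))"
  using h(1) g codesD(3)[OF k] codesD(3)[OF k'] by (auto simp: indices_def)

text \<open>Which of \<open>x g\<close> and \<open>y g\<close> is the tip is unknown, so the two
  signs after the step appear only in symmetric combinations. These suffice for the sign
  rules.\<close>

lemma step_signs:
  shows "circle B (x g) \<in> P \<longleftrightarrow> h \<in> Z"
    "circle B' (x g) \<in> P' \<and> circle B' (y g) \<in> P' \<longleftrightarrow> h \<in> Z' \<and> Some g \<in> Z'"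
    "circle B' (x g) \<in> P' \<or> circle B' (y g) \<in> P' \<longleftrightarrow> h \<in> Z' \<or> Some g \<in> Z'"
proof -
  note T = step_edge(6)
  have hf: "(anchor T h, foot T g) \<in> R B'" by (rule parent_anchor[OF T step_edge(4) g h])
  have cx: "circle B (x g) = circle B (anchor T h)"
    using circle_eq_iff x_arc anchor_arc[OF T step_edge(4) h(1)] step_related(5) step_edge(1) by blast
  have cf: "circle B' (foot T g) = circle B' (anchor T h)"
    using circle_eq_iff foot_arc[OF T step_edge(1)] anchor_arc[OF T step_edge(4) h(1)] R_sym[OF hf]
    by blast
  have ct: "circle B' (tip T g) = circle B' (anchor T (Some g))"
    by (simp add: anchor_def)
  show "circle B (x g) \<in> P \<longleftrightarrow> h \<in> Z" unfolding cx by (rule positive_iff[OF k h(1)])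
  have "circle B' (foot T g) \<in> P' \<longleftrightarrow> h \<in> Z'" "circle B' (tip T g) \<in> P' \<longleftrightarrow> Some g \<in> Z'"
    unfolding cf ct using positive_iff[OF k'] step_indices(1,2) by blast+
  then show "circle B' (x g) \<in> P' \<and> circle B' (y g) \<in> P' \<longleftrightarrow> h \<in> Z' \<and> Some g \<in> Z'"
    "circle B' (x g) \<in> P' \<or> circle B' (y g) \<in> P' \<longleftrightarrow> h \<in> Z' \<or> Some g \<in> Z'"
    by (auto simp: tip_def foot_def split: if_splits)
qed

text \<open>Circles away from g keep their anchors, so their signs can be compared label by
  label.\<close>

lemma step_other_signs:
  "(\<forall>a\<in>A. (a, x g) \<notin> R B \<longrightarrow> (circle B' a \<in> P' \<longleftrightarrow> circle B a \<in> P)) \<longleftrightarrow>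
    (\<forall>i\<in>indices S - {h}. i \<in> Z' \<longleftrightarrow> i \<in> Z)"
proof
  note T = step_edge(6)
  assume l: "\<forall>a\<in>A. (a, x g) \<notin> R B \<longrightarrow> (circle B' a \<in> P' \<longleftrightarrow> circle B a \<in> P)"
  show "\<forall>i\<in>indices S - {h}. i \<in> Z' \<longleftrightarrow> i \<in> Z"
  proof
    fix i assume i: "i \<in> indices S - {h}"
    then have "(anchor T i, anchor T h) \<notin> R B" using anchors_distinct[OF T step_edge(4)] h(1) by blast
    then have "(anchor T i, x g) \<notin> R B" using R_trans[OF _ step_related(5)] by blast
    then have "circle B' (anchor T i) \<in> P' \<longleftrightarrow> circle B (anchor T i) \<in> P"
      using l anchor_arc[OF T step_edge(4)] i by blast
    moreover have "i \<in> indices (insert g S)" using i by (auto simp: indices_def)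
    ultimately show "i \<in> Z' \<longleftrightarrow> i \<in> Z" using positive_iff[OF k] positive_iff[OF k'] i by blast
  qed
next
  note T = step_edge(6)
  assume r: "\<forall>i\<in>indices S - {h}. i \<in> Z' \<longleftrightarrow> i \<in> Z"
  show "\<forall>a\<in>A. (a, x g) \<notin> R B \<longrightarrow> (circle B' a \<in> P' \<longleftrightarrow> circle B a \<in> P)"
  proof (intro ballI impI)
    fix a assume a: "a \<in> A" "(a, x g) \<notin> R B"
    obtain i where i: "i \<in> indices (insert g S)" "(a, anchor T i) \<in> R B'"
      using anchors_cover[OF T step_edge(5) a(1)] by blast
    then have iB: "(a, anchor T i) \<in> R B" using step_related(3) by blast
    have "i \<noteq> Some g"
      using iB a(2) R_trans[OF _ R_sym[OF step_related(4)]] by (auto simp: anchor_def)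
    moreover have "i \<noteq> h" using iB a(2) R_trans[OF _ R_sym[OF step_related(5)]] by blast
    ultimately have iS: "i \<in> indices S - {h}" using i(1) by (auto simp: indices_def)
    have "circle B' a = circle B' (anchor T i)" "circle B a = circle B (anchor T i)"
      using circle_eq_iff a(1) anchor_arc[OF T step_edge(5) i(1)] i(2) iB by blast+
    then show "circle B' a \<in> P' \<longleftrightarrow> circle B a \<in> P"
      using positive_iff[OF k, of i] positive_iff[OF k' i(1)] iS r by simp
  qed
qed

lemma step_positive: "P \<subseteq> circles D B" "P' \<subseteq> circles D B'"
  using decode_enhanced[OF k'] decode_enhanced[OF k] by (auto simp: enhanced_states_def decode_def)

text \<open>The first alternative, a positive new circle with the sign of the parent h unchanged, is
  the identity component that the matching uses. The second moves a positive sign to the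
  parent.\<close>

lemma decode_split_iff:
  assumes gT: "g \<notin> T"
  shows "decode (T, insert g S, Z') \<in> state_targets D (decode (T, S, Z)) g \<longleftrightarrow>
    Z' = insert (Some g) Z \<or> h \<notin> Z \<and> Z' = insert h Z"
proof -
  have gB: "g \<notin> B" using gT g by (simp add: in_sd_iff)
  have B': "insert g B = B'" using flip_step gB by (simp add: flip_def)
  have "decode (T, insert g S, Z') \<in> state_targets D (decode (T, S, Z)) g \<longleftrightarrow>
      (B', P') \<in> state_targets D (B, P) g"
    by (simp add: decode_def)
  also have "\<dots> \<longleftrightarrow> (\<forall>i\<in>indices S - {h}. i \<in> Z' \<longleftrightarrow> i \<in> Z) \<and>
    (h \<in> Z \<and> h \<in> Z' \<and> Some g \<in> Z' \<or> h \<notin> Z \<and> (h \<in> Z') \<noteq> (Some g \<in> Z'))"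
    unfolding split_targets[OF step_edge(2,1) gB step_related(1) step_positive(1)] B'
      step_other_signs step_signs(1)
    using step_positive(2) step_signs(2,3) by blast
  also have "\<dots> \<longleftrightarrow> Z' = insert (Some g) Z \<or> h \<notin> Z \<and> Z' = insert h Z"
    using step_indices(3-7) by blast
  finally show ?thesis .
qed

text \<open>A negative circle is a unit for merging and is absorbed without a trace; this is the
  identity component here. A positive circle hands its sign to the parent and gives 0 if the parent
  is already positive.\<close>

lemma decode_merge_iff:
  assumes gT: "g \<in> T"
  shows "decode (T, S, Z) \<in> state_targets D (decode (T, insert g S, Z')) g \<longleftrightarrow>
    Some g \<notin> Z' \<and> Z = Z' \<or> Some g \<in> Z' \<and> h \<notin> Z' \<and> Z = insert h (Z' - {Some g})"
proof -
  have gB: "g \<notin> B'" using gT g by (simp add: in_sd_iff)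
  have B': "insert g B' = B" unfolding flip_step using gT g by (auto simp: flip_def in_sd_iff)
  have "decode (T, S, Z) \<in> state_targets D (decode (T, insert g S, Z')) g \<longleftrightarrow>
      (B, P) \<in> state_targets D (B', P') g"
    by (simp add: decode_def)
  also have "\<dots> \<longleftrightarrow> (\<forall>i\<in>indices S - {h}. i \<in> Z' \<longleftrightarrow> i \<in> Z) \<and>
    (h \<notin> Z' \<and> Some g \<notin> Z' \<and> h \<notin> Z \<or> (h \<in> Z') \<noteq> (Some g \<in> Z') \<and> h \<in> Z)"
    unfolding merge_targets[OF step_edge(3,1) gB step_related(2) step_positive(2)] B'
      step_other_signs[symmetric] step_signs(1)
    using step_positive(1) step_signs(2,3) by blast
  also have "\<dots> \<longleftrightarrow> Some g \<notin> Z' \<and> Z = Z' \<or> Some g \<in> Z' \<and> h \<notin> Z' \<and> Z = insert h (Z' - {Some g})"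
    using step_indices(3-7) by blast
  finally show ?thesis .
qed

end

text \<open>A live edge resists cancellation only if it is flipped with the sign that the identity
  component misses: positive for \<open>e\<close> in \<open>T\<close>, where flipping back is a
  merge, and negative for \<open>e\<close> outside \<open>T\<close>, where flipping is a
  split.\<close>

definition noncritical :: "'c code \<Rightarrow> 'c \<Rightarrow> bool"
  where "noncritical = (\<lambda>(T, S, Z) e. e \<in> lives T \<and> \<not> (e \<in> S \<and> (Some e \<in> Z \<longleftrightarrow> e \<in> T)))"

text \<open>Follows the identity component at \<open>e\<close> in whichever direction is possible.
  The sign of the new circle is fixed by whether \<open>e\<close> lies in \<open>T\<close>, and on
  noncritical codes this is an involution.\<close>

definition toggle :: "'c \<Rightarrow> 'c code \<Rightarrow> 'c code"
  where "toggle e = (\<lambda>(T, S, Z). if e \<in> S then (T, S - {e}, Z - {Some e})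
    else (T, insert e S, if e \<in> T then Z else insert (Some e) Z))"

lemma toggle_code: "k \<in> codes \<Longrightarrow> noncritical k e \<Longrightarrow> toggle e k \<in> codes"
  by (cases k) (auto simp: codes_def noncritical_def toggle_def indices_def)

lemma toggle_toggle: "k \<in> codes \<Longrightarrow> noncritical k e \<Longrightarrow> toggle e (toggle e k) = k"
  by (cases k) (auto simp: codes_def noncritical_def toggle_def indices_def)

text \<open>The condition at an edge reads only the flip and the sign at that edge, and the toggled
  edge stays noncritical. Hence matched codes have the same pivot.\<close>

lemma noncritical_toggle: "k \<in> codes \<Longrightarrow> noncritical k e \<Longrightarrow> noncritical (toggle e k) = noncritical k"
  by (cases k) (auto simp: codes_def noncritical_def toggle_def indices_def fun_eq_iff)

lemma smoothing_toggle: "smoothing (toggle e k) = flip e (smoothing k)"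
  by (cases k) (auto simp: smoothing_def toggle_def sd_def flip_def)

text \<open>
  The total depth of the positive circles, where an unflipped edge is charged as the noncritical
  state with which it is matched if this has a positive circle. The differential only moves
  positive signs towards the root.
\<close>

definition energy :: "'c code \<Rightarrow> nat"
  where "energy = (\<lambda>(T, S, Z). (\<Sum>i\<in>Z. depth T i) + (\<Sum>e\<in>lives T - S - T. depth T (Some e)))"

text \<open>Later trees have the smaller first component; within an interval the energy
  decides.\<close>

definition rank :: "'c code \<Rightarrow> nat \<times> nat"
  where "rank k = (binary_value E (E - fst k), energy k)"

lemma finite_lives: "finite (lives T)"
  using lives_subset finite_crossings by (rule finite_subset)

lemma finite_code:
  assumes "(T, S, Z) \<in> codes"
  shows "finite S" "finite Z"
proof -
  show "finite S" using codesD(2)[OF assms] finite_lives by (rule finite_subset)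
  then show "finite Z" using codesD(3)[OF assms] by (auto simp: indices_def intro: finite_subset)
qed

lemma energy_flip:
  assumes k: "(T, S, Z) \<in> codes" and g: "g \<in> lives T" "g \<notin> S" "g \<notin> T"
  shows "energy (T, S, Z) = (\<Sum>i\<in>Z. depth T i) + depth T (Some g) +
    (\<Sum>e\<in>lives T - insert g S - T. depth T (Some e))"
proof -
  have "lives T - S - T = insert g (lives T - insert g S - T)" using g by auto
  then show ?thesis using finite_lives by (simp add: energy_def)
qed

text \<open>For e outside \<open>T\<close> the charge for the unflipped edge equals the depth of the
  positive circle that replaces it. For e in \<open>T\<close> the circle involved is negative and
  there is no charge.\<close>

lemma rank_toggle:
  assumes k: "k \<in> codes" and e: "noncritical k e" "e \<notin> smoothing k"
  shows "rank (toggle e k) = rank k"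
proof -
  obtain T S Z where TSZ: "k = (T, S, Z)" by (cases k)
  note k' = k[unfolded TSZ]
  show ?thesis
  proof (cases "e \<in> S")
    case True
    then have e': "e \<in> T" "Some e \<notin> Z" using e by (auto simp: TSZ smoothing_def in_sd_iff noncritical_def)
    then have "lives T - (S - {e}) - T = lives T - S - T" by auto
    then show ?thesis using True e' by (simp add: TSZ rank_def toggle_def energy_def)
  next
    case False
    then have e': "e \<in> lives T" "e \<notin> T" "Some e \<notin> Z"
      using e codesD(3)[OF k'] by (auto simp: TSZ smoothing_def in_sd_iff noncritical_def indices_def)
    then show ?thesis
      using False energy_flip[OF k' e'(1) False e'(2)] finite_code[OF k']
      by (simp add: TSZ rank_def toggle_def) (simp add: energy_def)
  qed
qed

lemma parent_exists:
  assumes "tree T" "S \<subseteq> lives T" "g \<in> lives T"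
  obtains h where "h \<in> indices S" "(anchor T h, tip T g) \<in> R (sd T S)"
  using anchors_cover[OF assms(1,2) tip_arc[OF assms(1)]] assms(3) lives_subset R_sym by blast

lemma toggle_target:
  assumes k: "k \<in> codes" and e: "noncritical k e" "e \<notin> smoothing k"
  shows "decode (toggle e k) \<in> state_targets D (decode k) e"
proof -
  obtain T S Z where TSZ: "k = (T, S, Z)" by (cases k)
  note k' = k[unfolded TSZ]
  note T = codesD[OF k']
  have live: "e \<in> lives T" using e by (simp add: TSZ noncritical_def)
  note tk = toggle_code[OF k e(1)]
  show ?thesis
  proof (cases "e \<in> S")
    case True
    then have e': "e \<in> T" "Some e \<notin> Z" using e by (auto simp: TSZ smoothing_def in_sd_iff noncritical_def)
    have S: "insert e (S - {e}) = S" using True by blast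
    obtain h where h: "h \<in> indices (S - {e})" "(anchor T h, tip T e) \<in> R (sd T (S - {e}))"
      using parent_exists[OF T(1) _ live, of "S - {e}"] T(2) by blast
    have *: "toggle e k = (T, S - {e}, Z)" using True e' by (simp add: TSZ toggle_def)
    show ?thesis
      using decode_merge_iff[of T "S - {e}" Z e Z h] k' tk live h e' unfolding S * by (simp add: TSZ)
  next
    case False
    then have e': "e \<notin> T" using e by (simp add: TSZ smoothing_def in_sd_iff)
    obtain h where h: "h \<in> indices S" "(anchor T h, tip T e) \<in> R (sd T S)"
      using parent_exists[OF T(1,2) live] by blast
    have *: "toggle e k = (T, insert e S, insert (Some e) Z)" using False e' by (simp add: TSZ toggle_def)
    show ?thesis
      using decode_split_iff[of T S Z e "insert (Some e) Z" h] k' tk live h e' False unfolding *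
      by (simp add: TSZ)
  qed
qed

text \<open>A step either reaches a later tree, or is the identity component, or puts a positive
  sign on the parent at the cost of a deeper sign or charge; \<open>depth_parent\<close> makes the
  last case a strict descent.\<close>

lemma target_rank:
  assumes k: "k \<in> codes" and l: "l \<in> codes" and g: "g \<in> E" "g \<notin> smoothing k"
    and t: "decode l \<in> state_targets D (decode k) g"
  shows "(rank l, rank k) \<in> less_than <*lex*> less_than \<or> noncritical k g \<and> l = toggle g k"
proof -
  obtain T S Z where k_eq: "k = (T, S, Z)" by (cases k)
  obtain T' S' Z' where l_eq: "l = (T', S', Z')" by (cases l)
  note kc = k[unfolded k_eq] and lc = l[unfolded l_eq]
  note T = codesD[OF kc] and T' = codesD[OF lc]
  have sm: "sd T' S' = insert g (sd T S)"
    using target_fst[OF t] by (simp add: fst_decode k_eq l_eq smoothing_def)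
  have gB: "g \<notin> sd T S" using g(2) by (simp add: k_eq smoothing_def)
  show ?thesis
  proof (cases "T = T'")
    case False
    then show ?thesis
      using interval_step[OF T(1) T'(1) False T(2) T'(2) gB sm] by (simp add: rank_def k_eq l_eq)
  next
    case True
    have S': "S' = flip g S"
      using arg_cong[OF sm, of "sd T"] gB True by (auto simp: sd_def flip_def)
    have live: "g \<in> lives T" using S' T(2) T'(2) True by (auto simp: flip_def split: if_splits)
    show ?thesis
    proof (cases "g \<in> S")
      case gS: True
      then have gT: "g \<in> T" using gB by (simp add: in_sd_iff)
      have S: "insert g S' = S" "g \<notin> S'" using S' gS by (auto simp: flip_def)
      have S'S: "S' = S - {g}" using S by blast
      obtain h where h: "h \<in> indices S'" "(anchor T h, tip T g) \<in> R (sd T S')"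
        using parent_exists[OF T(1) _ live, of S'] T'(2) True by blast
      have h_less: "depth T h < depth T (Some g)"
        by (rule depth_parent[OF T(1) _ live S(2) h]) (use T'(2) True in blast)
      have "Some g \<notin> Z \<and> Z' = Z \<or> Some g \<in> Z \<and> h \<notin> Z \<and> Z' = insert h (Z - {Some g})"
        using decode_merge_iff[of T S' Z' g Z h] kc lc live h t S gT True
        by (simp add: k_eq l_eq)
      then show ?thesis
      proof (elim disjE conjE)
        assume "Some g \<notin> Z" "Z' = Z"
        then show ?thesis
          using live gS gT S'S True by (simp add: k_eq l_eq noncritical_def toggle_def)
      next
        assume Z: "Some g \<in> Z" "h \<notin> Z" "Z' = insert h (Z - {Some g})"
        \<comment> \<open>Edges of \<open>T\<close> are never charged, so returning g to its
          original smoothing affects only the sum over the positive circles.\<close>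
        have "lives T - S' - T = lives T - S - T" using gT S by auto
        moreover have "(\<Sum>i\<in>Z'. depth T i) < (\<Sum>i\<in>Z. depth T i)"
          using Z h_less finite_code(2)[OF kc] sum.remove[OF finite_code(2)[OF kc] Z(1), of "depth T"]
          by simp
        ultimately have "energy l < energy k" using True by (simp add: k_eq l_eq energy_def)
        then show ?thesis using True by (simp add: rank_def k_eq l_eq)
      qed
    next
      case gS: False
      then have gT: "g \<notin> T" using gB by (simp add: in_sd_iff)
      have S: "S' = insert g S" using S' gS by (simp add: flip_def)
      obtain h where h: "h \<in> indices S" "(anchor T h, tip T g) \<in> R (sd T S)"
        using parent_exists[OF T(1,2) live] by blast
      have h_less: "depth T h < depth T (Some g)"
        by (rule depth_parent[OF T(1,2) live gS h])
      have "Z' = insert (Some g) Z \<or> h \<notin> Z \<and> Z' = insert h Z"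
        using decode_split_iff[of T S Z g Z' h] kc lc live h t S gT gS True
        by (simp add: k_eq l_eq)
      then show ?thesis
      proof (elim disjE conjE)
        assume "Z' = insert (Some g) Z"
        then show ?thesis
          using live gS gT S True by (simp add: k_eq l_eq noncritical_def toggle_def)
      next
        assume Z: "h \<notin> Z" "Z' = insert h Z"
        have "energy l < energy k"
          using Z h_less finite_code(2)[OF kc] energy_flip[OF kc live gS gT] True S
          by (simp add: k_eq l_eq) (simp add: energy_def)
        then show ?thesis using True by (simp add: rank_def k_eq l_eq)
      qed
    qed
  qed
qed

text \<open>Only the sign of the root circle is free. A negative root, \<open>b\<close> true,
  belongs to the generator in the upper bidegree.\<close>

definition critical :: "'c set \<times> bool \<Rightarrow> 'c code"
  where "critical = (\<lambda>(T, b). (T, lives T, Some ` (lives T \<inter> T) \<union> (if b then {} else {None})))"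

lemma critical_code: "tree T \<Longrightarrow> critical (T, b) \<in> codes"
  by (auto simp: critical_def codes_def indices_def)

lemma critical_iff:
  assumes k: "k \<in> codes"
  shows "(\<forall>e. \<not> noncritical k e) \<longleftrightarrow> (\<exists>T b. tree T \<and> k = critical (T, b))"
proof
  obtain T S Z where TSZ: "k = (T, S, Z)" by (cases k)
  note T = codesD[OF k[unfolded TSZ]]
  assume none: "\<forall>e. \<not> noncritical k e"
  then have "S = lives T" and Z: "\<And>e. e \<in> lives T \<Longrightarrow> Some e \<in> Z \<longleftrightarrow> e \<in> T"
    using T(2) by (auto simp: TSZ noncritical_def)
  moreover have "Z = Some ` (lives T \<inter> T) \<union> (if None \<notin> Z then {} else {None})"
    using T(3) Z \<open>S = lives T\<close> by (auto simp: indices_def)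
  ultimately have "k = critical (T, None \<notin> Z)" by (simp add: TSZ critical_def)
  then show "\<exists>T b. tree T \<and> k = critical (T, b)" using T(1) by blast
qed (auto simp: critical_def noncritical_def split: if_splits)

text \<open>It depends on the set of noncritical edges alone, which \<open>toggle\<close> preserves,
  so a code and its partner choose the same edge.\<close>

definition pivot :: "'c code \<Rightarrow> 'c"
  where "pivot k = Min {e. noncritical k e}"

lemma pivot_noncritical:
  assumes "noncritical k e"
  shows "noncritical k (pivot k)"
proof -
  have "{e. noncritical k e} \<subseteq> lives (fst k)" by (cases k) (auto simp: noncritical_def)
  then have "finite {e. noncritical k e}" using finite_lives by (rule finite_subset)
  then show ?thesis unfolding pivot_def using Min_in[of "{e. noncritical k e}"] assms by blast
qed

definition sources :: "'c code set"
  where "sources = {k \<in> codes. noncritical k (pivot k) \<and> pivot k \<notin> smoothing k}"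

definition partner :: "'c code \<Rightarrow> 'c code"
  where "partner k = toggle (pivot k) k"

lemma pivot_partner: "k \<in> codes \<Longrightarrow> noncritical k (pivot k) \<Longrightarrow> pivot (partner k) = pivot k"
  using noncritical_toggle[of k "pivot k"] by (simp add: partner_def pivot_def)

text \<open>The critical codes are indexed through \<gamma>, which keeps the matching independent of
  the Tait graph. A source has the same rank as its partner, so comparing ranks of sources is enough
  for triangularity.\<close>

lemma acyclic_matching_khovanov:
  fixes X :: "'g bigraded_basis"
  assumes X: "bij_betw \<gamma> (gens X) {(T, b). tree T}"
  shows "acyclic_matching (khovanov_group D) (1, 0) \<delta> sources decode (decode \<circ> partner)
    (inv_image (less_than <*lex*> less_than) rank) X (decode \<circ> critical \<circ> \<gamma>)"
proof -
  have partner: "partner k \<in> codes" "partner (partner k) = k" "noncritical (partner k) = noncritical k"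
      "smoothing (partner k) = flip (pivot k) (smoothing k)"
    if "k \<in> codes" "noncritical k (pivot k)" for k
    using toggle_code[OF that] toggle_toggle[OF that] noncritical_toggle[OF that] smoothing_toggle
      pivot_partner[OF that] by (simp_all add: partner_def)
  have sources: "k \<in> codes" "noncritical k (pivot k)" "pivot k \<notin> smoothing k" if "k \<in> sources" for k
    using that by (auto simp: sources_def)
  have partner_sources: "partner ` sources = {k \<in> codes. noncritical k (pivot k) \<and> pivot k \<in> smoothing k}"
  proof (intro equalityI subsetI)
    fix l assume "l \<in> partner ` sources"
    then obtain k where k: "k \<in> sources" "l = partner k" by blast
    note s = sources[OF k(1)]
    show "l \<in> {k \<in> codes. noncritical k (pivot k) \<and> pivot k \<in> smoothing k}"
      using partner[OF s(1,2)] s pivot_partner[OF s(1,2)] k(2) by (simp add: flip_def)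
  next
    fix l assume l: "l \<in> {k \<in> codes. noncritical k (pivot k) \<and> pivot k \<in> smoothing k}"
    then have "partner l \<in> sources"
      using partner[of l] pivot_partner[of l] by (simp add: sources_def flip_def)
    then show "l \<in> partner ` sources" using partner(2)[of l] l by force
  qed
  have crit: "(critical \<circ> \<gamma>) ` gens X = {k \<in> codes. \<forall>e. \<not> noncritical k e}"
  proof -
    have "\<gamma> ` gens X = {(T, b). tree T}" using X by (simp add: bij_betw_def)
    then have "(critical \<circ> \<gamma>) ` gens X = critical ` {(T, b). tree T}" by (metis image_comp)
    also have "\<dots> = {k \<in> codes. \<exists>T b. tree T \<and> k = critical (T, b)}"
      using critical_code by auto
    also have "\<dots> = {k \<in> codes. \<forall>e. \<not> noncritical k e}"
      by (rule Collect_cong, rule conj_cong[OF refl]) (rule critical_iff[symmetric])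
    finally show ?thesis .
  qed
  have none_iff: "(\<forall>e. \<not> noncritical k e) \<longleftrightarrow> \<not> noncritical k (pivot k)" for k
    using pivot_noncritical[of k] by blast
  have cover: "codes = sources \<union> partner ` sources \<union> (critical \<circ> \<gamma>) ` gens X"
    unfolding partner_sources crit none_iff unfolding sources_def by blast
  have disjoint: "sources \<inter> partner ` sources = {}" "sources \<inter> (critical \<circ> \<gamma>) ` gens X = {}"
    "partner ` sources \<inter> (critical \<circ> \<gamma>) ` gens X = {}"
    unfolding partner_sources crit none_iff unfolding sources_def by blast+
  have sub: "sources \<subseteq> codes" "partner ` sources \<subseteq> codes" "(critical \<circ> \<gamma>) ` gens X \<subseteq> codes"
    using cover by blast+
  have inj: "inj_on critical {(T, b). tree T}"
    by (rule inj_onI) (auto simp: critical_def split: if_splits)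
  have inj_partner: "inj_on partner sources"
    by (rule inj_on_inverseI[of _ partner]) (use partner(2) sources in blast)
  have img: "decode ` U \<inter> decode ` V = {}" if "U \<inter> V = {}" "U \<subseteq> codes" "V \<subseteq> codes" for U V
    using inj_on_image_Int[OF decode_inj that(2,3)] that(1) by simp
  show ?thesis
  proof
    show "differential (khovanov_group D) (1, 0) (frag_extend \<delta>)"
      using differential_khovanov by (simp add: khovanov_d_eq)
    show "inj_on decode sources" using decode_inj sub(1) by (rule inj_on_subset)
    show "inj_on (decode \<circ> partner) sources"
      using inj_partner inj_on_subset[OF decode_inj sub(2)] by (rule comp_inj_on)
    have "inj_on (critical \<circ> \<gamma>) (gens X)"
      using X inj by (auto simp: bij_betw_def intro: comp_inj_on)
    then show "inj_on (decode \<circ> critical \<circ> \<gamma>) (gens X)"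
      using inj_on_subset[OF decode_inj sub(3)] unfolding comp_assoc by (rule comp_inj_on)
    have "gens (khovanov_group D) = decode ` codes"
      by (simp add: decode_surj khovanov_group_def)
    also have "\<dots> = decode ` (sources \<union> partner ` sources \<union> (critical \<circ> \<gamma>) ` gens X)"
      by (rule arg_cong[OF cover])
    finally show "gens (khovanov_group D) = decode ` sources \<union> (decode \<circ> partner) ` sources \<union>
        (decode \<circ> critical \<circ> \<gamma>) ` gens X"
      by (simp only: image_Un image_comp comp_assoc)
    show "decode ` sources \<inter> (decode \<circ> partner) ` sources = {}"
      "decode ` sources \<inter> (decode \<circ> critical \<circ> \<gamma>) ` gens X = {}"
      "(decode \<circ> partner) ` sources \<inter> (decode \<circ> critical \<circ> \<gamma>) ` gens X = {}"
      using img[OF disjoint(1) sub(1,2)] img[OF disjoint(2) sub(1,3)] img[OF disjoint(3) sub(2,3)]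
      by (simp_all only: image_comp comp_assoc)
    show "wf (inv_image (less_than <*lex*> less_than) rank)" by auto
  next
    fix k assume "k \<in> sources"
    note k = sources[OF this]
    have E: "pivot k \<in> E - fst (decode k)"
      using k lives_subset by (cases k) (auto simp: noncritical_def fst_decode)
    show "Poly_Mapping.lookup (\<delta> (decode k)) ((decode \<circ> partner) k) \<in> {1, - 1}"
      using lookup_\<delta>[OF decode_enhanced[OF k(1)] E, of "decode (partner k)"]
        toggle_target[OF k] unfolding o_def partner_def edge_sign_def
      by (simp add: minus_one_power_iff)
  next
    fix l k assume lk: "l \<in> sources" "k \<in> sources" "l \<noteq> k"
      and nz: "Poly_Mapping.lookup (\<delta> (decode k)) ((decode \<circ> partner) l) \<noteq> 0"
    note l = sources[OF lk(1)] and k = sources[OF lk(2)]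
    have "decode (partner l) \<in> Poly_Mapping.keys (\<delta> (decode k))" using nz by (simp add: in_keys_iff)
    then obtain g where g: "g \<in> E" "g \<notin> smoothing k" "decode (partner l) \<in> state_targets D (decode k) g"
      using \<delta>_keys[of "decode k"] by (auto simp: fst_decode)
    \<comment> \<open>Toggling g would give k and l the same pivot. It lies in neither smoothing but
      does lie in that of the partner of l, so g must be the pivot and k = l.\<close>
    have "\<not> (noncritical k g \<and> partner l = toggle g k)"
    proof
      assume *: "noncritical k g \<and> partner l = toggle g k"
      then have nc: "noncritical l = noncritical k"
        using noncritical_toggle[OF k(1)] partner(3)[OF l(1,2)] by metis
      then have "pivot l = pivot k" by (simp add: pivot_def)
      moreover have "flip (pivot l) (smoothing l) = flip g (smoothing k)"
        using * partner(4)[OF l(1,2)] smoothing_toggle by metis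
      ultimately have "g = pivot k" using g(2) k(3) l(3) by (auto simp: flip_def)
      then have "partner l = partner k" using * by (simp add: partner_def)
      then show False using inj_partner lk by (auto dest: inj_onD)
    qed
    then have "(rank (partner l), rank k) \<in> less_than <*lex*> less_than"
      using target_rank[OF k(1) partner(1)[OF l(1,2)] g] by blast
    then show "(l, k) \<in> inv_image (less_than <*lex*> less_than) rank"
      using rank_toggle[OF l] by (simp add: partner_def)
  qed
qed

end

section \<open>Circles as orbits of a permutation\<close>

definition orbit_rel :: "'a set \<Rightarrow> ('a \<Rightarrow> 'a) \<Rightarrow> 'a rel"
  where "orbit_rel A s = eqv_gen A {(a, s a) | a. a \<in> A}"

lemma equiv_orbit_rel: "equiv A (orbit_rel A s)"
  unfolding orbit_rel_def by (rule equiv_eqv_gen)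

lemma orbit_rel_step: "a \<in> A \<Longrightarrow> s a \<in> A \<Longrightarrow> (a, s a) \<in> orbit_rel A s"
  unfolding orbit_rel_def by (rule eqv_gen_base) auto

text \<open>An injective map of a finite set into itself is onto, so a set closed under forward
  steps is also closed under backward ones.\<close>

lemma orbit_rel_closed:
  assumes A: "finite A" and s: "inj_on s A" and Y: "Y \<subseteq> A" "s ` Y \<subseteq> Y"
    and ab: "(a, b) \<in> orbit_rel A s"
  shows "a \<in> Y \<longleftrightarrow> b \<in> Y"
proof -
  have "finite Y" using Y(1) A by (rule finite_subset)
  then have sY: "s ` Y = Y"
    using endo_inj_surj[OF _ Y(2)] inj_on_subset[OF s Y(1)] by blast
  let ?Q = "{(a, b). a \<in> A \<and> b \<in> A \<and> (a \<in> Y \<longleftrightarrow> b \<in> Y)}"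
  have *: "s c \<in> Y \<longleftrightarrow> c \<in> Y" if "c \<in> A" for c
  proof
    assume "s c \<in> Y"
    then obtain d where "d \<in> Y" "s c = s d" using sY by (metis imageE)
    then show "c \<in> Y" using s that Y(1) by (metis inj_onD subsetD)
  qed (use Y in blast)
  show ?thesis
  proof -
    have "(a, b) \<in> (({(a, s a) |a. a \<in> A}) \<union> ({(a, s a) |a. a \<in> A})\<inverse>)\<^sup>*"
      using ab by (simp add: orbit_rel_def eqv_gen_def)
    then show ?thesis by (induction rule: rtrancl_induct) (auto simp: *)
  qed
qed

section \<open>A permutation multiplied by a transposition\<close>

context
  fixes A :: "'a set" and s s' :: "'a \<Rightarrow> 'a" and x y :: 'a
  assumes A: "finite A" and s: "inj_on s A" "s ` A \<subseteq> A" and xy: "x \<in> A" "y \<in> A" "x \<noteq> y"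
    and s': "s' x = s y" "s' y = s x" "\<And>a. a \<noteq> x \<Longrightarrow> a \<noteq> y \<Longrightarrow> s' a = s a"
begin

private lemma iterate_in: "a \<in> A \<Longrightarrow> (s ^^ n) a \<in> A"
  using s(2) by (induction n) auto

private lemma iterate_related: "a \<in> A \<Longrightarrow> (a, (s ^^ n) a) \<in> orbit_rel A s"
proof (induction n)
  case 0
  then show ?case using equiv_refl[OF equiv_orbit_rel] by simp
next
  case (Suc n)
  then show ?case
    using equiv_trans[OF equiv_orbit_rel] orbit_rel_step[of "(s ^^ n) a" A s] iterate_in[of a] s(2)
    by (metis funpow.simps(2) o_apply)
qed

private lemma forward_orbit:
  assumes a: "a \<in> A" and ab: "(a, b) \<in> orbit_rel A s"
  shows "\<exists>n. b = (s ^^ n) a"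
proof -
  let ?Y = "range (\<lambda>n. (s ^^ n) a)"
  have "s ((s ^^ n) a) \<in> ?Y" for n by (rule range_eqI[of _ _ "Suc n"]) simp
  then have "s ` ?Y \<subseteq> ?Y" by blast
  moreover have "?Y \<subseteq> A" using iterate_in[OF a] by blast
  moreover have "a \<in> ?Y" by (rule range_eqI[of _ _ 0]) simp
  ultimately have "b \<in> ?Y" using orbit_rel_closed[OF A s(1) _ _ ab] by blast
  then show ?thesis by blast
qed

lemma swap_inj: "inj_on s' A" "s' ` A \<subseteq> A"
proof -
  define t where "t a = (if a = x then y else if a = y then x else a)" for a
  have *: "s' a = s (t a)" for a using s' by (simp add: t_def)
  have tA: "t a \<in> A" if "a \<in> A" for a using that xy by (simp add: t_def)
  show "inj_on s' A"
  proof (rule inj_onI)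
    fix a b assume ab: "a \<in> A" "b \<in> A" "s' a = s' b"
    then have "t a = t b" unfolding * using inj_onD[OF s(1)] tA by blast
    then show "a = b" by (simp add: t_def split: if_splits)
  qed
  show "s' ` A \<subseteq> A" using s(2) tA unfolding * by blast
qed

text \<open>Now y is sent to \<open>s x\<close>, so the stretch of the old orbit from
  \<open>s x\<close> to y closes up, and it does not contain x.\<close>

lemma swap_splits:
  assumes "(x, y) \<in> orbit_rel A s"
  shows "(x, y) \<notin> orbit_rel A s'"
proof
  assume xy': "(x, y) \<in> orbit_rel A s'"
  define m where "m = (LEAST m. (s ^^ m) x = y)"
  obtain n where "y = (s ^^ n) x" using forward_orbit[OF xy(1) assms] by blast
  then have m: "(s ^^ m) x = y" unfolding m_def by (metis (mono_tags) LeastI)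
  have least: "(s ^^ i) x \<noteq> y" if "i < m" for i using that not_less_Least unfolding m_def by blast
  have m0: "m > 0" using m xy(3) by (cases m) auto
  \<comment> \<open>A return to x on the way would give a shorter way from x to y.\<close>
  have not_x: "(s ^^ i) x \<noteq> x" if "0 < i" "i \<le> m" for i
  proof
    assume "(s ^^ i) x = x"
    then have "(s ^^ (m - i)) x = (s ^^ (m - i)) ((s ^^ i) x)" by simp
    also have "\<dots> = (s ^^ m) x" using that by (metis comp_apply funpow_add le_add_diff_inverse2)
    finally show False using m least[of "m - i"] that m0 by simp
  qed
  let ?O = "(\<lambda>i. (s ^^ i) x) ` {0<..m}"
  have "s' ((s ^^ i) x) \<in> ?O" if i: "0 < i" "i \<le> m" for i
  proof (cases "i = m")
    case True
    then have "s' ((s ^^ i) x) = (s ^^ 1) x" using m s'(2) by simp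
    then show ?thesis using m0 by (intro image_eqI[of _ _ 1]) auto
  next
    case False
    then have "s' ((s ^^ i) x) = (s ^^ Suc i) x" using s'(3) not_x[OF i] least[of i] i by simp
    then show ?thesis using False i by (intro image_eqI[of _ _ "Suc i"]) auto
  qed
  then have "s' ` ?O \<subseteq> ?O" by auto
  moreover have "?O \<subseteq> A" using iterate_in[OF xy(1)] by blast
  ultimately have "x \<in> ?O \<longleftrightarrow> y \<in> ?O" using orbit_rel_closed[OF A swap_inj(1) _ _ xy'] by blast
  moreover have "y \<in> ?O" using m m0 by (intro image_eqI[of _ _ m]) auto
  ultimately have "x \<in> ?O" by blast
  then obtain i where "0 < i" "i \<le> m" "x = (s ^^ i) x" by auto
  then show False using not_x by metis
qed

text \<open>From y the new map goes to \<open>s x\<close> and then follows the old orbit of x, which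
  avoids y, until it arrives at x.\<close>

lemma swap_merges:
  assumes "(x, y) \<notin> orbit_rel A s"
  shows "(x, y) \<in> orbit_rel A s'"
proof -
  have sx: "s x \<in> A" using s(2) xy by blast
  have "(s x, x) \<in> orbit_rel A s"
    using equiv_sym[OF equiv_orbit_rel orbit_rel_step[of x A s, OF xy(1) sx]] .
  then obtain n where "x = (s ^^ n) (s x)" using forward_orbit[OF sx] by blast
  then have n: "x = (s ^^ Suc n) x" by (simp add: funpow_swap1)
  define m where "m = (LEAST m. (s ^^ Suc m) x = x)"
  have m: "(s ^^ Suc m) x = x" unfolding m_def by (rule LeastI) (rule n[symmetric])
  have least: "(s ^^ Suc i) x \<noteq> x" if "i < m" for i using that not_less_Least unfolding m_def by blast
  have "i \<le> m \<Longrightarrow> (y, (s ^^ Suc i) x) \<in> orbit_rel A s'" for i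
  proof (induction i)
    case 0
    then show ?case using orbit_rel_step[of y A s'] xy sx s'(2) by simp
  next
    case (Suc i)
    let ?z = "(s ^^ Suc i) x"
    have "?z \<noteq> y" using iterate_related[OF xy(1)] assms by metis
    moreover have "?z \<noteq> x" using least Suc by simp
    ultimately have "s' ?z = (s ^^ Suc (Suc i)) x" using s'(3) by simp
    moreover have "(?z, s' ?z) \<in> orbit_rel A s'"
      using orbit_rel_step[of ?z A s'] iterate_in[OF xy(1)] swap_inj(2) by blast
    ultimately show ?case using Suc equiv_trans[OF equiv_orbit_rel] by (metis Suc_leD)
  qed
  then have "(y, x) \<in> orbit_rel A s'" using m by (metis order_refl)
  then show ?thesis by (rule equiv_sym[OF equiv_orbit_rel])
qed

lemma swap_merge_rel:
  assumes no: "(x, y) \<notin> orbit_rel A s"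
  shows "orbit_rel A s' = merge_rel (orbit_rel A s) x y"
proof (rule equalityI)
  have xy_merge: "(x, y) \<in> merge_rel (orbit_rel A s) x y"
    using equiv_refl[OF equiv_orbit_rel] xy by (auto simp: merge_rel_def)
  note E = equiv_merge[OF equiv_orbit_rel[of A s] xy(1,2)]
  have step: "(a, s a) \<in> merge_rel (orbit_rel A s) x y" if "a \<in> A" for a
    by (intro subsetD[OF subset_merge] orbit_rel_step) (use that s(2) in auto)
  show "orbit_rel A s' \<subseteq> merge_rel (orbit_rel A s) x y"
    unfolding orbit_rel_def[of A s']
  proof (rule eqv_gen_subset[OF E], clarify)
    fix a assume "a \<in> A"
    then show "(a, s' a) \<in> merge_rel (orbit_rel A s) x y"
      using s' step[of a] step[OF xy(1)] step[OF xy(2)] xy_merge equiv_sym[OF E xy_merge] equiv_trans[OF E]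
      by metis
  qed
  show "merge_rel (orbit_rel A s) x y \<subseteq> orbit_rel A s'"
  proof (rule merge_subset[OF equiv_orbit_rel equiv_orbit_rel])
    note xy' = swap_merges[OF no]
    have step': "(a, s' a) \<in> orbit_rel A s'" if "a \<in> A" for a
      using orbit_rel_step[of a A s'] swap_inj(2) that by blast
    show "orbit_rel A s \<subseteq> orbit_rel A s'"
      unfolding orbit_rel_def[of A s]
    proof (rule eqv_gen_subset[OF equiv_orbit_rel], clarify)
      fix a assume "a \<in> A"
      then show "(a, s a) \<in> orbit_rel A s'"
        using s' step'[of a] step'[OF xy(1)] step'[OF xy(2)] xy' equiv_sym[OF equiv_orbit_rel xy']
          equiv_trans[OF equiv_orbit_rel] by metis
    qed
    show "(x, y) \<in> orbit_rel A s'" by (rule xy')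
  qed
qed

end

section \<open>Orientation of the arcs by the checkerboard coloring\<close>

definition mate :: "bool \<Rightarrow> nat \<Rightarrow> nat"
  where "mate b k = (if b then 3 - k else if even k then k + 1 else k - 1)"

lemma less_four_cases: "(k::nat) < 4 \<Longrightarrow> k = 0 \<or> k = 1 \<or> k = 2 \<or> k = 3"
  by auto

text \<open>\<open>mate_opposite\<close> is the source of the transposition: changing the smoothing
  has the same effect as exchanging an end with the opposite one.\<close>

lemma mate_less: "k < 4 \<Longrightarrow> mate b k < 4"
  and mate_mate: "k < 4 \<Longrightarrow> mate b (mate b k) = k"
  and mate_parity: "k < 4 \<Longrightarrow> even (mate b k) \<longleftrightarrow> odd k"
  and mate_opposite: "k < 2 \<Longrightarrow> mate (\<not> b) k = mate b (k + 2)" "k < 2 \<Longrightarrow> mate (\<not> b) (k + 2) = mate b k"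
  by (auto simp: mate_def dest!: less_four_cases less_2_cases split: if_splits)

lemma smoothing_pairs_mate: "(k, l) \<in> smoothing_pairs b \<Longrightarrow> k < 4 \<and> l = mate b k"
  "k < 4 \<Longrightarrow> (k, mate b k) \<in> smoothing_pairs b \<or> (mate b k, k) \<in> smoothing_pairs b"
  by (auto simp: smoothing_pairs_def mate_def dest!: less_four_cases split: if_splits)

locale checkerboard_diagram =
  fixes D :: "('c::linorder, 'a) link_diagram" and S :: "('a \<times> bool) set set"
  assumes oriented: "oriented_link_diagram D" and checkerboard: "checkerboard D S"
    and one_component: "card (diagram_components D) = 1"
begin

definition shaded :: "'a \<times> bool \<Rightarrow> bool"
  where "shaded s \<longleftrightarrow> region_rel D `` {s} \<in> S"

text \<open>With the shaded region on the left of each arc, these are the ends at which an arc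
  leaves its crossing.\<close>

definition col :: "'c \<times> nat \<Rightarrow> bool"
  where "col e \<longleftrightarrow> shaded (ccw_side D e)"

lemma finite_A: "finite (arcs D)" and finite_E: "finite (crossings D)"
  using oriented by (auto simp: oriented_link_diagram_def)

lemma arc_at_in: "c \<in> crossings D \<Longrightarrow> k < 4 \<Longrightarrow> arc_at D (c, k) \<in> arcs D"
  using oriented by (auto simp: oriented_link_diagram_def arc_ends_def)

lemma shaded_flip: "a \<in> arcs D \<Longrightarrow> shaded (a, \<not> b) \<longleftrightarrow> \<not> shaded (a, b)"
  using checkerboard by (cases b) (auto simp: checkerboard_def shaded_def)

lemma equiv_region: "equiv (arcs D \<times> UNIV) (region_rel D)"
  unfolding region_rel_def by (rule equiv_eqv_gen)

lemma shaded_cong: "(s, t) \<in> region_rel D \<Longrightarrow> shaded s \<longleftrightarrow> shaded t"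
  unfolding shaded_def using equiv_class_eq[OF equiv_region] by metis

lemma corner_step:
  "c \<in> crossings D \<Longrightarrow> k < 4 \<Longrightarrow> (ccw_side D (c, k), cw_side D (c, (k + 1) mod 4)) \<in> region_rel D"
  unfolding region_rel_def
  by (rule eqv_gen_base) (auto simp: ccw_side_def cw_side_def arc_at_in)

lemma shaded_cw: "c \<in> crossings D \<Longrightarrow> k < 4 \<Longrightarrow> shaded (cw_side D (c, k)) \<longleftrightarrow> \<not> col (c, k)"
  unfolding col_def ccw_side_def cw_side_def by (rule shaded_flip) (rule arc_at_in)

text \<open>One corner lies between the ends k and k + 1, and crossing the arc at end k + 1 changes
  the shading.\<close>

lemma col_alternates: "c \<in> crossings D \<Longrightarrow> k < 4 \<Longrightarrow> col (c, (k + 1) mod 4) \<longleftrightarrow> \<not> col (c, k)"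
  using shaded_cong[OF corner_step[of c k]] shaded_cw[of c "(k + 1) mod 4"] by (auto simp: col_def)

lemma col_parity:
  assumes "c \<in> crossings D" "k < 4"
  shows "col (c, k) \<longleftrightarrow> (col (c, 0) \<longleftrightarrow> even k)"
proof -
  have "col (c, 1) \<longleftrightarrow> \<not> col (c, 0)" using col_alternates[OF assms(1), of 0] by simp
  moreover have "col (c, 2) \<longleftrightarrow> \<not> col (c, 1)"
    using col_alternates[OF assms(1), of 1] by (simp add: numeral_2_eq_2)
  moreover have "col (c, 3) \<longleftrightarrow> \<not> col (c, 2)" using col_alternates[OF assms(1), of 2] by simp
  ultimately show ?thesis using less_four_cases[OF assms(2)] by (elim disjE) simp_all
qed

lemma ends_ex1:
  assumes e: "e \<in> arc_ends D"
  shows "\<exists>!d. d \<in> arc_ends D \<and> arc_at D d = arc_at D e \<and> outgoing D d"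
    "\<exists>!d. d \<in> arc_ends D \<and> arc_at D d = arc_at D e \<and> \<not> outgoing D d"
proof -
  have a: "arc_at D e \<in> arcs D" using e arc_at_in by (auto simp: arc_ends_def)
  have "{d \<in> arc_ends D. arc_at D d = arc_at D e} \<noteq> {}" using e by blast
  then show "\<exists>!d. d \<in> arc_ends D \<and> arc_at D d = arc_at D e \<and> outgoing D d"
    "\<exists>!d. d \<in> arc_ends D \<and> arc_at D d = arc_at D e \<and> \<not> outgoing D d"
    using oriented a by (auto simp: oriented_link_diagram_def)
qed

lemma end_unique:
  assumes e: "e \<in> arc_ends D" "e' \<in> arc_ends D" "arc_at D e = arc_at D e'" "col e = col e'"
  shows "e = e'"
proof -
  have a: "arc_at D e \<in> arcs D" using e(1) arc_at_in by (auto simp: arc_ends_def)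
  have "shaded (arc_at D e, outgoing D e) \<longleftrightarrow> shaded (arc_at D e, outgoing D e')"
    using e(3,4) by (simp add: col_def ccw_side_def)
  then have o: "outgoing D e = outgoing D e'" 
    using shaded_flip[OF a, of True] by (cases "outgoing D e"; cases "outgoing D e'") simp_all
  show ?thesis using ends_ex1[OF e(1)] e(1-3) o by metis
qed

lemma end_exists:
  assumes e: "e \<in> arc_ends D"
  shows "\<exists>e'\<in>arc_ends D. arc_at D e' = arc_at D e \<and> \<not> col e'"
proof -
  have a: "arc_at D e \<in> arcs D" using e arc_at_in by (auto simp: arc_ends_def)
  have "\<exists>d. d \<in> arc_ends D \<and> arc_at D d = arc_at D e \<and> outgoing D d"
    "\<exists>d. d \<in> arc_ends D \<and> arc_at D d = arc_at D e \<and> \<not> outgoing D d"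
    using ends_ex1[OF e] by blast+
  then obtain d d' where d: "d \<in> arc_ends D" "arc_at D d = arc_at D e" "outgoing D d"
    and d': "d' \<in> arc_ends D" "arc_at D d' = arc_at D e" "\<not> outgoing D d'" by blast
  have "col d \<longleftrightarrow> shaded (arc_at D e, True)" "col d' \<longleftrightarrow> shaded (arc_at D e, False)"
    using d d' by (simp_all add: col_def ccw_side_def)
  then have "\<not> col d \<or> \<not> col d'" using shaded_flip[OF a, of True] by simp
  then show ?thesis using d d' by blast
qed

text \<open>
  Oriented with the shaded region on its left, each arc ends where its counterclockwise side is not
  shaded. These orientations are preserved by every smoothing, so its circles are the orbits of a
  permutation of the arcs.
\<close>

definition head :: "'a \<Rightarrow> 'c \<times> nat"
  where "head a = (THE e. e \<in> arc_ends D \<and> arc_at D e = a \<and> \<not> col e)"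

text \<open>A circle without crossings is made a fixed point, so that it forms an orbit of its
  own.\<close>

definition succ :: "'c set \<Rightarrow> 'a \<Rightarrow> 'a"
  where "succ B a = (if \<exists>e\<in>arc_ends D. arc_at D e = a
    then (case head a of (c, k) \<Rightarrow> arc_at D (c, mate (c \<in> B) k)) else a)"

lemma head_eq: "e \<in> arc_ends D \<Longrightarrow> \<not> col e \<Longrightarrow> head (arc_at D e) = e"
  unfolding head_def by (rule the_equality) (use end_unique in blast)+

lemma succ_arc_at:
  "c \<in> crossings D \<Longrightarrow> k < 4 \<Longrightarrow> \<not> col (c, k) \<Longrightarrow>
    succ B (arc_at D (c, k)) = arc_at D (c, mate (c \<in> B) k)"
  using head_eq[of "(c, k)"] by (auto simp: succ_def arc_ends_def)

lemma arc_cases: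
  assumes "a \<in> arcs D"
  obtains (circle) "\<And>B. succ B a = a" "\<forall>e\<in>arc_ends D. arc_at D e \<noteq> a"
  | (strand) c k where "c \<in> crossings D" "k < 4" "\<not> col (c, k)" "a = arc_at D (c, k)"
proof (cases "\<exists>e\<in>arc_ends D. arc_at D e = a")
  case True
  then obtain e where "e \<in> arc_ends D" "arc_at D e = a" "\<not> col e" using end_exists by metis
  then show ?thesis using strand[of "fst e" "snd e"] by (auto simp: arc_ends_def)
qed (use circle in \<open>simp add: succ_def\<close>)

lemma col_mate: "c \<in> crossings D \<Longrightarrow> k < 4 \<Longrightarrow> col (c, mate b k) \<longleftrightarrow> \<not> col (c, k)"
  using col_parity[of c k] col_parity[of c "mate b k"] mate_less[of k b] mate_parity[of k b] by auto

lemma succ_in: "succ B ` arcs D \<subseteq> arcs D"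
proof clarify
  fix a assume a: "a \<in> arcs D"
  then show "succ B a \<in> arcs D"
    by (cases rule: arc_cases) (auto simp: succ_arc_at arc_at_in mate_less a)
qed

lemma succ_inj: "inj_on (succ B) (arcs D)"
proof (rule inj_onI)
  fix a b assume ab: "a \<in> arcs D" "b \<in> arcs D" "succ B a = succ B b"
  have mixed: False if "\<forall>e\<in>arc_ends D. arc_at D e \<noteq> a" "succ B a = a"
    "c \<in> crossings D" "k < 4" "\<not> col (c, k)" "b = arc_at D (c, k)" "succ B a = succ B b" for a b c k
  proof -
    have "a = arc_at D (c, mate (c \<in> B) k)" using that succ_arc_at by metis
    moreover have "(c, mate (c \<in> B) k) \<in> arc_ends D" using that mate_less by (simp add: arc_ends_def)
    ultimately show False using that(1) by blast
  qed
  from ab(1) show "a = b"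
  proof (cases rule: arc_cases)
    case circle
    from ab(2) show ?thesis
    proof (cases rule: arc_cases)
      case (strand c k)
      then show ?thesis using mixed[of a c k b] circle ab(3) by blast
    qed (use circle ab(3) in simp)
  next
    case a: (strand c k)
    from ab(2) show ?thesis
    proof (cases rule: arc_cases)
      case circle
      then show ?thesis using mixed[of b c k a] a ab(3) by simp
    next
      case b: (strand c' k')
      have "(c, mate (c \<in> B) k) = (c', mate (c' \<in> B) k')"
      proof (rule end_unique)
        show "arc_at D (c, mate (c \<in> B) k) = arc_at D (c', mate (c' \<in> B) k')"
          using ab(3) a b succ_arc_at by metis
      qed (use a b mate_less col_mate in \<open>auto simp: arc_ends_def\<close>)
      then show ?thesis using a b mate_mate by (metis prod.inject)
    qed
  qed
qed

text \<open>Both smoothings join an end where an arc enters the crossing to one where an arc leaves,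
  so each smoothing pair is a step of \<open>succ\<close> in one of the two directions.\<close>

lemma smoothing_rel_orbit: "smoothing_rel D B = orbit_rel (arcs D) (succ B)"
proof (rule equalityI)
  show "smoothing_rel D B \<subseteq> orbit_rel (arcs D) (succ B)"
    unfolding smoothing_rel_def
  proof (rule eqv_gen_subset[OF equiv_orbit_rel], clarify)
    fix c k l assume c: "c \<in> crossings D" and kl: "(k, l) \<in> smoothing_pairs (c \<in> B)"
    have k: "k < 4" "l = mate (c \<in> B) k" using smoothing_pairs_mate(1)[OF kl] by auto
    then have l: "l < 4" "k = mate (c \<in> B) l" using mate_less mate_mate by auto
    have step: "(a, succ B a) \<in> orbit_rel (arcs D) (succ B)" if "a \<in> arcs D" for a
      using orbit_rel_step[of a "arcs D" "succ B"] succ_in that by blast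
    show "(arc_at D (c, k), arc_at D (c, l)) \<in> orbit_rel (arcs D) (succ B)"
    proof (cases "col (c, k)")
      case False
      then show ?thesis using step[OF arc_at_in[OF c k(1)]] succ_arc_at[OF c k(1) False] k(2) by simp
    next
      case True
      then have "\<not> col (c, l)" using col_mate[OF c k(1)] k(2) by simp
      then show ?thesis
        using step[OF arc_at_in[OF c l(1)]] succ_arc_at[OF c l(1)] l(2) equiv_sym[OF equiv_orbit_rel] by metis
    qed
  qed
  show "orbit_rel (arcs D) (succ B) \<subseteq> smoothing_rel D B"
    unfolding orbit_rel_def
  proof (rule eqv_gen_subset)
    show E: "equiv (arcs D) (smoothing_rel D B)" unfolding smoothing_rel_def by (rule equiv_eqv_gen)
    show "{(a, succ B a) |a. a \<in> arcs D} \<subseteq> smoothing_rel D B"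
    proof clarify
      fix a assume a: "a \<in> arcs D"
      then show "(a, succ B a) \<in> smoothing_rel D B"
      proof (cases rule: arc_cases)
        case circle
        then show ?thesis using equiv_refl[OF E a] by simp
      next
        case (strand c k)
        have pair: "(arc_at D (c, k), arc_at D (c, l)) \<in> smoothing_rel D B"
          if "(k, l) \<in> smoothing_pairs (c \<in> B)" "k < 4" "l < 4" for k l
          unfolding smoothing_rel_def
          by (rule eqv_gen_base) (use that strand(1) arc_at_in in auto)
        show ?thesis
          using smoothing_pairs_mate(2)[OF strand(2), of "c \<in> B"] pair[of k "mate (c \<in> B) k"]
            equiv_sym[OF E pair[of "mate (c \<in> B) k" k]] strand mate_less succ_arc_at by metis
      qed
    qed
  qed
qed

text \<open>\<open>x c\<close> and \<open>y c\<close> are the arcs entering the crossing. The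
  entering ends are opposite each other, so the shading at end 0 decides between the even and the
  odd ones.\<close>

definition x :: "'c \<Rightarrow> 'a"
  where "x c = arc_at D (c, if col (c, 0) then 1 else 0)"

definition y :: "'c \<Rightarrow> 'a"
  where "y c = arc_at D (c, if col (c, 0) then 3 else 2)"

lemma end_xy: "c \<in> crossings D \<Longrightarrow> k < 4 \<Longrightarrow> \<not> col (c, k) \<Longrightarrow> arc_at D (c, k) \<in> {x c, y c}"
  using col_parity[of c k] less_four_cases[of k] by (auto simp: x_def y_def)

lemma xy_not_col:
  assumes "c \<in> crossings D"
  shows "\<not> col (c, if col (c, 0) then 1 else 0)" "\<not> col (c, if col (c, 0) then 3 else 2)"
  using col_parity[OF assms, of 1] col_parity[OF assms, of 2] col_parity[OF assms, of 3] by auto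

lemma x_in: "c \<in> crossings D \<Longrightarrow> x c \<in> arcs D" and y_in: "c \<in> crossings D \<Longrightarrow> y c \<in> arcs D"
  by (auto simp: x_def y_def arc_at_in)

lemma xy_neq: "c \<in> crossings D \<Longrightarrow> x c \<noteq> y c"
  using end_unique[of "(c, if col (c, 0) then 1 else 0)" "(c, if col (c, 0) then 3 else 2)"] xy_not_col[of c]
  by (auto simp: x_def y_def arc_ends_def split: if_splits)

lemma succ_flip:
  assumes c: "c \<in> crossings D"
  shows "succ (flip c B) (x c) = succ B (y c)" "succ (flip c B) (y c) = succ B (x c)"
    "a \<noteq> x c \<Longrightarrow> a \<noteq> y c \<Longrightarrow> succ (flip c B) a = succ B a"
proof -
  have xy: "succ B (x c) = arc_at D (c, mate (c \<in> B) (if col (c, 0) then 1 else 0))"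
    "succ B (y c) = arc_at D (c, mate (c \<in> B) (if col (c, 0) then 3 else 2))" for B
    unfolding x_def y_def using succ_arc_at[OF c _ xy_not_col(1)[OF c]] succ_arc_at[OF c _ xy_not_col(2)[OF c]]
    by (auto split: if_splits)
  have "c \<in> flip c B \<longleftrightarrow> c \<notin> B" by (simp add: flip_def)
  then show "succ (flip c B) (x c) = succ B (y c)" "succ (flip c B) (y c) = succ B (x c)"
    using mate_opposite[of 0 "c \<in> B"] mate_opposite[of 1 "c \<in> B"]
    unfolding xy by (auto simp: numeral_2_eq_2 numeral_3_eq_3)
  assume a: "a \<noteq> x c" "a \<noteq> y c"
  show "succ (flip c B) a = succ B a"
  proof (cases "\<exists>e\<in>arc_ends D. arc_at D e = a")
    case True
    then obtain c' k where e: "(c', k) \<in> arc_ends D" "arc_at D (c', k) = a" "\<not> col (c', k)"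
      using end_exists by (metis surj_pair)
    then have "c' \<in> crossings D" "k < 4" by (auto simp: arc_ends_def)
    moreover have "c' \<noteq> c" using end_xy[of c k] e a calculation by auto
    ultimately show ?thesis using succ_arc_at[of c' k] e by (auto simp: flip_def)
  qed (simp add: succ_def)
qed

lemma component_full: "eqv_gen (arcs D)
    {(arc_at D (c, k), arc_at D (c, l)) | c k l. c \<in> crossings D \<and> k < 4 \<and> l < 4} = arcs D \<times> arcs D"
    (is "?W = _")
proof -
  have E: "equiv (arcs D) ?W" by (rule equiv_eqv_gen)
  have "arcs D \<noteq> {}" using one_component by (auto simp: diagram_components_def quotient_def)
  then show ?thesis
    using card_quotient_1_iff[OF E] one_component by (simp add: diagram_components_def)
qed

text \<open>A change at c exchanges the successors of \<open>x c\<close> and \<open>y c\<close>, so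
  the transposition lemmas apply. For connectedness, any smoothing joins each leaving end to an
  entering one, so relating \<open>x c\<close> to \<open>y c\<close> relates all four ends.\<close>

sublocale smoothing_cube D x y
proof
  show "finite (crossings D)" "finite (arcs D)" using finite_A finite_E by auto
  show "arcs D \<noteq> {}"
    using one_component by (auto simp: diagram_components_def quotient_def)
next
  fix c assume "c \<in> crossings D"
  then show "x c \<in> arcs D" "y c \<in> arcs D" using x_in y_in by auto
next
  fix B c assume B: "B \<subseteq> crossings D" and c: "c \<in> crossings D"
  note swap = finite_A succ_inj succ_in x_in[OF c] y_in[OF c] xy_neq[OF c] succ_flip[OF c]
  show "(x c, y c) \<in> smoothing_rel D B \<longleftrightarrow> (x c, y c) \<notin> smoothing_rel D (flip c B)"
    unfolding smoothing_rel_orbit using swap_splits[OF swap] swap_merges[OF swap] by blast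
  show "(x c, y c) \<notin> smoothing_rel D B \<Longrightarrow>
      smoothing_rel D (flip c B) = merge_rel (smoothing_rel D B) (x c) (y c)"
    unfolding smoothing_rel_orbit by (rule swap_merge_rel[OF swap])
next
  fix B Q assume B: "B \<subseteq> crossings D" and Q: "equiv (arcs D) Q" "smoothing_rel D B \<subseteq> Q"
    and xy: "\<And>c. c \<in> crossings D \<Longrightarrow> (x c, y c) \<in> Q"
  have "(x c, arc_at D (c, k)) \<in> Q" if ck: "c \<in> crossings D" "k < 4" for c k
  proof -
    have near: "(x c, arc_at D (c, l)) \<in> Q" if "l < 4" "\<not> col (c, l)" for l
      using end_xy[OF ck(1) that] xy[OF ck(1)] equiv_refl[OF Q(1) x_in[OF ck(1)]] by auto
    show ?thesis
    proof (cases "col (c, k)")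
      case True
      let ?l = "mate (c \<in> B) k"
      have l: "?l < 4" "\<not> col (c, ?l)" using mate_less[OF ck(2)] col_mate[OF ck] True by auto
      have "(arc_at D (c, ?l), succ B (arc_at D (c, ?l))) \<in> smoothing_rel D B"
        unfolding smoothing_rel_orbit
        using arc_at_in[OF ck(1) l(1)] succ_in[of B] by (intro orbit_rel_step) auto
      then have "(arc_at D (c, ?l), arc_at D (c, k)) \<in> Q"
        using succ_arc_at[OF ck(1) l] mate_mate[OF ck(2)] Q(2) by auto
      then show ?thesis using near[OF l] equiv_trans[OF Q(1)] by blast
    qed (use near ck in blast)
  qed
  note star = this
  have "(arc_at D (c, k), arc_at D (c, l)) \<in> Q" if ckl: "c \<in> crossings D" "k < 4" "l < 4" for c k l
    by (rule equiv_trans[OF Q(1) equiv_sym[OF Q(1) star[OF ckl(1,2)]] star[OF ckl(1,3)]])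
  then have "{(arc_at D (c, k), arc_at D (c, l)) | c k l. c \<in> crossings D \<and> k < 4 \<and> l < 4} \<subseteq> Q"
    by auto
  from eqv_gen_subset[OF Q(1) this] have "arcs D \<times> arcs D \<subseteq> Q" unfolding component_full .
  then show "Q = arcs D \<times> arcs D" using equiv_type[OF Q(1)] by blast
qed

end

section \<open>Spanning trees and activities\<close>

text \<open>Naming the ends of an edge as u and v treats loops, where both agree, and proper edges
  alike.\<close>

locale finite_graph =
  fixes G :: "('v, 'e) signed_graph" and u v :: "'e \<Rightarrow> 'v"
  assumes finite_verts: "finite (verts G)" and finite_edges: "finite (edges G)"
    and verts_nonempty: "verts G \<noteq> {}"
    and ends: "e \<in> edges G \<Longrightarrow> ends_of G e = {u e, v e}"
    and u_vert: "e \<in> edges G \<Longrightarrow> u e \<in> verts G" and v_vert: "e \<in> edges G \<Longrightarrow> v e \<in> verts G"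
begin

definition conn :: "'e set \<Rightarrow> 'v rel"
  where "conn T = eqv_gen (verts G) {(a, b). \<exists>e\<in>T. ends_of G e = {a, b}}"

abbreviation num_components :: "'e set \<Rightarrow> nat"
  where "num_components T \<equiv> card (graph_components G T)"

lemma graph_components_eq: "graph_components G T = verts G // conn T"
  by (simp add: graph_components_def conn_def)

lemma equiv_conn: "equiv (verts G) (conn T)"
  unfolding conn_def by (rule equiv_eqv_gen)

lemmas conn_refl = equiv_refl[OF equiv_conn] and conn_sym = equiv_sym[OF equiv_conn]
  and conn_trans = equiv_trans[OF equiv_conn] and conn_in = equiv_in[OF equiv_conn]

lemma conn_edge:
  assumes "e \<in> T" "e \<in> edges G" "ends_of G e = {a, b}"
  shows "(a, b) \<in> conn T"
proof -
  have "{a, b} = {u e, v e}" using assms(3) ends[OF assms(2)] by simp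
  then have "a \<in> verts G" "b \<in> verts G"
    using u_vert[OF assms(2)] v_vert[OF assms(2)] by (auto simp: doubleton_eq_iff)
  then show ?thesis unfolding conn_def using assms by (intro eqv_gen_base) auto
qed

lemma conn_insert:
  assumes T: "T \<subseteq> edges G" and e: "e \<in> edges G"
  shows "conn (insert e T) = merge_rel (conn T) (u e) (v e)"
proof (rule equalityI)
  let ?M = "merge_rel (conn T) (u e) (v e)"
  note uv = u_vert[OF e] v_vert[OF e]
  note M = equiv_merge[OF equiv_conn uv]
  have uv_M: "(u e, v e) \<in> ?M" using conn_refl uv by (auto simp: merge_rel_def)
  show "conn (insert e T) \<subseteq> ?M"
    unfolding conn_def[of "insert e T"]
  proof (rule eqv_gen_subset[OF M], clarify)
    fix a b f assume f: "f \<in> insert e T" "ends_of G f = {a, b}"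
    show "(a, b) \<in> ?M"
    proof (cases "f = e")
      case True
      then have "a = u e \<and> b = v e \<or> a = v e \<and> b = u e" using f ends[OF e] by (auto simp: doubleton_eq_iff)
      then show ?thesis using uv_M equiv_sym[OF M uv_M] by auto
    next
      case False
      then have "(a, b) \<in> conn T" using conn_edge[of f T a b] f T by blast
      then show ?thesis using subset_merge by (rule subsetD[rotated])
    qed
  qed
  show "?M \<subseteq> conn (insert e T)"
  proof (rule merge_subset[OF equiv_conn equiv_conn])
    show "conn T \<subseteq> conn (insert e T)"
      unfolding conn_def[of T]
      by (rule eqv_gen_subset[OF equiv_conn]) (use conn_edge[of _ "insert e T"] T in blast)
    show "(u e, v e) \<in> conn (insert e T)" by (rule conn_edge) (use e ends in auto)
  qed
qed

lemma num_components_insert: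
  assumes "T \<subseteq> edges G" "e \<in> edges G"
  shows "(u e, v e) \<in> conn T \<Longrightarrow> num_components (insert e T) = num_components T"
    "(u e, v e) \<notin> conn T \<Longrightarrow> num_components T = num_components (insert e T) + 1"
  unfolding graph_components_eq conn_insert[OF assms]
  using merge_absorb[OF equiv_conn] card_quotient_merge[OF equiv_conn] u_vert v_vert assms finite_verts
  by auto

lemma num_components_empty: "num_components {} = card (verts G)"
proof -
  have "conn {} = Id_on (verts G)" by (auto simp: conn_def eqv_gen_def)
  then have "graph_components G {} = (\<lambda>a. {a}) ` verts G"
    by (auto simp: graph_components_eq quotient_def)
  then show ?thesis by (simp add: card_image inj_on_def)
qed

lemma finite_subset_edges: "T \<subseteq> edges G \<Longrightarrow> finite T"
  by (rule finite_subset[OF _ finite_edges])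

lemma card_verts_le:
  assumes "T \<subseteq> edges G"
  shows "card (verts G) \<le> num_components T + card T"
  using finite_subset_edges[OF assms] assms
proof (induction T)
  case (insert e T)
  then show ?case using num_components_insert[of T e] by (cases "(u e, v e) \<in> conn T") auto
qed (simp add: num_components_empty)

lemma num_components_pos: "num_components T > 0"
proof -
  have "finite (graph_components G T)"
    unfolding graph_components_eq using finite_verts equiv_type[OF equiv_conn] by (rule finite_quotient)
  moreover have "graph_components G T \<noteq> {}"
    using verts_nonempty by (auto simp: graph_components_eq quotient_def)
  ultimately show ?thesis by (simp add: card_gt_0_iff)
qed

lemma num_components_1_iff: "num_components T = 1 \<longleftrightarrow> conn T = verts G \<times> verts G"
  unfolding graph_components_eq by (rule card_quotient_1_iff[OF equiv_conn verts_nonempty])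

text \<open>A walk that returns to a visited vertex is cut back to that visit; distinct vertices are
  what \<open>is_cycle\<close> demands.\<close>

lemma conn_path:
  assumes T: "T \<subseteq> edges G" and ab: "(a, b) \<in> conn T"
  shows "\<exists>xs. xs \<noteq> [] \<and> hd xs = a \<and> last xs = b \<and> distinct xs \<and> set xs \<subseteq> verts G \<and>
    (\<forall>i. Suc i < length xs \<longrightarrow> (\<exists>e\<in>T. ends_of G e = {xs ! i, xs ! Suc i}))"
    (is "\<exists>xs. ?path xs b")
proof -
  let ?r = "{(a, b). \<exists>e\<in>T. ends_of G e = {a, b}}"
  have "(a, b) \<in> (?r \<union> ?r\<inverse>)\<^sup>*" "a \<in> verts G"
    using ab by (auto simp: conn_def eqv_gen_def)
  then show ?thesis
  proof (induction rule: rtrancl_induct)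
    case base
    then have "?path [a] a" by simp
    then show ?case ..
  next
    case (step b c)
    obtain xs where xs: "?path xs b" using step by blast
    obtain e where e: "e \<in> T" "ends_of G e = {b, c}" using step(2) by (auto simp: insert_commute)
    have c: "c \<in> verts G" using conn_in(2)[OF conn_edge[OF e(1) _ e(2)]] e(1) T by blast
    show ?case
    proof (cases "c \<in> set xs")
      case True
      then obtain ys zs where yz: "xs = ys @ c # zs" by (auto simp: in_set_conv_decomp)
      have "\<exists>e\<in>T. ends_of G e = {(ys @ [c]) ! i, (ys @ [c]) ! Suc i}" if "Suc i < length (ys @ [c])" for i
      proof -
        have "(ys @ [c]) ! j = xs ! j" if "j < Suc (length ys)" for j
          using that by (auto simp: yz nth_append)
        moreover have "Suc i < length xs" using that by (simp add: yz)
        ultimately show ?thesis using xs that by simp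
      qed
      moreover have "hd (ys @ [c]) = a" using xs by (cases ys) (auto simp: yz)
      ultimately have "?path (ys @ [c]) c" using xs by (simp add: yz)
      then show ?thesis ..
    next
      case False
      have "\<exists>e\<in>T. ends_of G e = {(xs @ [c]) ! i, (xs @ [c]) ! Suc i}" if i: "Suc i < length (xs @ [c])" for i
      proof (cases "Suc i < length xs")
        case True
        then show ?thesis using xs by (simp add: nth_append)
      next
        case False
        then have "i = length xs - 1" "Suc i = length xs" using i by simp_all
        then have "(xs @ [c]) ! i = b" "(xs @ [c]) ! Suc i = c"
          using xs last_conv_nth[of xs] by (auto simp: nth_append)
        then show ?thesis using e by metis
      qed
      then have "?path (xs @ [c]) c" using xs False c by (simp add: hd_append)
      then show ?thesis ..
    qed
  qed
qed

text \<open>The edge closes a simple path between its ends. On a simple path the pair of ends of an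
  edge determines its position, so the edges are distinct; for a loop the path has a single
  vertex.\<close>

lemma cycle_through:
  assumes T: "T \<subseteq> edges G" and e: "e \<in> edges G" "e \<notin> T" "(u e, v e) \<in> conn T"
  shows "\<exists>C. is_cycle G C \<and> e \<in> C \<and> C \<subseteq> insert e T"
proof -
  obtain xs where xs: "xs \<noteq> []" "hd xs = u e" "last xs = v e" "distinct xs" "set xs \<subseteq> verts G"
    "\<forall>i. Suc i < length xs \<longrightarrow> (\<exists>f\<in>T. ends_of G f = {xs ! i, xs ! Suc i})"
    using conn_path[OF T e(3)] by blast
  define n where "n = length xs - 1"
  have len: "length xs = Suc n" using xs(1) by (simp add: n_def)
  obtain f where f: "\<And>i. i < n \<Longrightarrow> f i \<in> T \<and> ends_of G (f i) = {xs ! i, xs ! Suc i}"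
    using xs(6) unfolding len by (metis Suc_less_eq)
  have inj: "inj_on f {..<n}"
  proof (rule inj_onI)
    fix i j assume ij: "i \<in> {..<n}" "j \<in> {..<n}" "f i = f j"
    then have "{xs ! i, xs ! Suc i} = {xs ! j, xs ! Suc j}" using f by (metis lessThan_iff)
    moreover have "xs ! k = xs ! l \<longleftrightarrow> k = l" if "k \<le> n" "l \<le> n" for k l
      using nth_eq_iff_index_eq[OF xs(4), of k l] that len by simp
    ultimately show "i = j" using ij by (auto simp: doubleton_eq_iff)
  qed
  let ?es = "map f [0..<n] @ [e]"
  have "is_cycle G (set ?es)"
    unfolding is_cycle_def
  proof (intro exI conjI allI impI)
    show "?es \<noteq> []" "length xs = length ?es" by (simp_all add: len)
    have "distinct (map f [0..<n])" using inj by (simp add: distinct_map atLeast0LessThan)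
    moreover have "e \<notin> set (map f [0..<n])" using f e(2) by auto
    ultimately show "distinct ?es" by simp
    show "set ?es \<subseteq> edges G" using f T e(1) by auto
    fix i assume "i < length ?es"
    then have i: "i \<le> n" by simp
    show "ends_of G (?es ! i) = {xs ! i, xs ! (Suc i mod length ?es)}"
    proof (cases "i = n")
      case True
      have "xs ! n = v e" "xs ! 0 = u e" using xs(1-3) len by (simp_all add: last_conv_nth hd_conv_nth)
      then show ?thesis using True ends[OF e(1)] by (auto simp: nth_append)
    next
      case False
      then show ?thesis using i f[of i] by (simp add: nth_append)
    qed
  qed (use xs in auto)
  moreover have "e \<in> set ?es" "set ?es \<subseteq> insert e T" using f by auto
  ultimately show ?thesis by blast
qed

text \<open>Start behind f and go around: after n - 1 steps the walk reaches the other end of f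
  without having used f.\<close>

lemma cycle_edge_conn:
  assumes T: "T \<subseteq> edges G" and C: "is_cycle G C" "C \<subseteq> T" "f \<in> C"
  shows "(u f, v f) \<in> conn (T - {f})"
proof -
  obtain xs es where es: "es \<noteq> []" "length xs = length es" "distinct xs" "distinct es"
    "set xs \<subseteq> verts G" "set es \<subseteq> edges G" "set es = C"
    "\<forall>i < length es. ends_of G (es ! i) = {xs ! i, xs ! (Suc i mod length es)}"
    using C(1) unfolding is_cycle_def by blast
  define n where "n = length es"
  have n: "n > 0" using es(1) by (simp add: n_def)
  obtain j where j: "j < n" "f = es ! j" using C(3) es(7) by (metis in_set_conv_nth n_def)
  have walk: "i < n \<Longrightarrow> (xs ! (Suc j mod n), xs ! ((Suc j + i) mod n)) \<in> conn (T - {f})" for i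
  proof (induction i)
    case 0
    have "xs ! (Suc j mod n) \<in> verts G" using n es(2,5) by (metis mod_less_divisor n_def nth_mem subsetD)
    then show ?case using conn_refl by simp
  next
    case (Suc i)
    let ?k = "(Suc j + i) mod n"
    have k: "?k < n" using n by simp
    have "?k \<noteq> j"
    proof (cases "Suc j + i < n")
      case False
      then have "?k = Suc j + i - n" using j(1) Suc(2) by (simp add: le_mod_geq)
      then show ?thesis using False Suc(2) by simp
    qed simp
    then have ne: "es ! ?k \<noteq> f" using j k es(4) by (simp add: nth_eq_iff_index_eq n_def)
    have "es ! ?k \<in> C" using k es(7) nth_mem n_def by metis
    then have *: "es ! ?k \<in> T - {f}" using C(2) ne by blast
    have "ends_of G (es ! ?k) = {xs ! ?k, xs ! (Suc ?k mod n)}" using es(8) k n_def by simp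
    then have "(xs ! ?k, xs ! (Suc ?k mod n)) \<in> conn (T - {f})"
      using conn_edge[OF *] * T by blast
    moreover have "Suc ?k mod n = (Suc j + Suc i) mod n" by (simp add: mod_Suc_eq)
    ultimately show ?case using Suc conn_trans by (metis Suc_lessD)
  qed
  have "(Suc j + (n - 1)) mod n = j" using j n by simp
  then have "(xs ! (Suc j mod n), xs ! j) \<in> conn (T - {f})" using walk[of "n - 1"] n by simp
  moreover have "f \<in> edges G" using C T by blast
  then have "{u f, v f} = {xs ! j, xs ! (Suc j mod n)}" using es(8) j ends by (metis n_def)
  ultimately show ?thesis using conn_sym by (auto simp: doubleton_eq_iff)
qed

text \<open>An edge that closes no cycle joins two components. Conversely a cycle edge can be
  removed without changing the components, and equality would then violate
  \<open>card_verts_le\<close> for the smaller set.\<close>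

lemma acyclic_iff:
  assumes "T \<subseteq> edges G"
  shows "(\<forall>C\<subseteq>T. \<not> is_cycle G C) \<longleftrightarrow> num_components T + card T = card (verts G)"
proof
  assume "\<forall>C\<subseteq>T. \<not> is_cycle G C"
  with finite_subset_edges[OF assms] assms show "num_components T + card T = card (verts G)"
  proof (induction T)
    case (insert e T)
    have "(u e, v e) \<notin> conn T"
      using cycle_through[of T e] insert by blast
    then have "num_components T = num_components (insert e T) + 1"
      using num_components_insert(2)[of T e] insert by blast
    moreover have "num_components T + card T = card (verts G)" using insert by blast
    ultimately show ?case using insert by simp
  qed (simp add: num_components_empty)
next
  assume eq: "num_components T + card T = card (verts G)"
  show "\<forall>C\<subseteq>T. \<not> is_cycle G C"
  proof (intro allI impI notI)
    fix C assume C: "C \<subseteq> T" "is_cycle G C"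
    then have "C \<noteq> {}" by (auto simp: is_cycle_def)
    then obtain f where f: "f \<in> C" by blast
    then have fT: "insert f (T - {f}) = T" "f \<in> edges G" using C assms by auto
    have "num_components T = num_components (T - {f})"
      using num_components_insert(1)[of "T - {f}" f] cycle_edge_conn[OF assms C(2,1) f] fT assms by auto
    moreover have "card T = Suc (card (T - {f}))"
      using finite_subset_edges[OF assms] f C by (metis card.remove subsetD)
    moreover have "card (verts G) \<le> num_components (T - {f}) + card (T - {f})"
      using assms by (intro card_verts_le) blast
    ultimately show False using eq by simp
  qed
qed

lemma spanning_tree_iff:
  "spanning_tree G T \<longleftrightarrow> T \<subseteq> edges G \<and> num_components T = 1 \<and> card T + 1 = card (verts G)"
proof (cases "T \<subseteq> edges G")
  case True
  then show ?thesis unfolding spanning_tree_def acyclic_iff[OF True] by auto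
qed (simp add: spanning_tree_def)

lemma cut_iff: 
  assumes f: "f \<in> edges G"
  shows "f \<in> cut G T e \<longleftrightarrow> (u f, v f) \<notin> conn (T - {e})"
proof
  assume "f \<in> cut G T e"
  then obtain A B a b where AB: "A \<in> graph_components G (T - {e})" "B \<in> graph_components G (T - {e})"
    "A \<noteq> B" "a \<in> A" "b \<in> B" "ends_of G f = {a, b}" by (auto simp: cut_def)
  have "(a, b) \<notin> conn (T - {e})"
    using quotient_eq_iff[OF equiv_conn, of A "T - {e}" B a b] AB by (simp add: graph_components_eq)
  then show "(u f, v f) \<notin> conn (T - {e})"
    using AB(6) ends[OF f] conn_sym by (auto simp: doubleton_eq_iff)
next
  assume uv: "(u f, v f) \<notin> conn (T - {e})"
  let ?A = "conn (T - {e}) `` {u f}" and ?B = "conn (T - {e}) `` {v f}"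
  have "?A \<in> graph_components G (T - {e})" "?B \<in> graph_components G (T - {e})"
    using u_vert[OF f] v_vert[OF f] by (simp_all add: graph_components_eq quotientI)
  moreover have "?A \<noteq> ?B" using uv u_vert[OF f] v_vert[OF f] eq_equiv_class_iff[OF equiv_conn] by simp
  moreover have "u f \<in> ?A" "v f \<in> ?B" using conn_refl u_vert[OF f] v_vert[OF f] by auto
  ultimately show "f \<in> cut G T e"
    unfolding cut_def using f ends[OF f]
    by (intro CollectI conjI bexI[of _ ?A] bexI[of _ ?B] bexI[of _ "u f"] bexI[of _ "v f"])
qed

text \<open>If f lies in \<open>T\<close> both sides fail: f itself still connects its ends, and two
  removals leave too few edges. Otherwise the two components left by e are rejoined exactly by an
  edge of the cut.\<close>

lemma spanning_tree_swap:
  assumes T: "spanning_tree G T" and e: "e \<in> T" and f: "f \<in> edges G" "f \<noteq> e"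
  shows "f \<in> cut G T e \<longleftrightarrow> spanning_tree G (flip f (flip e T))"
proof -
  have TE: "T \<subseteq> edges G" and T1: "num_components T = 1" "card T + 1 = card (verts G)"
    using T by (auto simp: spanning_tree_iff)
  note fin = finite_subset_edges[OF TE]
  have flip: "flip e T = T - {e}" using e by (simp add: flip_def)
  have cardT: "card (T - {e}) + 1 = card T" using e fin by (metis Suc_eq_plus1 card.remove)
  show ?thesis
  proof (cases "f \<in> T")
    case True
    then have "(u f, v f) \<in> conn (T - {e})" by (intro conn_edge[of f]) (use f ends in auto)
    moreover have flip2: "flip f (flip e T) = T - {e} - {f}"
      using True f(2) by (simp add: flip) (simp add: flip_def)
    moreover have "card (T - {e} - {f}) < card (T - {e})"
      using True f fin by (intro psubset_card_mono) auto
    ultimately show ?thesis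
      using True f T1 cardT flip2 by (simp add: cut_iff spanning_tree_iff)
  next
    case False
    have eE: "e \<in> edges G" "insert e (T - {e}) = T" "T - {e} \<subseteq> edges G" using e TE by auto
    have "num_components (T - {e}) = 2"
      using num_components_insert[OF eE(3,1)] card_verts_le[OF eE(3)] T1 cardT unfolding eE(2)
      by linarith
    then have "num_components (insert f (T - {e})) = 1 \<longleftrightarrow> (u f, v f) \<notin> conn (T - {e})"
      using num_components_insert[OF eE(3) f(1)] by auto
    moreover have "card (insert f (T - {e})) = card T" using False cardT fin by simp
    ultimately show ?thesis
      using False f eE T1 by (auto simp: cut_iff spanning_tree_iff flip flip_def)
  qed
qed

text \<open>Removing an edge of any one cycle in \<open>insert e T\<close> leaves a spanning tree,
  so no other cycle can avoid that edge. Hence the cycles coincide and the description by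
  \<open>THE\<close> is meaningful.\<close>

lemma cyc_unique:
  assumes T: "spanning_tree G T" and e: "e \<in> edges G" "e \<notin> T"
  shows "is_cycle G (cyc G T e)" "cyc G T e \<subseteq> insert e T"
    "f \<in> edges G \<Longrightarrow> f \<noteq> e \<Longrightarrow> f \<in> cyc G T e \<longleftrightarrow> spanning_tree G (flip f (flip e T))"
proof -
  have TE: "T \<subseteq> edges G" and T1: "num_components T = 1" "card T + 1 = card (verts G)"
    using T by (simp_all add: spanning_tree_iff)
  note fin = finite_subset_edges[OF TE]
  let ?U = "insert e T"
  have U: "?U \<subseteq> edges G" using TE e by blast
  have uv: "(u e, v e) \<in> conn T" using T1(1) u_vert v_vert e unfolding num_components_1_iff by simp
  have U1: "num_components ?U = 1" using num_components_insert(1)[OF TE e(1) uv] T1 by simp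
  have swap: "spanning_tree G (?U - {f})" if C: "is_cycle G C" "C \<subseteq> ?U" "f \<in> C" for C f
  proof -
    have f: "f \<in> edges G" "insert f (?U - {f}) = ?U" "f \<in> ?U" using C U by auto
    have "?U - {f} \<subseteq> edges G" using U by blast
    from num_components_insert(1)[OF this f(1) cycle_edge_conn[OF U C]]
    have "num_components (?U - {f}) = 1" unfolding f(2) U1 by simp
    moreover have "card (?U - {f}) = card T" using fin e f(3) by (simp add: card_Diff_singleton)
    ultimately show ?thesis using T1 U by (auto simp: spanning_tree_iff)
  qed
  have sub: "C \<subseteq> C'" if C: "is_cycle G C" "C \<subseteq> ?U" "is_cycle G C'" "C' \<subseteq> ?U" for C C'
  proof
    fix f assume f: "f \<in> C"
    have "\<not> C' \<subseteq> ?U - {f}" using swap[OF C(1,2) f] C(3) by (auto simp: spanning_tree_def)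
    then show "f \<in> C'" using C(4) by blast
  qed
  obtain C where C: "is_cycle G C" "C \<subseteq> ?U" using cycle_through[OF TE e uv] by blast
  have "cyc G T e = C"
    unfolding cyc_def by (rule the_equality) (use C sub in auto)
  then show cyc: "is_cycle G (cyc G T e)" "cyc G T e \<subseteq> insert e T" using C by auto
  assume f: "f \<in> edges G" "f \<noteq> e"
  have flip: "flip e T = ?U" using e by (simp add: flip_def)
  show "f \<in> cyc G T e \<longleftrightarrow> spanning_tree G (flip f (flip e T))"
  proof (cases "f \<in> T")
    case True
    then have "flip f (flip e T) = ?U - {f}" unfolding flip by (simp add: flip_def)
    moreover have "\<not> spanning_tree G (?U - {f})" if "f \<notin> cyc G T e"
    proof -
      have "cyc G T e \<subseteq> ?U - {f}" using cyc(2) that by blast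
      then show ?thesis using cyc(1) unfolding spanning_tree_def by blast
    qed
    ultimately show ?thesis using swap[OF cyc, of f] by metis
  next
    case False
    then have "card (flip f (flip e T)) = card T + 2"
      using f e fin by (simp add: flip) (simp add: flip_def)
    then show ?thesis using False f cyc(2) T1 by (auto simp: spanning_tree_iff)
  qed
qed

end

lemma live_iff:
  fixes G :: "('v, 'e::linorder) signed_graph"
  assumes G: "finite_graph G u v" and T: "spanning_tree G T" and e: "e \<in> edges G"
  shows "live G T e \<longleftrightarrow> (\<forall>f\<in>edges G. f < e \<longrightarrow> \<not> spanning_tree G (flip f (flip e T)))"
proof -
  interpret finite_graph G u v by (rule G)
  let ?X = "if e \<in> T then cut G T e else cyc G T e"
  have "?X \<subseteq> edges G"
    using cyc_unique(2)[OF T e] T e by (auto simp: cut_def spanning_tree_def)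
  moreover have "f \<in> ?X \<longleftrightarrow> spanning_tree G (flip f (flip e T))" if "f \<in> edges G" "f < e" for f
    using spanning_tree_swap[OF T, of e f] cyc_unique(3)[OF T e, of f] that by auto
  ultimately show ?thesis unfolding live_def Ball_def using linorder_not_less by blast
qed

section \<open>The Tait graph\<close>

lemma card_quotient_eq_card_image:
  assumes R: "equiv A R" and f: "\<And>a b. a \<in> A \<Longrightarrow> b \<in> A \<Longrightarrow> (a, b) \<in> R \<longleftrightarrow> f a = f b"
  shows "card (A // R) = card (f ` A)"
proof -
  let ?h = "\<lambda>z. {b \<in> A. z = f b}"
  have "R `` {a} = ?h (f a)" if "a \<in> A" for a
    using f[OF that] equiv_in[OF R] by blast
  then have "A // R = ?h ` f ` A" by (auto simp: quotient_def)
  moreover have "inj_on ?h (f ` A)"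
    by (rule inj_onI) blast
  ultimately show ?thesis by (simp add: card_image)
qed

locale planar_diagram = checkerboard_diagram +
  assumes euler: "card (regions D) = card (crossings D) + 2"
begin

abbreviation G where "G \<equiv> tait_graph D S"

abbreviation "pos \<equiv> pos_edges G"

text \<open>\<open>True\<close> names the left side, so the truth value of the left side being
  shaded is itself the name of the shaded side.\<close>

definition shaded_side :: "'b \<Rightarrow> 'b \<times> bool" where "shaded_side a = (a, shaded (a, True))"
definition unshaded_side :: "'b \<Rightarrow> 'b \<times> bool" where "unshaded_side a = (a, \<not> shaded (a, True))"

definition sh :: "'b \<Rightarrow> ('b \<times> bool) set" where "sh a = region_rel D `` {shaded_side a}"
definition unsh :: "'b \<Rightarrow> ('b \<times> bool) set" where "unsh a = region_rel D `` {unshaded_side a}"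

lemma shaded_iff: "a \<in> A \<Longrightarrow> shaded (a, b) \<longleftrightarrow> (b \<longleftrightarrow> shaded (a, True))"
  using shaded_flip[of a True] by (cases b) auto

lemma sides:
  assumes "c \<in> E" "k < 4"
  shows "ccw_side D (c, k) = (if col (c, k) then shaded_side (arc_at D (c, k)) else unshaded_side (arc_at D (c, k)))"
    "cw_side D (c, k) = (if col (c, k) then unshaded_side (arc_at D (c, k)) else shaded_side (arc_at D (c, k)))"
  using shaded_iff[OF arc_at_in[OF assms], of "outgoing D (c, k)"]
  by (auto simp: col_def ccw_side_def cw_side_def shaded_side_def unshaded_side_def)

lemma class_eq: "(s, t) \<in> region_rel D \<Longrightarrow> region_rel D `` {s} = region_rel D `` {t}"
  using equiv_class_eq[OF equiv_region] .

lemma sh_corner: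
  assumes "c \<in> E" "k < 4" "col (c, k)"
  shows "sh (arc_at D (c, k)) = sh (arc_at D (c, (k + 1) mod 4))"
    "corner_region D c k = sh (arc_at D (c, (k + 1) mod 4))"
proof -
  have k': "(k + 1) mod 4 < 4" by simp
  have nc: "\<not> col (c, (k + 1) mod 4)" using col_alternates[OF assms(1,2)] assms(3) by blast
  have ccw: "ccw_side D (c, k) = shaded_side (arc_at D (c, k))"
    by (simp only: sides(1)[OF assms(1,2)] if_P[OF assms(3)])
  have cw: "cw_side D (c, (k + 1) mod 4) = shaded_side (arc_at D (c, (k + 1) mod 4))"
    by (simp only: sides(2)[OF assms(1) k'] if_not_P[OF nc])
  show "sh (arc_at D (c, k)) = sh (arc_at D (c, (k + 1) mod 4))"
    using class_eq[OF corner_step[OF assms(1,2)]] unfolding ccw cw sh_def .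
  show "corner_region D c k = sh (arc_at D (c, (k + 1) mod 4))"
    using class_eq[OF corner_step[OF assms(1,2)]] unfolding cw sh_def corner_region_def .
qed

lemma unsh_corner:
  assumes "c \<in> E" "k < 4" "\<not> col (c, k)"
  shows "unsh (arc_at D (c, k)) = unsh (arc_at D (c, (k + 1) mod 4))"
proof -
  have k': "(k + 1) mod 4 < 4" by simp
  have nc: "col (c, (k + 1) mod 4)" using col_alternates[OF assms(1,2)] assms(3) by blast
  have ccw: "ccw_side D (c, k) = unshaded_side (arc_at D (c, k))"
    by (simp only: sides(1)[OF assms(1,2)] if_not_P[OF assms(3)])
  have cw: "cw_side D (c, (k + 1) mod 4) = unshaded_side (arc_at D (c, (k + 1) mod 4))"
    by (simp only: sides(2)[OF assms(1) k'] if_P[OF nc])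
  show ?thesis
    using class_eq[OF corner_step[OF assms(1,2)]] unfolding ccw cw unsh_def .
qed

lemma corner_in_iff: "corner_region D c k \<in> S \<longleftrightarrow> col (c, k)"
  by (simp add: corner_region_def col_def shaded_def)

lemma pos_eq: "pos = {c \<in> E. col (c, 1)}"
  using col_parity[of _ 1] col_parity[of _ 3] by (auto simp: tait_graph_def corner_in_iff)

lemma pos_subset: "pos \<subseteq> E"
  by (auto simp: pos_eq)

text \<open>In the state \<open>pos\<close> every strand turns around a shaded corner, so the shaded
  regions are cut apart at all crossings. In the complementary state the strands turn around the
  unshaded corners.\<close>

lemma succ_pos:
  assumes c: "c \<in> E" "k < 4" "\<not> col (c, k)"
  shows "\<exists>l<4. succ pos (arc_at D (c, k)) = arc_at D (c, l) \<and> col (c, l) \<and> (l + 1) mod 4 = k"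
    "succ (E - pos) (arc_at D (c, k)) = arc_at D (c, (k + 1) mod 4)"
proof -
  have pos: "c \<in> pos \<longleftrightarrow> even k"
    using col_parity[OF c(1,2)] col_parity[OF c(1), of 1] c by (auto simp: pos_eq)
  have "(mate (c \<in> pos) k + 1) mod 4 = k" "mate (c \<in> E - pos) k = (k + 1) mod 4"
    using pos c(1) less_four_cases[OF c(2)] by (auto simp: mate_def)
  then show "\<exists>l<4. succ pos (arc_at D (c, k)) = arc_at D (c, l) \<and> col (c, l) \<and> (l + 1) mod 4 = k"
    "succ (E - pos) (arc_at D (c, k)) = arc_at D (c, (k + 1) mod 4)"
    using succ_arc_at[OF c] col_mate[OF c(1,2)] c(3) mate_less[OF c(2)] by metis+
qed

lemma succ_arc_of_next:
  assumes c: "c \<in> E" "k < 4"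
  shows "col (c, k) \<Longrightarrow> succ pos (arc_at D (c, (k + 1) mod 4)) = arc_at D (c, k)"
proof -
  assume col: "col (c, k)"
  have k': "(k + 1) mod 4 < 4" by simp
  have "\<not> col (c, (k + 1) mod 4)" using col_alternates[OF c] col by blast
  then obtain l where l: "l < 4" "succ pos (arc_at D (c, (k + 1) mod 4)) = arc_at D (c, l)"
    "(l + 1) mod 4 = (k + 1) mod 4" using succ_pos(1)[OF c(1) k'] by blast
  have "l = k" using l(1,3) c(2) less_four_cases[OF l(1)] less_four_cases[OF c(2)] by auto
  then show ?thesis using l(2) by simp
qed

lemma R_pos_imp_sh:
  assumes "(a, b) \<in> R pos"
  shows "sh a = sh b"
proof -
  let ?Q = "{(a, b). a \<in> A \<and> b \<in> A \<and> sh a = sh b}"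
  have "equiv A ?Q" by (rule equivI) (auto simp: refl_on_def sym_def trans_def)
  moreover have "(a, succ pos a) \<in> ?Q" if a: "a \<in> A" for a
  proof -
    have "sh a = sh (succ pos a)"
      using a
    proof (cases rule: arc_cases)
      case (strand c k)
      obtain l where "l < 4" "succ pos (arc_at D (c, k)) = arc_at D (c, l)" "col (c, l)" "(l + 1) mod 4 = k"
        using succ_pos(1)[OF strand(1-3)] by blast
      then show ?thesis using sh_corner(1)[OF strand(1), of l] strand(4) by simp
    qed simp
    then show ?thesis using a succ_in[of "pos"] by auto
  qed
  then have "{(a, succ pos a) | a. a \<in> A} \<subseteq> ?Q" by blast
  ultimately have "R pos \<subseteq> ?Q" unfolding smoothing_rel_orbit orbit_rel_def by (rule eqv_gen_subset)
  then show ?thesis using assms by blast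
qed

lemma R_neg_imp_unsh:
  assumes "(a, b) \<in> R (E - pos)"
  shows "unsh a = unsh b"
proof -
  let ?Q = "{(a, b). a \<in> A \<and> b \<in> A \<and> unsh a = unsh b}"
  have "equiv A ?Q" by (rule equivI) (auto simp: refl_on_def sym_def trans_def)
  moreover have "(a, succ (E - pos) a) \<in> ?Q" if a: "a \<in> A" for a
  proof -
    have "unsh a = unsh (succ (E - pos) a)"
      using a
    proof (cases rule: arc_cases)
      case (strand c k)
      then show ?thesis using unsh_corner[OF strand(1-3)] succ_pos(2)[OF strand(1-3)] by simp
    qed simp
    then show ?thesis using a succ_in[of "E - pos"] by auto
  qed
  then have "{(a, succ (E - pos) a) | a. a \<in> A} \<subseteq> ?Q" by blast
  ultimately have "R (E - pos) \<subseteq> ?Q" unfolding smoothing_rel_orbit orbit_rel_def by (rule eqv_gen_subset)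
  then show ?thesis using assms by blast
qed

text \<open>A generating pair of \<open>region_rel\<close> is a corner, and in the state that cuts
  off the corners of its color the two arcs at this corner follow each other on a circle.\<close>

lemma region_rel_imp:
  assumes "(s, t) \<in> region_rel D"
  shows "shaded s \<longleftrightarrow> shaded t" "(fst s, fst t) \<in> R (if shaded s then pos else E - pos)"
proof -
  let ?Q = "{(s, t). fst s \<in> A \<and> fst t \<in> A \<and> (shaded s \<longleftrightarrow> shaded t) \<and>
    (fst s, fst t) \<in> R (if shaded s then pos else E - pos)}"
  have "equiv (A \<times> UNIV) ?Q"
  proof (rule equivI)
    show "refl_on (A \<times> UNIV) ?Q" using R_refl by (auto simp: refl_on_def)
    show "sym ?Q" by (rule symI) (auto dest: R_sym)
    show "trans ?Q" by (rule transI) (auto dest: R_trans)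
  qed auto
  moreover have "(ccw_side D (c, k), cw_side D (c, (k + 1) mod 4)) \<in> ?Q"
    if c: "c \<in> E" "k < 4" for c and k :: nat
  proof -
    have k': "(k + 1) mod 4 < 4" by simp
    note arcs = arc_at_in[OF c] arc_at_in[OF c(1) k']
    have sh: "shaded (ccw_side D (c, k)) \<longleftrightarrow> col (c, k)"
      "shaded (cw_side D (c, (k + 1) mod 4)) \<longleftrightarrow> col (c, k)"
      using shaded_cw[OF c(1) k'] col_alternates[OF c] by (simp_all add: col_def)
    have step: "(a, succ B a) \<in> R B" if "a \<in> A" for a B
      unfolding smoothing_rel_orbit using that succ_in[of B] by (intro orbit_rel_step) auto
    have "(arc_at D (c, k), arc_at D (c, (k + 1) mod 4)) \<in> R (if col (c, k) then pos else E - pos)"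
    proof (cases "col (c, k)")
      case True
      then show ?thesis using R_sym[OF step[OF arcs(2), of pos]] succ_arc_of_next[OF c True] by simp
    next
      case False
      then show ?thesis using step[OF arcs(1), of "E - pos"] succ_pos(2)[OF c False] by simp
    qed
    then show ?thesis using arcs sh by (simp add: ccw_side_def cw_side_def)
  qed
  then have "{(ccw_side D (c, k), cw_side D (c, (k + 1) mod 4)) |c k. c \<in> E \<and> k < 4} \<subseteq> ?Q" by blast
  ultimately have "region_rel D \<subseteq> ?Q" unfolding region_rel_def by (rule eqv_gen_subset)
  then show "shaded s \<longleftrightarrow> shaded t" "(fst s, fst t) \<in> R (if shaded s then pos else E - pos)"
    using assms by blast+
qed

lemma side_shaded: "a \<in> A \<Longrightarrow> shaded (shaded_side a)" "a \<in> A \<Longrightarrow> \<not> shaded (unshaded_side a)"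
  using shaded_iff[of a "shaded (a, True)"] shaded_iff[of a "\<not> shaded (a, True)"]
  by (auto simp: shaded_side_def unshaded_side_def)

lemma sh_eq_iff:
  assumes ab: "a \<in> A" "b \<in> A"
  shows "sh a = sh b \<longleftrightarrow> (a, b) \<in> R pos" "unsh a = unsh b \<longleftrightarrow> (a, b) \<in> R (E - pos)"
proof -
  have "(shaded_side a, shaded_side b) \<in> region_rel D" if "sh a = sh b"
    using that eq_equiv_class_iff[OF equiv_region] ab by (simp add: sh_def shaded_side_def)
  then show "sh a = sh b \<longleftrightarrow> (a, b) \<in> R pos"
    using R_pos_imp_sh region_rel_imp(2) side_shaded(1)[OF ab(1)] by (force simp: shaded_side_def)
  have "(unshaded_side a, unshaded_side b) \<in> region_rel D" if "unsh a = unsh b"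
    using that eq_equiv_class_iff[OF equiv_region] ab by (simp add: unsh_def unshaded_side_def)
  then show "unsh a = unsh b \<longleftrightarrow> (a, b) \<in> R (E - pos)"
    using R_neg_imp_unsh region_rel_imp(2) side_shaded(2)[OF ab(1)] by (force simp: unshaded_side_def)
qed

lemma regions_eq: "regions D = sh ` A \<union> unsh ` A"
proof (intro equalityI subsetI)
  fix C assume "C \<in> regions D"
  then obtain a b where a: "a \<in> A" "C = region_rel D `` {(a, b)}"
    by (auto simp: regions_def elim!: quotientE)
  then show "C \<in> sh ` A \<union> unsh ` A"
    unfolding sh_def unsh_def shaded_side_def unshaded_side_def by (cases "b \<longleftrightarrow> shaded (a, True)") auto
next
  fix C assume "C \<in> sh ` A \<union> unsh ` A"
  then show "C \<in> regions D"
    by (auto simp: regions_def sh_def unsh_def shaded_side_def unshaded_side_def intro: quotientI)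
qed

lemma sh_image: "sh ` A = S" and unsh_not_S: "S \<inter> unsh ` A = {}"
proof -
  have sh: "sh a \<in> S" if "a \<in> A" for a using side_shaded(1)[OF that] by (simp add: sh_def shaded_def)
  have un: "unsh a \<notin> S" if "a \<in> A" for a using side_shaded(2)[OF that] by (simp add: unsh_def shaded_def)
  show "S \<inter> unsh ` A = {}" using un by blast
  have "S \<subseteq> sh ` A \<union> unsh ` A" using checkerboard by (simp add: checkerboard_def regions_eq)
  then show "sh ` A = S" using sh un by blast
qed

lemma sh_in: "a \<in> A \<Longrightarrow> sh a \<in> S"
  using sh_image by blast

lemma finite_S: "finite S"
  using finite_imageI[OF finite_A, of sh] unfolding sh_image .

text \<open>The circles of these two states bound the regions of one color each. Together they count
  all regions, which is where the Euler characteristic of the sphere enters.\<close>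

lemma card_circles_extreme:
  "card (circles D pos) = card S" "card (circles D (E - pos)) + card S = card E + 2"
proof -
  have "card (circles D pos) = card (sh ` A)"
    unfolding circles_eq by (rule card_quotient_eq_card_image) (simp_all add: sh_eq_iff)
  then show "card (circles D pos) = card S" unfolding sh_image .
  have "card (circles D (E - pos)) = card (unsh ` A)"
    unfolding circles_eq by (rule card_quotient_eq_card_image) (simp_all add: sh_eq_iff)
  moreover have "card (regions D) = card S + card (unsh ` A)"
    unfolding regions_eq sh_image using unsh_not_S finite_A finite_S by (intro card_Un_disjoint) auto
  ultimately show "card (circles D (E - pos)) + card S = card E + 2" using euler by simp
qed

lemma ends_of_tait:
  assumes c: "c \<in> E"
  shows "ends_of G c = {sh (x c), sh (y c)}"
proof -
  have four: "{..<4::nat} = {0, 1, 2, 3}" by auto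
  have "ends_of G c = corner_region D c ` {k \<in> {0, 1, 2, 3}. col (c, k)}"
    using corner_in_iff by (auto simp: tait_graph_def four)
  also have "{k \<in> {0, 1, 2, 3}. col (c, k)} = (if col (c, 0) then {0, 2} else {1, 3})"
    using col_parity[OF c, of 1] col_parity[OF c, of 2] col_parity[OF c, of 3] by auto
  finally have ends: "ends_of G c = corner_region D c ` (if col (c, 0) then {0, 2} else {1, 3})" .
  show ?thesis
  proof (cases "col (c, 0)")
    case True
    then have "corner_region D c 0 = sh (arc_at D (c, 1))" "corner_region D c 2 = sh (arc_at D (c, 3))"
      using sh_corner(2)[OF c, of 0] sh_corner(2)[OF c, of 2] col_parity[OF c, of 2] by simp_all
    then show ?thesis using True by (simp add: ends x_def y_def)
  next
    case False
    have "corner_region D c 1 = sh (arc_at D (c, 2))"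
      using sh_corner(2)[OF c, of 1] col_parity[OF c, of 1] False by (simp add: numeral_2_eq_2)
    moreover have "corner_region D c 3 = sh (arc_at D (c, 0))"
      using sh_corner(2)[OF c, of 3] col_parity[OF c, of 3] False by simp
    moreover have "sh (arc_at D (c, 0)) = sh (x c)" "sh (arc_at D (c, 2)) = sh (y c)"
      using False by (simp_all add: x_def y_def)
    ultimately show ?thesis using False by (auto simp: ends)
  qed
qed

sublocale tait: finite_graph G "sh \<circ> x" "sh \<circ> y"
proof
  show "finite (verts G)" "verts G \<noteq> {}"
    using finite_S arcs_nonempty sh_in by (auto simp: tait_graph_def)
  show "finite (edges G)" using finite_E by (simp add: tait_graph_def)
  fix e assume "e \<in> edges G"
  then have e: "e \<in> E" by (simp add: tait_graph_def)
  show "ends_of G e = {(sh \<circ> x) e, (sh \<circ> y) e}" using ends_of_tait[OF e] by simp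
  show "(sh \<circ> x) e \<in> verts G" "(sh \<circ> y) e \<in> verts G"
    using sh_in x_in[OF e] y_in[OF e] by (simp_all add: tait_graph_def)
qed

lemma tait_simps: "verts G = S" "edges G = E"
  by (simp_all add: tait_graph_def)

text \<open>
  The circles of the state \<open>sd pos T\<close> bound a neighbourhood of the subgraph \<open>T\<close>. Their number is
  determined by a genus that cannot decrease when edges are added, vanishes for the empty graph, and
  vanishes for the whole graph by the Euler formula.
\<close>

definition genus :: "'a set \<Rightarrow> int"
  where "genus T = 2 * int (tait.num_components T) + int (card T) - int (card S) -
    int (card (circles D (sd pos T)))"

lemma state_subset: "T \<subseteq> E \<Longrightarrow> sd pos T \<subseteq> E"
  using sd_subset[OF pos_subset] .

text \<open>Adding an edge to the subgraph connects the shaded regions at \<open>x c\<close> and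
  \<open>y c\<close>, while the change of smoothing there relates no more than these two
  arcs.\<close>

lemma circles_in_components:
  assumes "T \<subseteq> E" "(a, b) \<in> R (sd pos T)"
  shows "(sh a, sh b) \<in> tait.conn T"
proof -
  have "finite T" using assms(1) finite_E by (rule finite_subset)
  then show ?thesis
    using assms
  proof (induction T arbitrary: a b)
    case empty
    then have "sh a = sh b" using R_pos_imp_sh by simp
    then show ?case using tait.conn_refl[of "sh b"] sh_in[OF R_in(2)[OF empty(2)]] by (simp add: tait_simps)
  next
    case (insert c T)
    have c: "c \<in> E" and T: "T \<subseteq> E" using insert by auto
    let ?B = "sd pos T"
    note B = state_subset[OF T]
    have J: "tait.conn (insert c T) = merge_rel (tait.conn T) (sh (x c)) (sh (y c))"
      using tait.conn_insert[of T c] T c by (simp add: tait_simps)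
    have "(a, b) \<in> R (flip c ?B)" using insert by (simp add: sd_insert)
    moreover have "R (flip c ?B) \<subseteq> merge_rel (R ?B) (x c) (y c)"
    proof (cases "(x c, y c) \<in> R ?B")
      case True
      show ?thesis by (rule order_trans[OF flip_unmerge(3)[OF B c True] subset_merge])
    qed (simp add: flip_merge[OF B c])
    ultimately have "(a, b) \<in> merge_rel (R ?B) (x c) (y c)" by blast
    then show ?case using insert.IH[OF T] unfolding J merge_rel_def by blast
  qed
qed

text \<open>The quantity is twice the genus of the neighbourhood surface. An edge between two
  components also merges two circles, and all changes cancel; any other edge adds at most one
  circle, which the new edge itself balances.\<close>

lemma genus_insert:
  assumes T: "T \<subseteq> E" and c: "c \<in> E" "c \<notin> T"
  shows "genus T \<le> genus (insert c T)"
proof -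
  have fin: "finite T" using T finite_E by (rule finite_subset)
  note B = state_subset[OF T]
  have B': "sd pos (insert c T) = flip c (sd pos T)" using c by (simp add: sd_insert)
  have T': "T \<subseteq> edges G" "c \<in> edges G" using T c by (simp_all add: tait_simps)
  show ?thesis
  proof (cases "(sh (x c), sh (y c)) \<in> tait.conn T")
    case True
    then have "tait.num_components (insert c T) = tait.num_components T"
      using tait.num_components_insert(1)[OF T'] by simp
    moreover have "card (circles D (sd pos (insert c T))) \<le> card (circles D (sd pos T)) + 1"
      using card_circles_flip[OF B c(1)] unfolding B' by fastforce
    ultimately show ?thesis using fin c by (simp add: genus_def)
  next
    case False
    then have "tait.num_components T = tait.num_components (insert c T) + 1"
      using tait.num_components_insert(2)[OF T'] by simp
    moreover have "(x c, y c) \<notin> R (sd pos T)" using circles_in_components[OF T] False by blast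
    then have "card (circles D (sd pos T)) = card (circles D (sd pos (insert c T))) + 1"
      using card_circles_flip(1)[OF B c(1)] unfolding B' by simp
    ultimately show ?thesis using fin c by (simp add: genus_def)
  qed
qed

lemma genus_mono:
  assumes "T \<subseteq> U" "U \<subseteq> E"
  shows "genus T \<le> genus U"
proof -
  have fin: "finite (U - T)" using assms(2) finite_E by (meson Diff_subset finite_subset)
  have "V \<subseteq> U - T \<Longrightarrow> genus T \<le> genus (T \<union> V)" if "finite V" for V
    using that
  proof (induction V)
    case (insert c V)
    then have "genus (T \<union> V) \<le> genus (insert c (T \<union> V))"
      using assms by (intro genus_insert) auto
    then show ?case using insert by simp
  qed simp
  from this[OF fin order_refl] show ?thesis using assms(1) by (simp add: Un_absorb1)
qed

lemma conn_all: "tait.num_components E = 1"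
proof -
  let ?Q = "{(a, b). a \<in> A \<and> b \<in> A \<and> (sh a, sh b) \<in> tait.conn E}"
  have shA: "sh a \<in> verts G" if "a \<in> A" for a using sh_in[OF that] by (simp add: tait_simps)
  have "equiv A ?Q"
  proof (rule equivI)
    show "refl_on A ?Q" using tait.conn_refl shA by (auto simp: refl_on_def)
    show "sym ?Q" by (rule symI) (auto dest: tait.conn_sym)
    show "trans ?Q" by (rule transI) (auto dest: tait.conn_trans)
  qed auto
  moreover have "R (sd pos E) \<subseteq> ?Q" using circles_in_components[OF order_refl] R_in by blast
  moreover have "(x c, y c) \<in> ?Q" if "c \<in> E" for c
    using tait.conn_edge[of c E "sh (x c)" "sh (y c)"] ends_of_tait[OF that] x_in y_in that
    by (simp add: tait_simps)
  ultimately have full: "?Q = A \<times> A" by (rule connected[OF state_subset[OF order_refl]])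
  have full': "(sh a, sh b) \<in> tait.conn E" if "a \<in> A" "b \<in> A" for a b
  proof -
    have "(a, b) \<in> ?Q" unfolding full using that by simp
    then show ?thesis by simp
  qed
  have "(s, t) \<in> tait.conn E" if "s \<in> S" "t \<in> S" for s t
  proof -
    have "s \<in> sh ` A" "t \<in> sh ` A" using that unfolding sh_image .
    then show ?thesis using full' by (elim imageE) simp
  qed
  then have "tait.conn E = verts G \<times> verts G"
    using equiv_type[OF tait.equiv_conn] by (auto simp: tait_simps)
  then show ?thesis by (simp only: tait.num_components_1_iff)
qed

lemma genus_zero:
  assumes "T \<subseteq> E"
  shows "genus T = 0"
proof -
  have "genus {} = 0"
    using tait.num_components_empty card_circles_extreme(1) by (simp add: genus_def tait_simps)
  moreover have "sd pos E = E - pos" using pos_subset by (auto simp: sd_def)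
  then have "genus E = 0"
    using conn_all card_circles_extreme(2) by (simp add: genus_def)
  ultimately show ?thesis using genus_mono[of "{}" T] genus_mono[OF assms] assms by simp
qed

lemma card_circles_1_iff: "card (circles D B) = 1 \<longleftrightarrow> R B = A \<times> A"
  unfolding circles_eq by (rule card_quotient_1_iff[OF equiv_R arcs_nonempty])

text \<open>With genus zero there are 2 c + |T| - |S| circles, where c is the number of components.
  As |S| is at most c + |T|, this is at least c, hence at least 1, and a single circle forces
  equality in both estimates.\<close>

lemma spanning_tree_tree_iff: "spanning_tree G T \<longleftrightarrow> T \<subseteq> E \<and> tree (sd pos T)"
proof (cases "T \<subseteq> E")
  case True
  have "2 * int (tait.num_components T) + int (card T) = int (card S) + int (card (circles D (sd pos T)))"
    using genus_zero[OF True] by (simp add: genus_def)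
  moreover have "card S \<le> tait.num_components T + card T"
    using tait.card_verts_le[of T] True by (simp add: tait_simps)
  moreover have "tait.num_components T > 0" by (rule tait.num_components_pos)
  ultimately have "card (circles D (sd pos T)) = 1 \<longleftrightarrow> tait.num_components T = 1 \<and> card T + 1 = card S"
    by linarith
  then show ?thesis
    using True state_subset[OF True] unfolding tait.spanning_tree_iff tree_def card_circles_1_iff[symmetric]
    by (simp add: tait_simps)
qed (simp add: spanning_tree_def tait_simps)

lemma flip_sd: "flip c (sd pos T) = sd pos (flip c T)"
  by (auto simp: flip_def sd_def)

lemma live_lives_iff:
  assumes T: "spanning_tree G T" and e: "e \<in> E"
  shows "live G T e \<longleftrightarrow> e \<in> lives (sd pos T)"
proof -
  have "T \<subseteq> E" using T spanning_tree_tree_iff by blast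
  then have "spanning_tree G (flip f (flip e T)) \<longleftrightarrow> tree (flip f (flip e (sd pos T)))" if "f \<in> E" for f
    using flip_subset[OF that flip_subset[OF e]] by (simp add: flip_sd spanning_tree_tree_iff)
  then show ?thesis
    using live_iff[OF tait.finite_graph_axioms T, of e] e by (simp add: lives_def tait_simps)
qed

end

section \<open>Bidegrees of the critical states\<close>

text \<open>Turns counts into sums over all crossings, so that identities between counts can be
  checked at a single crossing.\<close>

lemma int_card_eq_sum: "finite E \<Longrightarrow> X \<subseteq> E \<Longrightarrow> int (card X) = (\<Sum>e\<in>E. of_bool (e \<in> X))"
  by (simp add: of_bool_def sum.If_cases Int_absorb1)

lemma bidegrees_match_iff:
  "bidegrees_match w k (i, j) (u, v) \<longleftrightarrow> u = j - i - w + 1 \<and> 4 * v = 2 * j - 4 * i - (w - k - 2)"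
proof -
  have "a = b / 2 - c - d / 4 \<longleftrightarrow> 4 * a = 2 * b - 4 * c - d" for a b c d :: rat
    by linarith
  then have "(of_int v :: rat) = of_int j / 2 - of_int i - of_int (w - k - 2) / 4 \<longleftrightarrow>
      4 * (of_int v :: rat) = 2 * of_int j - 4 * of_int i - of_int (w - k - 2)" .
  also have "\<dots> \<longleftrightarrow> (of_int (4 * v) :: rat) = of_int (2 * j - 4 * i - (w - k - 2))"
    by simp
  also have "\<dots> \<longleftrightarrow> 4 * v = 2 * j - 4 * i - (w - k - 2)"
    by (rule of_int_eq_iff)
  finally show ?thesis by (simp only: bidegrees_match_def case_prod_conv)
qed

context planar_diagram
begin

lemma circles_anchors:
  assumes T: "tree T" and U: "U \<subseteq> lives T"
  shows "bij_betw (\<lambda>i. circle (sd T U) (anchor T i)) (indices U) (circles D (sd T U))"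
proof (rule bij_betw_imageI)
  let ?B = "sd T U"
  show "inj_on (\<lambda>i. circle ?B (anchor T i)) (indices U)"
  proof (rule inj_onI)
    fix i j assume ij: "i \<in> indices U" "j \<in> indices U" "circle ?B (anchor T i) = circle ?B (anchor T j)"
    then have "(anchor T i, anchor T j) \<in> R ?B"
      using circle_eq_iff[OF anchor_arc[OF T U ij(1)] anchor_arc[OF T U ij(2)]] by blast
    then show "i = j" using anchors_distinct[OF T U ij(1,2)] by blast
  qed
  show "(\<lambda>i. circle ?B (anchor T i)) ` indices U = circles D ?B"
  proof (intro equalityI subsetI)
    fix C assume "C \<in> circles D ?B"
    then obtain a where a: "a \<in> A" "C = circle ?B a" by (rule circlesE)
    obtain i where i: "i \<in> indices U" "(a, anchor T i) \<in> R ?B"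
      using anchors_cover[OF T U a(1)] by blast
    have "C = circle ?B (anchor T i)"
      using circle_eq_iff[OF a(1) anchor_arc[OF T U i(1)]] i(2) a(2) by blast
    then show "C \<in> (\<lambda>i. circle ?B (anchor T i)) ` indices U" using i(1) by blast
  qed (use anchor_arc[OF T U] circle_in in blast)
qed

lemma state_tau_decode:
  assumes k: "(T, U, Z) \<in> codes"
  shows "state_tau D (decode (T, U, Z)) = 2 * int (card Z) - int (card U) - 1"
proof -
  note T = codesD[OF k]
  let ?f = "\<lambda>i. circle (sd T U) (anchor T i)"
  note bij = circles_anchors[OF T(1,2)]
  have fin: "finite U" using finite_code[OF k] by blast
  have "card (circles D (sd T U)) = card (indices U)" using bij_betw_same_card[OF bij] by simp
  also have "\<dots> = card U + 1" using fin by (simp add: indices_def card_image)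
  finally have c: "card (circles D (sd T U)) = card U + 1" .
  have inj: "inj_on ?f Z" using bij T(3) by (auto simp: bij_betw_def intro: inj_on_subset)
  have sub: "?f ` Z \<subseteq> circles D (sd T U)" using bij T(3) by (auto simp: bij_betw_def)
  have cz: "card (?f ` Z) = card Z" using inj by (rule card_image)
  have "card (circles D (sd T U) - ?f ` Z) = card U + 1 - card Z"
    using card_Diff_subset[OF finite_subset[OF sub finite_circles] sub] c cz by simp
  moreover have "card Z \<le> card U + 1" using card_mono[OF finite_circles sub] c cz by simp
  ultimately show ?thesis using cz by (simp add: state_tau_def decode_def)
qed

lemma two_state_i:
  assumes "B \<subseteq> E"
  shows "2 * state_i D (B, P) = writhe D - (int (card E) - 2 * int (card B))"
proof -
  have p: "pos_crossings D \<subseteq> E" using oriented by (simp add: oriented_link_diagram_def)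
  have "writhe D = (\<Sum>c\<in>E. 2 * of_bool (c \<in> pos_crossings D) - 1)"
    unfolding writhe_def by (intro sum.cong) auto
  also have "\<dots> = 2 * int (card (pos_crossings D)) - int (card E)"
    unfolding int_card_eq_sum[OF finite_E p] by (simp add: sum_subtractf sum_distrib_left)
  finally have w: "writhe D = 2 * int (card (pos_crossings D)) - int (card E)" .
  have "state_sigma D (B, P) = int (card E) - 2 * int (card B)"
    using card_Diff_subset[OF finite_subset[OF assms finite_E] assms] card_mono[OF finite_E assms]
    by (simp add: state_sigma_def)
  then show ?thesis by (simp add: state_i_def w)
qed

text \<open>Apart from the sign of the root circle, the comparison of both bidegrees splits into
  contributions of single crossings, which depend only on the sign of the edge, membership in
  \<open>T\<close> and liveness.\<close>

lemma critical_bidegree: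
  assumes T: "spanning_tree G T"
    and k: "k = num_pos G - num_neg G + 2 * (int (card (verts G)) - 1)"
  shows "bidegrees_match (writhe D) k (bideg (khovanov_group D) (decode (critical (sd pos T, b))))
    (bideg (UC G) (T, b))"
proof -
  let ?T = "sd pos T" and ?w = "writhe D"
  let ?L = "lives ?T"
  let ?B = "sd ?T ?L" and ?Z = "Some ` (?L \<inter> ?T) \<union> (if b then {} else {None})"
  have TE: "T \<subseteq> E" and tree: "tree ?T" using T by (simp_all add: spanning_tree_tree_iff)
  have code: "(?T, ?L, ?Z) \<in> codes" using critical_code[OF tree, of b] by (simp add: critical_def)
  define s where "s = decode (critical (?T, b))"
  have s: "s = decode (?T, ?L, ?Z)" by (simp add: s_def critical_def)
  have BE: "?B \<subseteq> E" using smoothing_subset[OF tree order_refl] .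
  have TE': "?T \<subseteq> E" using tree by (simp add: tree_def)
  have "finite (?L \<inter> ?T)" using finite_lives by simp
  then have "card ?Z = card (?L \<inter> ?T) + (if b then 0 else 1)"
    by (subst card_Un_disjoint) (auto simp: card_image)
  then have tau: "state_tau D s = 2 * int (card (?L \<inter> ?T)) + (if b then 0 else 2) - int (card ?L) - 1"
    unfolding s using state_tau_decode[OF code] by simp
  have i: "2 * state_i D s = ?w - (int (card E) - 2 * int (card ?B))"
    using two_state_i[OF BE] by (simp add: s decode_def)
  have j: "state_j D s = state_i D s + ?w - state_tau D s" by (simp add: state_j_def)
  have live: "live G T e \<longleftrightarrow> e \<in> ?L" if "e \<in> E" for e by (rule live_lives_iff[OF T that])
  have sub: "act_L G T \<subseteq> E" "act_l G T \<subseteq> E" "act_Lbar G T \<subseteq> E" "act_lbar G T \<subseteq> E" "act_D G T \<subseteq> E"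
    by (auto simp: act_L_def act_l_def act_Lbar_def act_lbar_def act_D_def tait_simps)
  have LT: "?L \<subseteq> E" "?L \<inter> ?T \<subseteq> E" "E \<inter> pos \<subseteq> E" "E - pos \<subseteq> E" using lives_subset by auto
  note cards = sub[THEN int_card_eq_sum[OF finite_E]] LT[THEN int_card_eq_sum[OF finite_E]]
    int_card_eq_sum[OF finite_E BE] int_card_eq_sum[OF finite_E TE] int_card_eq_sum[OF finite_E order_refl]
  note acts = act_L_def act_l_def act_Lbar_def act_lbar_def act_D_def
  \<comment> \<open>A live edge counts -1 exactly if its sign and its membership in the spanning
    tree disagree, that is if its crossing lies in \<open>?T\<close>.\<close>
  have u: "tree_u G T = int (card ?L) - 2 * int (card (?L \<inter> ?T))"
    unfolding tree_u_def cards sum_distrib_left sum_subtractf[symmetric] sum.distrib[symmetric]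
    by (intro sum.cong refl) (auto simp: acts tait_simps live in_sd_iff)
  have V: "int (card S) - 1 = int (card T)" using T by (simp add: tait.spanning_tree_iff tait_simps)
  \<comment> \<open>The term 2 (|V| - 1) of k is twice the number of tree edges, which makes k a sum
    over crossings too.\<close>
  have v: "int (card E) - 2 * int (card ?B) + 2 * tree_u G T + k = 4 * tree_v G T"
    unfolding k V tree_u_def tree_v_def num_pos_def num_neg_def tait_simps cards
      sum_distrib_left sum_subtractf[symmetric] sum.distrib[symmetric]
    by (intro sum.cong refl) (auto simp: acts tait_simps live in_sd_iff)
  have "bideg (khovanov_group D) s = (state_i D s, state_j D s)" by (simp add: khovanov_group_def)
  moreover have "bideg (UC G) (T, b) = (tree_u G T + (if b then 2 else 0), tree_v G T + (if b then 1 else 0))"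
    by (simp add: UC_def)
  ultimately show ?thesis
    unfolding s_def[symmetric] using i j tau u v by (simp add: bidegrees_match_iff)
qed

lemma bij_spanning_trees:
  "bij_betw (\<lambda>(T, b). (sd pos T, b)) (gens (UC G)) {(T, b :: bool). tree T}"
  by (rule bij_betw_byWitness[where f' = "\<lambda>(T, b). (sd pos T, b)"])
    (auto simp: UC_def spanning_tree_tree_iff tree_def dest: subsetD[OF state_subset])

lemma spanning_tree_retract:
  assumes k: "k = num_pos G - num_neg G + 2 * (int (card (verts G)) - 1)"
  shows "\<exists>dU. deformation_retract (bidegrees_match (writhe D) k)
    (UC G) (- 1, - 1) dU (khovanov_group D) (1, 0) (khovanov_d D)"
  unfolding khovanov_d_eq
proof (rule acyclic_matching.deformation_retract[OF acyclic_matching_khovanov[OF bij_spanning_trees]])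
  fix g assume "g \<in> gens (UC G)"
  then obtain T b where g: "g = (T, b)" "spanning_tree G T" by (auto simp: UC_def)
  then show "bidegrees_match (writhe D) k
      (bideg (khovanov_group D) ((decode \<circ> critical \<circ> (\<lambda>(T, b). (sd pos T, b))) g)) (bideg (UC G) g)"
    using critical_bidegree[OF g(2) k, of b] by simp
next
  fix q p p' assume "bidegrees_match (writhe D) k q p" "bidegrees_match (writhe D) k (q + (1, 0)) p'"
  \<comment> \<open>Raising i by 1 at fixed j lowers both u and v by 1.\<close>
  then show "p' = p + (- 1, - 1)"
    by (cases q; cases p; cases p') (auto simp: bidegrees_match_iff)
next
  fix q q' p assume "bidegrees_match (writhe D) k q p" "bidegrees_match (writhe D) k q' p"
  then show "q = q'"
    by (cases q; cases q'; cases p) (auto simp: bidegrees_match_iff)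
qed

end

theorem theorem4:
  fixes D :: "('c::linorder, 'a) link_diagram"
    and S :: "('a \<times> bool) set set"
    and G :: "(('a \<times> bool) set, 'c) signed_graph"
    and w k :: int
  assumes "connected_knot_diagram D"
    and "checkerboard D S"
    and "G = tait_graph D S"
    and "num_pos G \<ge> num_neg G"
    and "w = writhe D"
    and "k = num_pos G - num_neg G + 2 * (int (card (verts G)) - 1)"
  shows "\<exists>dU. differential (UC G) (- 1, - 1) dU \<and>
    deformation_retract (bidegrees_match w k)
      (UC G) (- 1, - 1) dU (khovanov_group D) (1, 0) (khovanov_d D) \<and>
    (\<forall>i j u v. u = j - i - w + 1 \<and>
        (of_int v :: rat) = of_int j / 2 - of_int i - of_int (w - k - 2) / 4 \<longrightarrow>
      homology (khovanov_group D) (1, 0) (khovanov_d D) (i, j)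
        \<cong> homology (UC G) (- 1, - 1) dU (u, v)) \<and>
    (\<forall>i j. (\<nexists>v. (of_int v :: rat) = of_int j / 2 - of_int i - of_int (w - k - 2) / 4) \<longrightarrow>
      trivial_group (homology (khovanov_group D) (1, 0) (khovanov_d D) (i, j)))"
proof -
  interpret planar_diagram D S
    using assms(1,2) unfolding connected_knot_diagram_def connected_link_diagram_def
    by unfold_locales auto
  obtain dU where retract: "deformation_retract (bidegrees_match w k)
      (UC G) (- 1, - 1) dU (khovanov_group D) (1, 0) (khovanov_d D)"
    using spanning_tree_retract[of k] assms by blast
  have "homology (khovanov_group D) (1, 0) (khovanov_d D) (i, j) \<cong> homology (UC G) (- 1, - 1) dU (u, v)"
    if "bidegrees_match w k (i, j) (u, v)" for i j u v
  proof (rule homology_iso[OF retract that])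
    show "bidegrees_match w k ((i, j) - (1, 0)) ((u, v) - (- 1, - 1))"
      using that by (simp add: bidegrees_match_iff)
  next
    fix q p p' assume "bidegrees_match w k q p" "bidegrees_match w k q p'"
    then show "p' = p" by (cases q; cases p; cases p') (simp add: bidegrees_match_iff)
  next
    fix q q' p assume "bidegrees_match w k q p" "bidegrees_match w k q' p"
    then show "q = q'" by (cases q; cases q'; cases p) (simp add: bidegrees_match_iff)
  qed
  moreover have "trivial_group (homology (khovanov_group D) (1, 0) (khovanov_d D) (i, j))"
    if "\<nexists>v. (of_int v :: rat) = of_int j / 2 - of_int i - of_int (w - k - 2) / 4" for i j
    by (rule homology_trivial[OF retract]) (use that in \<open>auto simp: bidegrees_match_def\<close>)
  moreover have "differential (UC G) (- 1, - 1) dU"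
    using retract by (simp add: deformation_retract_def)
  ultimately show ?thesis
    using retract by (intro exI[of _ dU]) (simp add: bidegrees_match_def)
qed

end
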